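(* Let $m\ge2$, let $d_1,\dots,d_m\ge1$ be integers, $d=d_1+\cdots+d_m$. There is a constant $C_{m,d}$, depending only on $m$ and $d$, such that the following holds. Let $\mathcal G$ be an incomparable family in $\mathcal D^1\times\cdots\times\mathcal D^m$, where each $\mathcal D^i$ is a dyadic grid of cubes in $\mathbb R^{d_i}$. Then for every $1<p\le2$ and every real-valued $f\in L^p(\mathbb R^d)$, $$\|M_{\mathcal G}f\|_p\le C_{m,d}\,(p')^{m-1}\|f\|_p,\qquad p'=\frac{p}{p-1}.$$
   Context: A dyadic grid of cubes in $\mathbb R^n$ is a collection of half-open axis-parallel cubes with side lengths $2^k$, $k\in\mathbb Z$, such that for every $k\in\mathbb Z$ the cubes of side length $2^k$ in the collection partition $\mathbb R^n$, and any two intersecting cubes of the collection are nested. Elements of $\mathcal D^1\times\cdots\times\mathcal D^m$ are the rectangles $I=I^1\times\cdots\times I^m\subset\mathbb R^d=\mathbb R^{d_1}\times\cdots\times\mathbb R^{d_m}$ with $I^i\in\mathcal D^i$. A family $\mathcal G$ of such rectangles is incomparable if no two distinct members contain one another. Its maximal function is $$M_{\mathcal G}f(x)=\sup_{I\in\mathcal G,\ x\in I}\frac1{|I|}\int_I|f|,$$ with the convention that an empty supremum is zero. $\|\cdot\|_p$ is the $L^p(\mathbb R^d)$ norm. *)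

theory Defs
  imports "HOL-Analysis.Analysis" "HOL-Library.Disjoint_Sets"
begin

text \<open>
  Dimensions vary inside the statement, so Euclidean spaces are not type-indexed.  A point of
  \<open>\<real>\<^sup>n\<close> is an extensional function on \<open>{..<n}\<close>, and a point of
  \<open>\<real>\<^sup>d = \<real>\<^bsup>\<delta> 0\<^esup> \<times> \<dots> \<times> \<real>\<^bsup>\<delta> (m - 1)\<^esup>\<close> is an extensional function on \<open>{..<m}\<close> whose \<open>i\<close>-th
  value is a point of \<open>\<real>\<^bsup>\<delta> i\<^esup>\<close>.  Blocks are numbered from 0.
\<close>

definition borel_space :: "nat \<Rightarrow> (nat \<Rightarrow> real) measure" where
  "borel_space n = Pi\<^sub>M {..<n} (\<lambda>_. lborel)"

text \<open>Lebesgue measure: the completion makes the Lebesgue measurable sets (rather than only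
  the Borel sets) measurable, as with \<^const>\<open>lebesgue\<close>.\<close>

definition lebesgue_blocks :: "nat \<Rightarrow> (nat \<Rightarrow> nat) \<Rightarrow> (nat \<Rightarrow> nat \<Rightarrow> real) measure" where
  "lebesgue_blocks m \<delta> = completion (Pi\<^sub>M {..<m} (\<lambda>i. borel_space (\<delta> i)))"

definition cube :: "nat \<Rightarrow> int \<Rightarrow> (nat \<Rightarrow> real) set \<Rightarrow> bool" where
  "cube n k Q \<longleftrightarrow> (\<exists>a. Q = (\<Pi>\<^sub>E j\<in>{..<n}. {a j ..< a j + 2 powi k}))"

definition dyadic_grid :: "nat \<Rightarrow> (nat \<Rightarrow> real) set set \<Rightarrow> bool" where
  "dyadic_grid n D \<longleftrightarrow>
     (\<forall>Q\<in>D. \<exists>k. cube n k Q) \<and>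
     (\<forall>k. partition_on (space (borel_space n)) {Q \<in> D. cube n k Q}) \<and>
     (\<forall>Q\<in>D. \<forall>R\<in>D. Q \<inter> R \<noteq> {} \<longrightarrow> Q \<subseteq> R \<or> R \<subseteq> Q)"

definition grid_rectangles ::
    "nat \<Rightarrow> (nat \<Rightarrow> (nat \<Rightarrow> real) set set) \<Rightarrow> (nat \<Rightarrow> nat \<Rightarrow> real) set set" where
  "grid_rectangles m D = {\<Pi>\<^sub>E i\<in>{..<m}. I i | I. \<forall>i<m. I i \<in> D i}"

definition incomparable :: "'a set set \<Rightarrow> bool" where
  "incomparable G \<longleftrightarrow> (\<forall>I\<in>G. \<forall>J\<in>G. I \<noteq> J \<longrightarrow> \<not> I \<subseteq> J)"

text \<open>Valued in \<^typ>\<open>ennreal\<close>, where the empty supremum is 0.\<close>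

definition maximal_function :: "'a measure \<Rightarrow> 'a set set \<Rightarrow> ('a \<Rightarrow> real) \<Rightarrow> 'a \<Rightarrow> ennreal" where
  "maximal_function M G f x =
     (SUP I\<in>{I \<in> G. x \<in> I}. (\<integral>\<^sup>+y\<in>I. ennreal \<bar>f y\<bar> \<partial>M) / emeasure M I)"

text \<open>Powers with exponent \<open>p > 0\<close>, so that \<open>\<infinity>\<^sup>p = \<infinity>\<close>.\<close>

definition ennpowr :: "ennreal \<Rightarrow> real \<Rightarrow> ennreal" where
  "ennpowr a p = (if a = \<infinity> then \<infinity> else ennreal (enn2real a powr p))"

definition Lp_norm :: "'a measure \<Rightarrow> real \<Rightarrow> ('a \<Rightarrow> ennreal) \<Rightarrow> ennreal" where
  "Lp_norm M p g = ennpowr (\<integral>\<^sup>+x. ennpowr (g x) p \<partial>M) (1 / p)"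

definition Lp_space :: "'a measure \<Rightarrow> real \<Rightarrow> ('a \<Rightarrow> real) set" where
  "Lp_space M p = {f \<in> borel_measurable M. Lp_norm M p (\<lambda>x. ennreal \<bar>f x\<bar>) < \<infinity>}"

end

(* The estimate is reduced to indicator functions f = 1_B, for which it says that on average over k
   the sets U_k covered by rectangles of density about 2^-k satisfy
   sum_{k <= K} 2^-k |U_k| <= C K^(m-1) |B|.  This goes by induction on the number m of factors.
   Write a rectangle as Q x R with Q in the first factor, let k be the level of its density and let
   i(x) be the level of the density of the slice B^x in R.  Rectangles of which a disproportionate part
   is occupied by denser rectangles with longer first side are discarded by a weak type estimate.  For fixed x
   the rectangles are sorted by q = a i - k with a suitable constant a; there are O(K) values of q.
   If R' lies strictly inside R in the same class, incomparability forces Q' to be longer than Q, so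
   either R' has the smaller density and is superfluous, or the selection makes the R' rare inside R, and
   they are negligible compared with R.  Hence each class may be replaced by its maximal
   members, which are incomparable in m - 1 factors, and the induction costs a single factor K. *)

theory Submission
  imports Defs
begin

section \<open>Nested and sparse families\<close>


text \<open>The power of p' appears only at the end: weights \<open>2 powr (- \<theta> * k)\<close>
  against terms whose partial sums grow like \<open>K ^ (m - 1)\<close> cost \<open>\<theta>\<close>
  to the power - (m - 1), and \<theta> = (p - 1) / 2 is what is left of the exponent once the dyadic
  shells of f have been summed. Interpolating over the shells in the usual way would typically cost
  a further power of p'; therefore powers of averages are compared with powers of densities
  pointwise, before integrating.

  In the induction the obstacle is that slicing destroys incomparability: over one point x the
  second sides of incomparable rectangles may be nested. Within a class a i - k, a slice denser by e
  levels belongs to a rectangle denser by a e levels. Hence a crude weak type estimate, polynomial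
  in 1/t, suffices for discarding: its loss at t = 4^-e is outweighed by 2^-(a e).

  Only nested families of sets of positive finite measure in sigma-finite spaces are used, so
  dimensions cannot enter the constants.\<close>

definition nested :: "'a set set \<Rightarrow> bool" where
  "nested D \<longleftrightarrow> (\<forall>Q\<in>D. \<forall>R\<in>D. Q \<inter> R \<noteq> {} \<longrightarrow> Q \<subseteq> R \<or> R \<subseteq> Q)"

definition boxes :: "'a measure \<Rightarrow> 'a set set \<Rightarrow> bool" where
  "boxes M E \<longleftrightarrow> E \<subseteq> fmeasurable M \<and> (\<forall>R\<in>E. 0 < measure M R)"

definition level :: "'a measure \<Rightarrow> 'a set \<Rightarrow> nat \<Rightarrow> 'a set \<Rightarrow> bool" where
  "level M B k R \<longleftrightarrow> (1/2) ^ Suc k * measure M R < measure M (R \<inter> B) \<and>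
     measure M (R \<inter> B) \<le> (1/2) ^ k * measure M R"

text \<open>The exponent \<open>n\<close> will be the number of factors. This is cruder than the
  sharp logarithmic loss, but the estimate is finally consumed only at \<open>t = 1/2\<close>, for
  sparse subfamilies, and at \<open>t = (1/4) ^ e\<close>, where a gain in density pays for
  it.\<close>

definition weak_type :: "'a measure \<Rightarrow> 'a set set \<Rightarrow> real \<Rightarrow> nat \<Rightarrow> bool" where
  "weak_type M E A n \<longleftrightarrow> (\<forall>F B t. finite F \<and> F \<subseteq> E \<and> B \<in> fmeasurable M \<and> 0 < t \<and> t \<le> 1 \<longrightarrow>
     measure M (\<Union>{R\<in>F. t * measure M R \<le> measure M (R \<inter> B)}) \<le> A * (1 / t) ^ n * measure M B)"

definition level_bound :: "'a measure \<Rightarrow> 'a set set \<Rightarrow> real \<Rightarrow> nat \<Rightarrow> bool" where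
  "level_bound M E C r \<longleftrightarrow> (\<forall>F B K. finite F \<and> F \<subseteq> E \<and> incomparable F \<and> B \<in> fmeasurable M \<longrightarrow>
     (\<Sum>k\<le>K. (1/2) ^ k * measure M (\<Union>{R\<in>F. level M B k R})) \<le> C * real (K + 1) ^ r * measure M B)"

lemma level_unique:
  assumes "level M B k R" "level M B j R"
  shows "k = j"
proof -
  have aux: False if "level M B a R" "level M B b R" "a < b" for a b
  proof -
    have "(1/2::real) ^ b \<le> (1/2) ^ Suc a"
      using that(3) by (intro power_decreasing) auto
    then have "(1/2::real) ^ b * measure M R \<le> (1/2) ^ Suc a * measure M R"
      by (intro mult_right_mono) auto
    with that show False unfolding level_def by linarith
  qed
  show ?thesis using aux assms by (meson linorder_neqE_nat)
qed

lemma incomparableD: "incomparable G \<Longrightarrow> I \<in> G \<Longrightarrow> J \<in> G \<Longrightarrow> I \<subseteq> J \<Longrightarrow> I = J"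
  by (auto simp only: incomparable_def)

lemma nestedD: "nested D \<Longrightarrow> Q \<in> D \<Longrightarrow> R \<in> D \<Longrightarrow> x \<in> Q \<Longrightarrow> x \<in> R \<Longrightarrow> Q \<subseteq> R \<or> R \<subseteq> Q"
  unfolding nested_def by (metis IntI empty_iff)

lemma weak_typeD:
  assumes "weak_type M E A n" "finite F" "F \<subseteq> E" "B \<in> fmeasurable M" "0 < t" "t \<le> 1"
  shows "measure M (\<Union>{R\<in>F. t * measure M R \<le> measure M (R \<inter> B)}) \<le> A * (1 / t) ^ n * measure M B"
  using assms(1)[unfolded weak_type_def, rule_format, of F B t] assms(2-) by simp

lemma level_boundD:
  assumes "level_bound M E C r" "finite F" "F \<subseteq> E" "incomparable F" "B \<in> fmeasurable M"
  shows "(\<Sum>k\<le>K. (1/2) ^ k * measure M (\<Union>{R\<in>F. level M B k R})) \<le> C * real (K + 1) ^ r * measure M B"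
  using assms(1)[unfolded level_bound_def, rule_format, of F B K] assms(2-) by simp

lemma fmeasurable_Union_boxes:
  "boxes M E \<Longrightarrow> F \<subseteq> E \<Longrightarrow> finite F \<Longrightarrow> \<Union>F \<in> fmeasurable M"
  unfolding boxes_def by (intro fmeasurable.finite_Union) auto

lemma sum_measure_disjoint_le:
  assumes "finite P" "disjoint_family_on e P" "\<And>R. R \<in> P \<Longrightarrow> e R \<in> fmeasurable M"
    "\<And>R. R \<in> P \<Longrightarrow> e R \<subseteq> B" "B \<in> fmeasurable M"
  shows "(\<Sum>R\<in>P. measure M (e R)) \<le> measure M B"
proof -
  have "(\<Sum>R\<in>P. measure M (e R)) = measure M (\<Union>(e ` P))"
    using assms by (intro measure_finite_Union[symmetric]) (auto dest: fmeasurableD fmeasurableD2)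
  also have "\<dots> \<le> measure M B"
    using assms by (intro measure_mono_fmeasurable) auto
  finally show ?thesis .
qed

lemma maximal_subfamily:
  assumes "finite F"
  obtains P where "P \<subseteq> F" "incomparable P" "\<And>R. R \<in> F \<Longrightarrow> \<exists>S\<in>P. R \<subseteq> S"
proof
  let ?P = "{S\<in>F. \<forall>R\<in>F. S \<subseteq> R \<longrightarrow> R = S}"
  show "?P \<subseteq> F" by auto
  show "incomparable ?P" unfolding incomparable_def by auto
  show "\<exists>S\<in>?P. R \<subseteq> S" if "R \<in> F" for R
    using finite_has_maximal2[OF assms that] by auto
qed

lemma nested_subset: "nested E \<Longrightarrow> F \<subseteq> E \<Longrightarrow> nested F"
  unfolding nested_def by blast

lemma incomparable_nested_disjoint:
  assumes "incomparable P" "nested P"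
  shows "disjoint_family_on (\<lambda>R. R) P"
  unfolding disjoint_family_on_def
proof (intro ballI impI)
  fix R S assume RS: "R \<in> P" "S \<in> P" "R \<noteq> S"
  have 1: "\<not> R \<subseteq> S"
    using incomparableD[OF assms(1) RS(1,2)] RS(3) by (rule contrapos_nn[rotated])
  have 2: "\<not> S \<subseteq> R"
    using incomparableD[OF assms(1) RS(2,1)] RS(3)[symmetric] by (rule contrapos_nn[rotated])
  show "R \<inter> S = {}"
  proof (rule ccontr)
    assume "R \<inter> S \<noteq> {}"
    then obtain x where "x \<in> R" "x \<in> S" by blast
    then show False using nestedD[OF assms(2) RS(1,2)] 1 2 by iprover
  qed
qed

text \<open>The maximal members of a nested family are disjoint and have the same union, so the
  hypothesis can be summed over them. Several weighted sets \<open>W j\<close> are allowed because a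
  rectangle is later tested against all its slice layers at once; a single set gives the usual weak
  type estimate.\<close>

lemma nested_weak_type_sum:
  assumes "boxes M D" "nested D" "finite F" "F \<subseteq> D" "finite J"
    and W: "\<And>j. j \<in> J \<Longrightarrow> W j \<in> fmeasurable M" and c: "\<And>j. j \<in> J \<Longrightarrow> 0 \<le> c j" and "0 \<le> l"
    and big: "\<And>Q. Q \<in> F \<Longrightarrow> l * measure M Q \<le> (\<Sum>j\<in>J. c j * measure M (Q \<inter> W j))"
  shows "l * measure M (\<Union>F) \<le> (\<Sum>j\<in>J. c j * measure M (W j))"
proof -
  obtain P where P: "P \<subseteq> F" "incomparable P" "\<And>R. R \<in> F \<Longrightarrow> \<exists>S\<in>P. R \<subseteq> S"
    using maximal_subfamily[OF \<open>finite F\<close>] by metis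
  have fin: "finite P" by (rule finite_subset[OF P(1) assms(3)])
  have disj: "disjoint_family_on (\<lambda>R. R) P"
    by (rule incomparable_nested_disjoint[OF P(2) nested_subset[OF assms(2) subset_trans[OF P(1) assms(4)]]])
  have fm: "R \<in> fmeasurable M" if "R \<in> P" for R
    using that P(1) assms(1,4) unfolding boxes_def by blast
  have "\<Union>F = \<Union>P" using P by blast
  then have "l * measure M (\<Union>F) = (\<Sum>Q\<in>P. l * measure M Q)"
    using measure_finite_Union[OF fin, of "\<lambda>R. R" M] disj fm
    by (simp add: sum_distrib_left subset_iff fmeasurableD fmeasurableD2)
  also have "\<dots> \<le> (\<Sum>Q\<in>P. \<Sum>j\<in>J. c j * measure M (Q \<inter> W j))"
    using P big by (intro sum_mono) auto
  also have "\<dots> = (\<Sum>j\<in>J. c j * (\<Sum>Q\<in>P. measure M (Q \<inter> W j)))"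
    by (subst sum.swap) (simp add: sum_distrib_left)
  also have "\<dots> \<le> (\<Sum>j\<in>J. c j * measure M (W j))"
  proof (intro sum_mono mult_left_mono c)
    fix j assume j: "j \<in> J"
    show "(\<Sum>Q\<in>P. measure M (Q \<inter> W j)) \<le> measure M (W j)"
      using disj fm W[OF j] fin
      by (intro sum_measure_disjoint_le) (auto simp: disjoint_family_on_def)
  qed
  finally show ?thesis .
qed

lemma nested_weak_type:
  assumes "boxes M D" "nested D"
  shows "weak_type M D 1 1"
  unfolding weak_type_def
proof (intro allI impI)
  fix F B and t :: real
  assume *: "finite F \<and> F \<subseteq> D \<and> B \<in> fmeasurable M \<and> 0 < t \<and> t \<le> 1"
  have "t * measure M (\<Union>{R\<in>F. t * measure M R \<le> measure M (R \<inter> B)})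
      \<le> (\<Sum>j\<in>{()}. 1 * measure M B)"
    using * assms by (intro nested_weak_type_sum[where W = "\<lambda>_. B"]) auto
  then show "measure M (\<Union>{R\<in>F. t * measure M R \<le> measure M (R \<inter> B)}) \<le> 1 * (1 / t) ^ 1 * measure M B"
    using * by (simp add: field_simps)
qed

text \<open>Incomparable members of a nested family are disjoint and each has at most one level, so
  the sets \<open>R \<inter> B\<close> are disjoint parts of \<open>B\<close> across all levels
  together and no power of \<open>K\<close> is lost. The 2 is the ratio of the two ends of a density
  band.\<close>

lemma nested_level_bound:
  assumes bx: "boxes M D" and "nested D"
  shows "level_bound M D 2 0"
  unfolding level_bound_def
proof (intro allI impI)
  fix F B K
  assume *: "finite F \<and> F \<subseteq> D \<and> incomparable F \<and> B \<in> fmeasurable M"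
  let ?F = "\<lambda>k. {R\<in>F. level M B k R}"
  have disj: "disjoint_family_on (\<lambda>R. R) F"
    using * nested_subset[OF assms(2)] by (intro incomparable_nested_disjoint) simp_all
  have fm: "R \<in> fmeasurable M" if "R \<in> F" for R
    using that * bx unfolding boxes_def by blast
  have "(\<Sum>k\<le>K. (1/2) ^ k * measure M (\<Union>(?F k))) \<le> (\<Sum>k\<le>K. \<Sum>R\<in>?F k. 2 * measure M (R \<inter> B))"
  proof (intro sum_mono)
    fix k
    have "(1/2) ^ k * measure M (\<Union>(?F k)) \<le> (1/2) ^ k * (\<Sum>R\<in>?F k. measure M R)"
      using * fm by (intro mult_left_mono measure_Union_le) (auto dest: fmeasurableD)
    also have "\<dots> \<le> (\<Sum>R\<in>?F k. 2 * measure M (R \<inter> B))"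
      unfolding sum_distrib_left by (intro sum_mono) (auto simp: level_def)
    finally show "(1/2) ^ k * measure M (\<Union>(?F k)) \<le> (\<Sum>R\<in>?F k. 2 * measure M (R \<inter> B))" .
  qed
  also have "\<dots> = (\<Sum>R\<in>(\<Union>k\<le>K. ?F k). 2 * measure M (R \<inter> B))"
    using * level_unique by (intro sum.UNION_disjoint[symmetric]) (auto, fast+)
  also have "\<dots> \<le> (\<Sum>R\<in>F. 2 * measure M (R \<inter> B))"
    using * by (intro sum_mono2) auto
  also have "\<dots> \<le> 2 * measure M B"
    unfolding sum_distrib_left[symmetric]
    using disj fm * by (intro mult_left_mono sum_measure_disjoint_le) (auto simp: disjoint_family_on_def)
  finally show "(\<Sum>k\<le>K. (1/2) ^ k * measure M (\<Union>(?F k))) \<le> 2 * real (K + 1) ^ 0 * measure M B"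
    by simp
qed

text \<open>Greedy: a rectangle is kept unless half of it is covered by those already kept.\<close>

lemma sparse_subfamily:
  assumes bx: "boxes M E" and wt: "weak_type M E A n" and F: "finite F" "F \<subseteq> E"
  obtains S where "S \<subseteq> F"
    "\<And>P. P \<subseteq> S \<Longrightarrow> (\<Sum>R\<in>P. measure M R) \<le> 2 * measure M (\<Union>P)"
    "measure M (\<Union>F) \<le> (1 + A * 2 ^ n) * measure M (\<Union>S)"
proof -
  \<comment> \<open>\<open>e R\<close> is the part of \<open>R\<close> not yet covered at the moment
    \<open>R\<close> is kept. The condition for rejection remains true afterwards, since
    \<open>\<Union>S\<close> only grows.\<close>
  have "\<exists>S e. S \<subseteq> F \<and> disjoint_family_on e S \<and>
      (\<forall>R\<in>S. e R \<subseteq> R \<and> e R \<in> fmeasurable M \<and> measure M R \<le> 2 * measure M (e R)) \<and>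
      (\<forall>R\<in>F - S. 1/2 * measure M R \<le> measure M (R \<inter> \<Union>S))"
    using F
  proof (induction F rule: finite_induct)
    case empty
    then show ?case by (auto simp: disjoint_family_on_def)
  next
    case (insert R F)
    then obtain S e where S: "S \<subseteq> F" "disjoint_family_on e S"
        "\<forall>R\<in>S. e R \<subseteq> R \<and> e R \<in> fmeasurable M \<and> measure M R \<le> 2 * measure M (e R)"
        "\<forall>R\<in>F - S. 1/2 * measure M R \<le> measure M (R \<inter> \<Union>S)"
      by auto
    have US: "\<Union>S \<in> fmeasurable M"
      using S(1) insert finite_subset by (intro fmeasurable_Union_boxes[OF bx]) auto
    have R: "R \<in> fmeasurable M" using insert bx unfolding boxes_def by auto
    show ?case
    proof (cases "1/2 * measure M R \<le> measure M (R \<inter> \<Union>S)")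
      case True
      with S show ?thesis by (intro exI[of _ S] exI[of _ e]) auto
    next
      case False
      have RS: "R \<notin> S" using S insert by auto
      have "measure M R = measure M (R \<inter> \<Union>S) + measure M (R - \<Union>S)"
        using measure_Un2[of "R \<inter> \<Union>S" M R] R US
        by (simp add: Un_absorb1 Diff_Int_distrib2 fmeasurable_Int_fmeasurable Diff_Int fmeasurableD)
      then have half: "measure M R \<le> 2 * measure M (R - \<Union>S)" using False by linarith
      have mono: "measure M (R' \<inter> \<Union>S) \<le> measure M (R' \<inter> \<Union>(insert R S))" if "R' \<in> F" for R'
      proof (intro measure_mono_fmeasurable)
        have "R' \<in> fmeasurable M" using that insert bx unfolding boxes_def by auto
        then show "R' \<inter> \<Union>S \<in> sets M" "R' \<inter> \<Union>(insert R S) \<in> fmeasurable M"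
          using US R by (auto intro!: fmeasurable_Int_fmeasurable)
      qed auto
      show ?thesis
      proof (intro exI[of _ "insert R S"] exI[of _ "e(R := R - \<Union>S)"] conjI)
        show "insert R S \<subseteq> insert R F" using S by auto
        show "disjoint_family_on (e(R := R - \<Union> S)) (insert R S)"
        proof -
          have 1: "e x \<inter> (R - \<Union>S) = {}" if "x \<in> S" for x
            using S(3) that by blast
          have 2: "x \<noteq> R" if "x \<in> S" for x using that RS by blast
          show ?thesis
            using S(2) 1 2 by (simp add: disjoint_family_on_def Int_commute)
        qed
        show "\<forall>Ra\<in>insert R S. (e(R := R - \<Union> S)) Ra \<subseteq> Ra \<and> (e(R := R - \<Union> S)) Ra \<in> fmeasurable M \<and>
            measure M Ra \<le> 2 * measure M ((e(R := R - \<Union> S)) Ra)"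
          using S RS half R US by (auto simp: fmeasurable_Diff)
        show "\<forall>Ra\<in>insert R F - insert R S. 1 / 2 * measure M Ra \<le> measure M (Ra \<inter> \<Union> (insert R S))"
          using S mono by (metis DiffE DiffI insert_iff order_trans)
      qed
    qed
  qed
  then obtain S e where S: "S \<subseteq> F" "disjoint_family_on e S"
        "\<And>R. R \<in> S \<Longrightarrow> e R \<subseteq> R" "\<And>R. R \<in> S \<Longrightarrow> e R \<in> fmeasurable M"
        "\<And>R. R \<in> S \<Longrightarrow> measure M R \<le> 2 * measure M (e R)"
        "\<And>R. R \<in> F - S \<Longrightarrow> 1/2 * measure M R \<le> measure M (R \<inter> \<Union>S)"
    by metis
  have finS: "finite S" using S F finite_subset by blast
  have US: "\<Union>S \<in> fmeasurable M"
    using S(1) F finS by (intro fmeasurable_Union_boxes[OF bx]) auto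
  let ?N = "{R\<in>F. 1/2 * measure M R \<le> measure M (R \<inter> \<Union>S)}"
  have UN: "\<Union>?N \<in> fmeasurable M"
    using F by (intro fmeasurable_Union_boxes[OF bx]) auto
  show thesis
  proof
    show "S \<subseteq> F" by fact
  next
    fix P assume P: "P \<subseteq> S"
    have "(\<Sum>R\<in>P. measure M R) \<le> 2 * (\<Sum>R\<in>P. measure M (e R))"
      unfolding sum_distrib_left using P S by (intro sum_mono) auto
    also have "(\<Sum>R\<in>P. measure M (e R)) \<le> measure M (\<Union>P)"
    proof (rule sum_measure_disjoint_le)
      show "finite P" using P finS finite_subset by blast
      show "disjoint_family_on e P" using S(2) P disjoint_family_on_mono by blast
      show "\<Union>P \<in> fmeasurable M"
        using P S(1) F finS finite_subset by (intro fmeasurable_Union_boxes[OF bx]) auto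
      show "e R \<in> fmeasurable M" "e R \<subseteq> \<Union>P" if "R \<in> P" for R
        using that P S(3)[of R] S(4)[of R] by auto
    qed
    finally show "(\<Sum>R\<in>P. measure M R) \<le> 2 * measure M (\<Union>P)" by simp
  next
    have "measure M (\<Union>F) \<le> measure M (\<Union>S \<union> \<Union>?N)"
      using S(6) US UN F bx by (intro measure_mono_fmeasurable)
        (auto intro: fmeasurableD[OF fmeasurable_Union_boxes[OF bx]])
    also have "\<dots> \<le> measure M (\<Union>S) + measure M (\<Union>?N)"
      using US UN by (intro measure_Un_le) auto
    \<comment> \<open>The rejected rectangles have density at least 1/2 in \<open>\<Union>S\<close>,
      which here takes the place of \<open>B\<close>.\<close>
    also have "measure M (\<Union>?N) \<le> A * (1 / (1/2)) ^ n * measure M (\<Union>S)"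
      by (rule weak_typeD[OF wt F US]) simp_all
    finally show "measure M (\<Union>F) \<le> (1 + A * 2 ^ n) * measure M (\<Union>S)"
      by (simp add: algebra_simps)
  qed
qed


section \<open>Layers of different density and their maximal members\<close>

lemma sum_half_powers_le: "finite S \<Longrightarrow> (\<Sum>e\<in>S. (1/2::real) ^ e) \<le> 2"
  using sum_le_suminf[of "\<lambda>e. (1/2::real) ^ e" S] suminf_geometric[of "1/2::real"] by simp

text \<open>Each of the ranges \<open>i \<le> j\<close> and \<open>j < i\<close> gives a geometric
  series of sum at most \<open>2 * (1/2) ^ i\<close>. For \<open>j < i\<close> the weight exceeds
  \<open>(1/2) ^ i\<close> by \<open>2 ^ (i - j)\<close>, which is why rarity is demanded with
  powers of 1/4: powers of 1/2 would only balance it, and the sum would grow with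
  \<open>i\<close>.\<close>

lemma geometric_interaction:
  fixes i :: nat
  assumes "i \<le> N"
  shows "(\<Sum>j\<le>N. (1/2) ^ j * (if i \<le> j then 1 else 2 * (1/4) ^ (i - j))) \<le> 4 * (1/2::real) ^ i"
proof -
  let ?c = "\<lambda>j. (1/2::real) ^ j * (if i \<le> j then 1 else 2 * (1/4) ^ (i - j))"
  have "(\<Sum>j\<le>N. ?c j) = (\<Sum>j\<in>{i..N}. ?c j) + (\<Sum>j<i. ?c j)"
    using assms by (subst sum.union_disjoint[symmetric]) (auto intro!: sum.cong)
  also have "(\<Sum>j\<in>{i..N}. ?c j) = (1/2) ^ i * (\<Sum>e\<in>(\<lambda>j. j - i) ` {i..N}. (1/2) ^ e)"
    unfolding sum_distrib_left
    by (subst sum.reindex) (auto simp: inj_on_def power_add[symmetric] intro!: sum.cong)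
  also have "\<dots> \<le> (1/2) ^ i * 2"
    by (intro mult_left_mono sum_half_powers_le) auto
  also have "(\<Sum>j<i. ?c j) = (1/2) ^ i * (\<Sum>e\<in>(\<lambda>j. i - j - 1) ` {..<i}. (1/2) ^ e)"
    unfolding sum_distrib_left
  proof (subst sum.reindex)
    show "inj_on (\<lambda>j. i - j - 1) {..<i}" by (auto simp: inj_on_def)
    show "(\<Sum>j<i. ?c j) = sum ((\<lambda>e. (1 / 2) ^ i * (1 / 2) ^ e) \<circ> (\<lambda>j. i - j - 1)) {..<i}"
    proof (intro sum.cong refl)
      fix j assume j: "j \<in> {..<i}"
      then obtain e where e: "i = Suc (j + e)" using less_imp_Suc_add by auto
      have q: "(1/4::real) ^ Suc e = (1/2) ^ Suc e * (1/2) ^ Suc e"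
        by (simp only: power_mult_distrib[symmetric]) simp
      have "?c j = (1/2) ^ j * (2 * (1/4) ^ Suc e)"
        using e by (simp del: power_Suc)
      also have "\<dots> = (1/2) ^ i * (1/2) ^ e"
        unfolding q using e by (simp add: power_add)
      finally show "?c j = ((\<lambda>e. (1 / 2) ^ i * (1 / 2) ^ e) \<circ> (\<lambda>j. i - j - 1)) j"
        using e by simp
    qed
  qed
  also have "(1/2) ^ i * (\<Sum>e\<in>(\<lambda>j. i - j - 1) ` {..<i}. (1/2::real) ^ e) \<le> (1/2) ^ i * 2"
    by (intro mult_left_mono sum_half_powers_le) auto
  finally show ?thesis by simp
qed

text \<open>Sparsifying each layer makes the small high-density rectangles inside large ones negligible
  even in total measure, so only the maximal rectangles matter, and these are incomparable.\<close>

lemma principal_level_bound: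
  assumes bx: "boxes M E" and wt: "weak_type M E A n" and lb: "level_bound M E C r"
    and "0 \<le> A" and B: "B \<in> fmeasurable M"
    and H: "\<And>i. i \<le> N \<Longrightarrow> finite (H i)" "\<And>i. i \<le> N \<Longrightarrow> H i \<subseteq> E"
    and lev: "\<And>i R. i \<le> N \<Longrightarrow> R \<in> H i \<Longrightarrow> level M B i R"
    and rare: "\<And>i j R. i \<le> N \<Longrightarrow> j < i \<Longrightarrow> R \<in> H i \<Longrightarrow>
      measure M (\<Union>{R'\<in>H j. R' \<subset> R}) \<le> (1/4) ^ (i - j) * measure M R"
  shows "(\<Sum>i\<le>N. (1/2) ^ i * measure M (\<Union>(H i))) \<le>
    (1 + A * 2 ^ n) * (4 * (C * real (N + 1) ^ r * measure M B))"
proof -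
  let ?c = "1 + A * 2 ^ n"
  have c: "0 \<le> ?c" using \<open>0 \<le> A\<close> by simp
  have "\<exists>S. S \<subseteq> H i \<and> (\<forall>P. P \<subseteq> S \<longrightarrow> (\<Sum>R\<in>P. measure M R) \<le> 2 * measure M (\<Union>P)) \<and>
      measure M (\<Union>(H i)) \<le> ?c * measure M (\<Union>S)" if "i \<le> N" for i
    using sparse_subfamily[OF bx wt H(1)[OF that] H(2)[OF that]] by metis
  then obtain S where S: "\<And>i. i \<le> N \<Longrightarrow> S i \<subseteq> H i"
      "\<And>i P. i \<le> N \<Longrightarrow> P \<subseteq> S i \<Longrightarrow> (\<Sum>R\<in>P. measure M R) \<le> 2 * measure M (\<Union>P)"
      "\<And>i. i \<le> N \<Longrightarrow> measure M (\<Union>(H i)) \<le> ?c * measure M (\<Union>(S i))"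
    by metis
  have finS: "finite (S i)" if "i \<le> N" for i
    using finite_subset[OF S(1)[OF that] H(1)[OF that]] .
  have SE: "S i \<subseteq> E" if "i \<le> N" for i using S(1) H(2) that by blast
  let ?F = "\<Union>i\<le>N. S i"
  have finF: "finite ?F" using finS by auto
  obtain P where P: "P \<subseteq> ?F" "incomparable P" "\<And>R. R \<in> ?F \<Longrightarrow> \<exists>S\<in>P. R \<subseteq> S"
    using maximal_subfamily[OF finF] by metis
  have PE: "P \<subseteq> E" using P(1) SE by blast
  have finP: "finite P" using finite_subset[OF P(1) finF] .
  define p where "p i = measure M (\<Union>(P \<inter> S i))" for i
  have p0: "0 \<le> p i" for i unfolding p_def by simp
  have levP: "{R\<in>P. level M B i R} = P \<inter> S i" if "i \<le> N" for i
  proof (intro equalityI subsetI)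
    fix R assume "R \<in> {R\<in>P. level M B i R}"
    then have R: "R \<in> P" "level M B i R" by auto
    then obtain j where j: "j \<le> N" "R \<in> S j" using P(1) by auto
    then have "level M B j R" using S(1) lev by blast
    with R have "j = i" by (simp add: level_unique)
    then show "R \<in> P \<inter> S i" using R j by simp
  next
    fix R assume "R \<in> P \<inter> S i"
    then show "R \<in> {R\<in>P. level M B i R}" using S(1)[OF that] lev[OF that] by auto
  qed
  have fmU: "\<Union>X \<in> fmeasurable M" if "X \<subseteq> E" "finite X" for X
    by (rule fmeasurable_Union_boxes[OF bx that])
  \<comment> \<open>What the layer \<open>j\<close> covers strictly inside the maximal rectangles of
    layer \<open>i\<close>; it matters for \<open>j < i\<close>, where the inner rectangles are the
    denser ones.\<close>
  let ?Y = "\<lambda>i j. \<Union>R\<in>P \<inter> S i. \<Union>{R'\<in>S j. R' \<subset> R}"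
  have Y: "?Y i j \<in> fmeasurable M" if "i \<le> N" "j \<le> N" for i j
    using finP finS[OF that(2)] SE[OF that(2)] by (intro fmeasurable.finite_UN fmU) auto
  have Ym: "measure M (?Y i j) \<le> 2 * (1/4) ^ (i - j) * p i" if "j < i" "i \<le> N" for i j
  proof -
    have j: "j \<le> N" using that by simp
    have "measure M (?Y i j) \<le> (\<Sum>R\<in>P \<inter> S i. measure M (\<Union>{R'\<in>S j. R' \<subset> R}))"
      using finP finS[OF j] SE[OF j] by (intro measure_UNION_le) (auto intro!: fmeasurableD fmU)
    also have "\<dots> \<le> (\<Sum>R\<in>P \<inter> S i. (1/4) ^ (i - j) * measure M R)"
    proof (intro sum_mono)
      fix R assume R: "R \<in> P \<inter> S i"
      have "measure M (\<Union>{R'\<in>S j. R' \<subset> R}) \<le> measure M (\<Union>{R'\<in>H j. R' \<subset> R})"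
      proof (rule measure_mono_fmeasurable)
        show "\<Union>{R'\<in>S j. R' \<subset> R} \<subseteq> \<Union>{R'\<in>H j. R' \<subset> R}" using S(1)[OF j] by blast
        show "\<Union>{R'\<in>S j. R' \<subset> R} \<in> sets M"
          using finS[OF j] SE[OF j] by (intro fmeasurableD fmU) auto
        show "\<Union>{R'\<in>H j. R' \<subset> R} \<in> fmeasurable M"
          using H(1)[OF j] H(2)[OF j] by (intro fmU) auto
      qed
      also have "\<dots> \<le> (1/4) ^ (i - j) * measure M R"
        using R S(1)[OF that(2)] by (intro rare that) auto
      finally show "measure M (\<Union>{R'\<in>S j. R' \<subset> R}) \<le> (1/4) ^ (i - j) * measure M R" .
    qed
    also have "\<dots> = (1/4) ^ (i - j) * (\<Sum>R\<in>P \<inter> S i. measure M R)"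
      by (simp add: sum_distrib_left)
    \<comment> \<open>Sparseness is used here: overlaps inside \<open>P \<inter> S i\<close> cost
      only a factor 2 in passing from the sum of the measures to the measure \<open>p i\<close> of
      the union.\<close>
    also have "\<dots> \<le> (1/4) ^ (i - j) * (2 * p i)"
      unfolding p_def by (intro mult_left_mono S(2)[OF that(2)]) auto
    finally show ?thesis by simp
  qed
  have cover: "measure M (\<Union>(S j)) \<le> (\<Sum>i\<le>N. (if i \<le> j then 1 else 2 * (1/4) ^ (i - j)) * p i)"
    if j: "j \<le> N" for j
  proof -
    \<comment> \<open>For \<open>i \<le> j\<close> the whole maximal rectangle may serve as a cover,
      because the weights \<open>(1/2) ^ j\<close> decay in that direction; for \<open>i > j\<close>
      only the rare part is affordable.\<close>
    let ?Z = "\<lambda>i. if i \<le> j then \<Union>(P \<inter> S i) else ?Y i j"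
    have Z: "?Z i \<in> fmeasurable M" if "i \<le> N" for i
      using Y[OF that j] fmU[of "P \<inter> S i"] finP PE by auto
    have "\<Union>(S j) \<subseteq> (\<Union>i\<le>N. ?Z i)"
    proof
      fix x assume "x \<in> \<Union>(S j)"
      then obtain R where R: "R \<in> S j" "x \<in> R" by auto
      obtain Q where Q: "Q \<in> P" "R \<subseteq> Q" using P(3)[of R] R j by auto
      then obtain i where i: "i \<le> N" "Q \<in> S i" using P(1) by auto
      have "x \<in> ?Z i"
      proof (cases "i \<le> j")
        case True
        then show ?thesis using Q i R by auto
      next
        case False
        have "R \<noteq> Q"
        proof
          assume "R = Q"
          then have "level M B i R" "level M B j R"
            using lev[OF i(1)] lev[OF j] S(1)[OF i(1)] S(1)[OF j] R i by auto
          then show False using level_unique False by blast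
        qed
        then have "R \<subset> Q" using Q by auto
        then show ?thesis using False R Q i by auto
      qed
      then show "x \<in> (\<Union>i\<le>N. ?Z i)" using i by blast
    qed
    then have "measure M (\<Union>(S j)) \<le> measure M (\<Union>i\<le>N. ?Z i)"
      using fmU[OF SE[OF j] finS[OF j]] Z
      by (intro measure_mono_fmeasurable fmeasurable.finite_UN) auto
    also have "\<dots> \<le> (\<Sum>i\<le>N. measure M (?Z i))"
      using Z by (intro measure_UNION_le) (auto dest: fmeasurableD)
    also have "\<dots> \<le> (\<Sum>i\<le>N. (if i \<le> j then 1 else 2 * (1/4) ^ (i - j)) * p i)"
    proof (intro sum_mono)
      fix i assume "i \<in> {..N}"
      then show "measure M (?Z i) \<le> (if i \<le> j then 1 else 2 * (1/4) ^ (i - j)) * p i"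
        using Ym[of j i] by (auto simp: p_def)
    qed
    finally show ?thesis .
  qed
  have "(\<Sum>j\<le>N. (1/2) ^ j * measure M (\<Union>(H j))) \<le>
      (\<Sum>j\<le>N. (1/2) ^ j * (?c * (\<Sum>i\<le>N. (if i \<le> j then 1 else 2 * (1/4) ^ (i - j)) * p i)))"
  proof (intro sum_mono mult_left_mono)
    fix j assume "j \<in> {..N}"
    then have j: "j \<le> N" by simp
    show "measure M (\<Union>(H j)) \<le> ?c * (\<Sum>i\<le>N. (if i \<le> j then 1 else 2 * (1/4) ^ (i - j)) * p i)"
      using S(3)[OF j] mult_left_mono[OF cover[OF j] c] by linarith
  qed auto
  also have "\<dots> = ?c * (\<Sum>j\<le>N. \<Sum>i\<le>N. (1/2) ^ j * (if i \<le> j then 1 else 2 * (1/4) ^ (i - j)) * p i)"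
    by (simp add: sum_distrib_left mult_ac)
  also have "\<dots> = ?c * (\<Sum>i\<le>N. (\<Sum>j\<le>N. (1/2) ^ j * (if i \<le> j then 1 else 2 * (1/4) ^ (i - j))) * p i)"
    by (subst sum.swap) (simp add: sum_distrib_right)
  also have "\<dots> \<le> ?c * (\<Sum>i\<le>N. (4 * (1/2) ^ i) * p i)"
    using c p0 by (intro mult_left_mono sum_mono mult_right_mono geometric_interaction) auto
  also have "\<dots> = ?c * (4 * (\<Sum>i\<le>N. (1/2) ^ i * measure M (\<Union>{R\<in>P. level M B i R})))"
    using levP by (simp add: sum_distrib_left p_def mult_ac)
  also have "\<dots> \<le> ?c * (4 * (C * real (N + 1) ^ r * measure M B))"
    using c by (intro mult_left_mono level_boundD[OF lb finP PE P(2) B]) auto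
  finally show ?thesis .
qed

section \<open>Products and slices\<close>


text \<open>Slices of a set of finite measure are finite only almost everywhere, and
  \<open>enn2real\<close> sends an infinite value to 0. The pointwise inequality is therefore
  demanded only where all slices involved are finite, which is enough after integration.\<close>

lemma nn_integral_slices_le:
  fixes u v :: "nat \<Rightarrow> 'a \<Rightarrow> ennreal"
  assumes J: "finite J" "finite K"
    and m: "\<And>j. j \<in> J \<Longrightarrow> ennreal (m j) = (\<integral>\<^sup>+x. u j x \<partial>M)" "\<And>j. j \<in> J \<Longrightarrow> u j \<in> borel_measurable M"
    and b: "\<And>k. k \<in> K \<Longrightarrow> ennreal (b k) = (\<integral>\<^sup>+x. v k x \<partial>M)" "\<And>k. k \<in> K \<Longrightarrow> v k \<in> borel_measurable M"
    and nonneg: "\<And>j. j \<in> J \<Longrightarrow> 0 \<le> c j" "\<And>j. j \<in> J \<Longrightarrow> 0 \<le> m j"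
      "\<And>k. k \<in> K \<Longrightarrow> 0 \<le> d k" "\<And>k. k \<in> K \<Longrightarrow> 0 \<le> b k"
    and le: "\<And>x. x \<in> space M \<Longrightarrow> (\<forall>j\<in>J. u j x < \<infinity>) \<Longrightarrow> (\<forall>k\<in>K. v k x < \<infinity>) \<Longrightarrow>
      (\<Sum>j\<in>J. c j * enn2real (u j x)) \<le> (\<Sum>k\<in>K. d k * enn2real (v k x))"
  shows "(\<Sum>j\<in>J. c j * m j) \<le> (\<Sum>k\<in>K. d k * b k)"
proof -
  have fin: "AE x in M. \<forall>j\<in>L. w j x < \<infinity>"
    if "finite L" "\<And>j. j \<in> L \<Longrightarrow> ennreal (a j) = (\<integral>\<^sup>+x. w j x \<partial>M)"
      "\<And>j. j \<in> L \<Longrightarrow> w j \<in> borel_measurable M" for L :: "nat set" and a and w :: "nat \<Rightarrow> 'a \<Rightarrow> ennreal"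
  proof (rule AE_finite_allI[OF that(1)])
    fix j assume j: "j \<in> L"
    have "(\<integral>\<^sup>+x. w j x \<partial>M) \<noteq> \<infinity>" using that(2)[OF j] by (metis ennreal_neq_top infinity_ennreal_def)
    from nn_integral_PInf_AE[OF that(3)[OF j] this] show "AE x in M. w j x < \<infinity>"
      by eventually_elim (simp add: top.not_eq_extremum)
  qed
  have step: "ennreal (\<Sum>j\<in>L. e j * a j) = (\<integral>\<^sup>+x. (\<Sum>j\<in>L. ennreal (e j) * w j x) \<partial>M)"
    if "\<And>j. j \<in> L \<Longrightarrow> ennreal (a j) = (\<integral>\<^sup>+x. w j x \<partial>M)" "\<And>j. j \<in> L \<Longrightarrow> w j \<in> borel_measurable M"
      "\<And>j. j \<in> L \<Longrightarrow> 0 \<le> e j" "\<And>j. j \<in> L \<Longrightarrow> 0 \<le> a j"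
    for L :: "nat set" and a e and w :: "nat \<Rightarrow> 'a \<Rightarrow> ennreal"
  proof -
    have "ennreal (\<Sum>j\<in>L. e j * a j) = (\<Sum>j\<in>L. ennreal (e j) * ennreal (a j))"
      using that by (subst sum_ennreal[symmetric]) (auto simp: ennreal_mult)
    also have "\<dots> = (\<Sum>j\<in>L. \<integral>\<^sup>+x. ennreal (e j) * w j x \<partial>M)"
      using that by (intro sum.cong refl) (simp add: nn_integral_cmult)
    also have "\<dots> = (\<integral>\<^sup>+x. (\<Sum>j\<in>L. ennreal (e j) * w j x) \<partial>M)"
      using that by (intro nn_integral_sum[symmetric]) auto
    finally show ?thesis .
  qed
  have conv: "(\<Sum>j\<in>L. ennreal (e j) * w j) = ennreal (\<Sum>j\<in>L. e j * enn2real (w j))"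
    if "\<forall>j\<in>L. w j < \<infinity>" "\<And>j. j \<in> L \<Longrightarrow> 0 \<le> e j" for L :: "nat set" and e and w :: "nat \<Rightarrow> ennreal"
  proof -
    have "(\<Sum>j\<in>L. ennreal (e j) * w j) = (\<Sum>j\<in>L. ennreal (e j * enn2real (w j)))"
      using that by (intro sum.cong) (auto simp: ennreal_mult)
    also have "\<dots> = ennreal (\<Sum>j\<in>L. e j * enn2real (w j))"
      using that by (intro sum_ennreal) auto
    finally show ?thesis .
  qed
  have "ennreal (\<Sum>j\<in>J. c j * m j) = (\<integral>\<^sup>+x. (\<Sum>j\<in>J. ennreal (c j) * u j x) \<partial>M)"
    by (rule step[OF m nonneg(1,2)])
  also have "\<dots> \<le> (\<integral>\<^sup>+x. (\<Sum>k\<in>K. ennreal (d k) * v k x) \<partial>M)"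
  proof (rule nn_integral_mono_AE)
    have "AE x in M. \<forall>j\<in>J. u j x < \<infinity>" by (rule fin[OF J(1) m])
    moreover have "AE x in M. \<forall>k\<in>K. v k x < \<infinity>" by (rule fin[OF J(2) b])
    ultimately show "AE x in M. (\<Sum>j\<in>J. ennreal (c j) * u j x) \<le> (\<Sum>k\<in>K. ennreal (d k) * v k x)"
      using AE_space
    proof eventually_elim
      case (elim x)
      then show ?case
        using conv[OF elim(1) nonneg(1)] conv[OF elim(2) nonneg(3)] le[OF elim(3,1,2)]
        by (simp add: ennreal_leI)
    qed
  qed
  also have "\<dots> = ennreal (\<Sum>k\<in>K. d k * b k)"
    by (rule step[OF b nonneg(3,4), symmetric])
  finally show ?thesis
    using nonneg by (subst (asm) ennreal_le_iff) (auto intro!: sum_nonneg)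
qed

section \<open>Fubini in both directions and the weak type estimate for a product\<close>

definition product_boxes :: "'a set set \<Rightarrow> 'b set set \<Rightarrow> ('a \<times> 'b) set set" where
  "product_boxes D E = {Q \<times> R | Q R. Q \<in> D \<and> R \<in> E}"

context pair_sigma_finite
begin

lemma slices_le1:
  fixes J K :: "nat set"
  assumes "finite J" "finite K" "\<And>j. j \<in> J \<Longrightarrow> X j \<in> fmeasurable (M1 \<Otimes>\<^sub>M M2)"
      "\<And>k. k \<in> K \<Longrightarrow> Y k \<in> fmeasurable (M1 \<Otimes>\<^sub>M M2)"
    and "\<And>j. j \<in> J \<Longrightarrow> 0 \<le> c j" "\<And>k. k \<in> K \<Longrightarrow> 0 \<le> d k"
    and le: "\<And>x. x \<in> space M1 \<Longrightarrow> (\<And>j. j \<in> J \<Longrightarrow> Pair x -` X j \<in> fmeasurable M2) \<Longrightarrow>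
      (\<And>k. k \<in> K \<Longrightarrow> Pair x -` Y k \<in> fmeasurable M2) \<Longrightarrow>
      (\<Sum>j\<in>J. c j * measure M2 (Pair x -` X j)) \<le> (\<Sum>k\<in>K. d k * measure M2 (Pair x -` Y k))"
  shows "(\<Sum>j\<in>J. c j * measure (M1 \<Otimes>\<^sub>M M2) (X j)) \<le> (\<Sum>k\<in>K. d k * measure (M1 \<Otimes>\<^sub>M M2) (Y k))"
proof (rule nn_integral_slices_le[where u = "\<lambda>j x. emeasure M2 (Pair x -` X j)" and
      v = "\<lambda>k x. emeasure M2 (Pair x -` Y k)" and M = M1])
  have *: "ennreal (measure (M1 \<Otimes>\<^sub>M M2) Z) = (\<integral>\<^sup>+x. emeasure M2 (Pair x -` Z) \<partial>M1)"
    if "Z \<in> fmeasurable (M1 \<Otimes>\<^sub>M M2)" for Z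
    using that M2.emeasure_pair_measure_alt[of Z M1]
    by (metis emeasure_eq_measure2 fmeasurableD)
  show "ennreal (measure (M1 \<Otimes>\<^sub>M M2) (X j)) = (\<integral>\<^sup>+x. emeasure M2 (Pair x -` X j) \<partial>M1)" if "j \<in> J" for j
    by (rule *[OF assms(3)[OF that]])
  show "ennreal (measure (M1 \<Otimes>\<^sub>M M2) (Y k)) = (\<integral>\<^sup>+x. emeasure M2 (Pair x -` Y k) \<partial>M1)" if "k \<in> K" for k
    by (rule *[OF assms(4)[OF that]])
  fix x assume x: "x \<in> space M1" "\<forall>j\<in>J. emeasure M2 (Pair x -` X j) < \<infinity>" "\<forall>k\<in>K. emeasure M2 (Pair x -` Y k) < \<infinity>"
  have "Pair x -` X j \<in> fmeasurable M2" if "j \<in> J" for j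
    using x that fmeasurableD[OF assms(3)[OF that]] by (intro fmeasurableI sets_Pair1) auto
  moreover have "Pair x -` Y k \<in> fmeasurable M2" if "k \<in> K" for k
    using x that fmeasurableD[OF assms(4)[OF that]] by (intro fmeasurableI sets_Pair1) auto
  ultimately show "(\<Sum>j\<in>J. c j * enn2real (emeasure M2 (Pair x -` X j))) \<le>
      (\<Sum>k\<in>K. d k * enn2real (emeasure M2 (Pair x -` Y k)))"
    using le[OF x(1)] unfolding measure_def by blast
qed (use assms in \<open>auto intro!: measurable_emeasure_Pair1\<close>)

lemma slices_le2:
  fixes J K :: "nat set"
  assumes "finite J" "finite K" "\<And>j. j \<in> J \<Longrightarrow> X j \<in> fmeasurable (M1 \<Otimes>\<^sub>M M2)"
      "\<And>k. k \<in> K \<Longrightarrow> Y k \<in> fmeasurable (M1 \<Otimes>\<^sub>M M2)"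
    and "\<And>j. j \<in> J \<Longrightarrow> 0 \<le> c j" "\<And>k. k \<in> K \<Longrightarrow> 0 \<le> d k"
    and le: "\<And>x. x \<in> space M2 \<Longrightarrow> (\<And>j. j \<in> J \<Longrightarrow> (\<lambda>z. (z, x)) -` X j \<in> fmeasurable M1) \<Longrightarrow>
      (\<And>k. k \<in> K \<Longrightarrow> (\<lambda>z. (z, x)) -` Y k \<in> fmeasurable M1) \<Longrightarrow>
      (\<Sum>j\<in>J. c j * measure M1 ((\<lambda>z. (z, x)) -` X j)) \<le> (\<Sum>k\<in>K. d k * measure M1 ((\<lambda>z. (z, x)) -` Y k))"
  shows "(\<Sum>j\<in>J. c j * measure (M1 \<Otimes>\<^sub>M M2) (X j)) \<le> (\<Sum>k\<in>K. d k * measure (M1 \<Otimes>\<^sub>M M2) (Y k))"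
proof (rule nn_integral_slices_le[where u = "\<lambda>j x. emeasure M1 ((\<lambda>z. (z, x)) -` X j)" and
      v = "\<lambda>k x. emeasure M1 ((\<lambda>z. (z, x)) -` Y k)" and M = M2])
  have *: "ennreal (measure (M1 \<Otimes>\<^sub>M M2) Z) = (\<integral>\<^sup>+x. emeasure M1 ((\<lambda>z. (z, x)) -` Z) \<partial>M2)"
    if "Z \<in> fmeasurable (M1 \<Otimes>\<^sub>M M2)" for Z
    using that emeasure_pair_measure_alt2[of Z]
    by (metis emeasure_eq_measure2 fmeasurableD)
  show "ennreal (measure (M1 \<Otimes>\<^sub>M M2) (X j)) = (\<integral>\<^sup>+x. emeasure M1 ((\<lambda>z. (z, x)) -` X j) \<partial>M2)" if "j \<in> J" for j
    by (rule *[OF assms(3)[OF that]])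
  show "ennreal (measure (M1 \<Otimes>\<^sub>M M2) (Y k)) = (\<integral>\<^sup>+x. emeasure M1 ((\<lambda>z. (z, x)) -` Y k) \<partial>M2)" if "k \<in> K" for k
    by (rule *[OF assms(4)[OF that]])
  fix x assume x: "x \<in> space M2" "\<forall>j\<in>J. emeasure M1 ((\<lambda>z. (z, x)) -` X j) < \<infinity>" "\<forall>k\<in>K. emeasure M1 ((\<lambda>z. (z, x)) -` Y k) < \<infinity>"
  have "(\<lambda>z. (z, x)) -` X j \<in> fmeasurable M1" if "j \<in> J" for j
    using x that fmeasurableD[OF assms(3)[OF that]] by (intro fmeasurableI sets_Pair2) auto
  moreover have "(\<lambda>z. (z, x)) -` Y k \<in> fmeasurable M1" if "k \<in> K" for k
    using x that fmeasurableD[OF assms(4)[OF that]] by (intro fmeasurableI sets_Pair2) auto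
  ultimately show "(\<Sum>j\<in>J. c j * enn2real (emeasure M1 ((\<lambda>z. (z, x)) -` X j))) \<le>
      (\<Sum>k\<in>K. d k * enn2real (emeasure M1 ((\<lambda>z. (z, x)) -` Y k)))"
    using le[OF x(1)] unfolding measure_def by blast
qed (use assms in \<open>auto intro!: measurable_emeasure_Pair2\<close>)

lemma slice_le1:
  assumes "X \<in> fmeasurable (M1 \<Otimes>\<^sub>M M2)" "Y \<in> fmeasurable (M1 \<Otimes>\<^sub>M M2)" "0 \<le> d"
    and "\<And>x. x \<in> space M1 \<Longrightarrow> Pair x -` X \<in> fmeasurable M2 \<Longrightarrow> Pair x -` Y \<in> fmeasurable M2 \<Longrightarrow>
      measure M2 (Pair x -` X) \<le> d * measure M2 (Pair x -` Y)"
  shows "measure (M1 \<Otimes>\<^sub>M M2) X \<le> d * measure (M1 \<Otimes>\<^sub>M M2) Y"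
  using slices_le1[of "{0}" "{0}" "\<lambda>_. X" "\<lambda>_. Y" "\<lambda>_. 1" "\<lambda>_. d"] assms by simp

lemma slice_le2:
  assumes "X \<in> fmeasurable (M1 \<Otimes>\<^sub>M M2)" "Y \<in> fmeasurable (M1 \<Otimes>\<^sub>M M2)" "0 \<le> c"
    and "\<And>y. y \<in> space M2 \<Longrightarrow> (\<lambda>x. (x, y)) -` X \<in> fmeasurable M1 \<Longrightarrow> (\<lambda>x. (x, y)) -` Y \<in> fmeasurable M1 \<Longrightarrow>
      c * measure M1 ((\<lambda>x. (x, y)) -` X) \<le> measure M1 ((\<lambda>x. (x, y)) -` Y)"
  shows "c * measure (M1 \<Otimes>\<^sub>M M2) X \<le> measure (M1 \<Otimes>\<^sub>M M2) Y"
  using slices_le2[of "{0}" "{0}" "\<lambda>_. X" "\<lambda>_. Y" "\<lambda>_. c" "\<lambda>_. 1"] assms by simp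

lemma measure_Times:
  assumes "Q \<in> sets M1" "R \<in> sets M2"
  shows "measure (M1 \<Otimes>\<^sub>M M2) (Q \<times> R) = measure M1 Q * measure M2 R"
  using assms by (simp add: measure_def M2.emeasure_pair_measure_Times enn2real_mult)

lemma fmeasurable_Times:
  assumes "Q \<in> fmeasurable M1" "R \<in> fmeasurable M2"
  shows "Q \<times> R \<in> fmeasurable (M1 \<Otimes>\<^sub>M M2)"
proof (rule fmeasurableI)
  show "emeasure (M1 \<Otimes>\<^sub>M M2) (Q \<times> R) < \<infinity>"
    using assms by (simp add: M2.emeasure_pair_measure_Times fmeasurableD emeasure_eq_measure2
        flip: ennreal_mult)
qed (use assms in \<open>auto dest: fmeasurableD\<close>)

lemma boxes_product:
  assumes "boxes M1 D" "boxes M2 E"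
  shows "boxes (M1 \<Otimes>\<^sub>M M2) (product_boxes D E)"
  using assms unfolding boxes_def product_boxes_def
  by (auto intro!: fmeasurable_Times simp: measure_Times fmeasurableD subset_iff)

text \<open>Boxes have positive measure, hence are nonempty; so a rectangle kept as a plain set
  determines its sides as its two projections.\<close>

lemma product_boxesD:
  assumes "boxes M1 D" "boxes M2 E" "I \<in> product_boxes D E"
  shows "I = fst ` I \<times> snd ` I" "fst ` I \<in> D" "snd ` I \<in> E"
proof -
  obtain Q R where I: "I = Q \<times> R" "Q \<in> D" "R \<in> E"
    using assms(3) unfolding product_boxes_def by auto
  have "Q \<noteq> {}" "R \<noteq> {}" using I assms(1,2) unfolding boxes_def by auto
  then show "I = fst ` I \<times> snd ` I" "fst ` I \<in> D" "snd ` I \<in> E" using I by auto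
qed

lemma mem_product_boxes:
  assumes "boxes M1 D" "boxes M2 E" "I \<in> product_boxes D E"
  shows "(x, y) \<in> I \<longleftrightarrow> x \<in> fst ` I \<and> y \<in> snd ` I"
  by (subst (1) product_boxesD(1)[OF assms]) (simp only: mem_Sigma_iff)

lemma product_boxes_slice_Union:
  assumes "boxes M1 D" "boxes M2 E" "F \<subseteq> product_boxes D E"
  shows "(\<lambda>x. (x, y)) -` \<Union>F = \<Union>((`) fst ` {I\<in>F. y \<in> snd ` I})"
proof (intro set_eqI iffI)
  fix x assume "x \<in> (\<lambda>x. (x, y)) -` \<Union>F"
  then obtain I where I: "I \<in> F" "(x, y) \<in> I" by auto
  then show "x \<in> \<Union>((`) fst ` {I\<in>F. y \<in> snd ` I})"
    using mem_product_boxes[OF assms(1,2) subsetD[OF assms(3) I(1)], of x y] by blast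
next
  fix x assume "x \<in> \<Union>((`) fst ` {I\<in>F. y \<in> snd ` I})"
  then obtain I where I: "I \<in> F" "x \<in> fst ` I" "y \<in> snd ` I" by blast
  then show "x \<in> (\<lambda>x. (x, y)) -` \<Union>F"
    using mem_product_boxes[OF assms(1,2) subsetD[OF assms(3) I(1)], of x y] by blast
qed

lemma product_boxes_slice_Union':
  assumes "boxes M1 D" "boxes M2 E" "F \<subseteq> product_boxes D E"
  shows "Pair x -` \<Union>F = \<Union>((`) snd ` {I\<in>F. x \<in> fst ` I})"
proof (intro set_eqI iffI)
  fix y assume "y \<in> Pair x -` \<Union>F"
  then obtain I where I: "I \<in> F" "(x, y) \<in> I" by auto
  then show "y \<in> \<Union>((`) snd ` {I\<in>F. x \<in> fst ` I})"
    using mem_product_boxes[OF assms(1,2) subsetD[OF assms(3) I(1)], of x y] by blast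
next
  fix y assume "y \<in> \<Union>((`) snd ` {I\<in>F. x \<in> fst ` I})"
  then obtain I where I: "I \<in> F" "x \<in> fst ` I" "y \<in> snd ` I" by blast
  then show "y \<in> Pair x -` \<Union>F"
    using mem_product_boxes[OF assms(1,2) subsetD[OF assms(3) I(1)], of x y] by blast
qed

lemma measurable_slice:
  assumes "B \<in> sets (M1 \<Otimes>\<^sub>M M2)" "R \<in> sets M2"
  shows "(\<lambda>x. measure M2 (R \<inter> Pair x -` B)) \<in> borel_measurable M1"
proof -
  let ?X = "(space M1 \<times> R) \<inter> B"
  have "?X \<in> sets (M1 \<Otimes>\<^sub>M M2)" using assms by auto
  then have [measurable]: "(\<lambda>x. emeasure M2 (Pair x -` ?X)) \<in> borel_measurable M1"
    by (rule M2.measurable_emeasure_Pair)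
  have "(\<lambda>x. enn2real (emeasure M2 (Pair x -` ?X))) \<in> borel_measurable M1" by measurable
  moreover have "enn2real (emeasure M2 (Pair x -` ?X)) = measure M2 (R \<inter> Pair x -` B)"
    if "x \<in> space M1" for x
  proof -
    have "Pair x -` ?X = R \<inter> Pair x -` B" using that by auto
    then show ?thesis by (simp add: measure_def)
  qed
  ultimately show ?thesis by (simp cong: measurable_cong)
qed

text \<open>Fubini is used twice, through the intermediate set \<open>E1\<close>. If
  \<open>I\<close> has density at least \<open>t\<close>, the points of its first side whose slice
  has density below \<open>t/2\<close> account for at most half of that, so the remaining points
  \<open>T I\<close> fill a proportion \<open>t/2\<close> of the first side. \<open>E1\<close> is
  the union of the slabs over the sets \<open>T I\<close>. Fixing the first coordinate bounds
  \<open>E1\<close> by \<open>B\<close> through the estimate in \<open>M2\<close>; fixing the second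
  bounds \<open>\<Union>F\<close> by \<open>E1\<close> through nestedness of
  \<open>D\<close>.\<close>

lemma weak_type_product:
  assumes D: "boxes M1 D" "nested D" and E: "boxes M2 E" and wt: "weak_type M2 E A n" and "0 \<le> A"
  shows "weak_type (M1 \<Otimes>\<^sub>M M2) (product_boxes D E) (A * 2 ^ Suc n) (Suc n)"
  unfolding weak_type_def
proof (intro allI impI)
  let ?N = "M1 \<Otimes>\<^sub>M M2"
  fix F0 B and t :: real
  assume *: "finite F0 \<and> F0 \<subseteq> product_boxes D E \<and> B \<in> fmeasurable ?N \<and> 0 < t \<and> t \<le> 1"
  define F where "F = {I\<in>F0. t * measure ?N I \<le> measure ?N (I \<inter> B)}"
  have F: "finite F" "F \<subseteq> product_boxes D E" using * unfolding F_def by auto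
  have B: "B \<in> fmeasurable ?N" and t: "0 < t" "t \<le> 1" using * by auto
  note pb = product_boxesD[OF D(1) E subsetD[OF F(2)]]
  have Q: "fst ` I \<in> fmeasurable M1" "snd ` I \<in> fmeasurable M2" if "I \<in> F" for I
    using pb(2,3)[OF that] D(1) E unfolding boxes_def by auto
  define T where "T I = {x\<in>fst ` I. t/2 * measure M2 (snd ` I) \<le> measure M2 (snd ` I \<inter> Pair x -` B)}" for I
  have T: "T I \<in> fmeasurable M1" if "I \<in> F" for I
  proof (rule fmeasurableI2[OF Q(1)[OF that]])
    note [measurable] = measurable_slice[OF fmeasurableD[OF B] fmeasurableD[OF Q(2)[OF that]]]
    have "T I = {x\<in>space M1. t/2 * measure M2 (snd ` I) \<le> measure M2 (snd ` I \<inter> Pair x -` B)} \<inter> fst ` I"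
      unfolding T_def using sets.sets_into_space[OF fmeasurableD[OF Q(1)[OF that]]] by auto
    also have "\<dots> \<in> sets M1" using Q(1)[OF that] by (intro sets.Int) (measurable, auto)
    finally show "T I \<in> sets M1" .
  qed (auto simp: T_def)
  define E1 where "E1 = (\<Union>I\<in>F. T I \<times> snd ` I)"
  have E1: "E1 \<in> fmeasurable ?N"
    unfolding E1_def using F T Q by (intro fmeasurable.finite_UN fmeasurable_Times) auto
  have UF: "\<Union>F \<in> fmeasurable ?N"
    by (rule fmeasurable_Union_boxes[OF boxes_product[OF D(1) E] F(2,1)])
  have Tbig: "t/2 * measure M1 (fst ` I) \<le> measure M1 (T I)" if I: "I \<in> F" for I
  proof -
    let ?Q = "fst ` I" and ?R = "snd ` I"
    have IQ: "I = ?Q \<times> ?R" by (rule pb(1)[OF I])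
    have fm: "I \<inter> B \<in> fmeasurable ?N" "I \<in> fmeasurable ?N" "T I \<times> ?R \<in> fmeasurable ?N"
      using fmeasurable_Times[OF Q[OF I]] IQ B fmeasurable_Times[OF T[OF I] Q(2)[OF I]]
      by (auto intro: fmeasurable_Int_fmeasurable fmeasurableD)
    have split: "measure M2 (Pair x -` (I \<inter> B)) \<le>
        measure M2 (Pair x -` (T I \<times> ?R)) + t/2 * measure M2 (Pair x -` I)" for x
    proof (cases "x \<in> ?Q")
      case True
      have 1: "Pair x -` (I \<inter> B) = ?R \<inter> Pair x -` B" "Pair x -` I = ?R"
        using True by (subst IQ; auto)+
      show ?thesis
      proof (cases "x \<in> T I")
        case True
        have "Pair x -` (T I \<times> ?R) = ?R" using True by auto
        moreover have "measure M2 (?R \<inter> Pair x -` B) \<le> measure M2 ?R"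
          using Q(2)[OF I] B by (intro measure_mono_fmeasurable) (auto intro!: sets_Pair1)
        ultimately show ?thesis unfolding 1 using t by (simp add: add_increasing2)
      next
        case False
        then have "measure M2 (?R \<inter> Pair x -` B) \<le> t/2 * measure M2 ?R"
          using \<open>x \<in> ?Q\<close> unfolding T_def by simp
        then show ?thesis unfolding 1 by (simp add: add_increasing)
      qed
    next
      case False
      then have "Pair x -` (I \<inter> B) = {}" by (subst IQ) auto
      then show ?thesis using t by simp
    qed
    have "measure ?N (I \<inter> B) \<le> measure ?N (T I \<times> ?R) + t/2 * measure ?N I"
      using slices_le1[of "{0}" "{0, Suc 0}" "\<lambda>_. I \<inter> B" "\<lambda>k. if k = 0 then T I \<times> ?R else I" "\<lambda>_. 1"
          "\<lambda>k. if k = 0 then 1 else t/2"] fm split t by (simp add: numeral_2_eq_2)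
    then have "t * (measure M1 ?Q * measure M2 ?R) \<le> measure M1 (T I) * measure M2 ?R + t/2 * (measure M1 ?Q * measure M2 ?R)"
      using I unfolding F_def
      using measure_Times[of ?Q ?R] measure_Times[of "T I" ?R] IQ Q[OF I] T[OF I] by (simp add: fmeasurableD)
    then have "(t/2 * measure M1 ?Q) * measure M2 ?R \<le> measure M1 (T I) * measure M2 ?R"
      by (simp add: algebra_simps)
    moreover have "0 < measure M2 ?R" using pb(3)[OF I] E unfolding boxes_def by auto
    ultimately show ?thesis by simp
  qed
  have "measure ?N E1 \<le> (A * (2 / t) ^ n) * measure ?N B"
  proof (rule slice_le1[OF E1 B])
    fix x assume x: "x \<in> space M1" "Pair x -` E1 \<in> fmeasurable M2" "Pair x -` B \<in> fmeasurable M2"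
    let ?G = "{R\<in>(`) snd ` F. (t/2) * measure M2 R \<le> measure M2 (R \<inter> Pair x -` B)}"
    have "measure M2 (Pair x -` E1) \<le> measure M2 (\<Union>?G)"
    proof (rule measure_mono_fmeasurable)
      show "Pair x -` E1 \<subseteq> \<Union>?G" unfolding E1_def T_def by auto
      show "\<Union>?G \<in> fmeasurable M2"
        using F pb(3) by (intro fmeasurable_Union_boxes[OF E]) auto
    qed (use x in auto)
    also have "\<dots> \<le> A * (1 / (t/2)) ^ n * measure M2 (Pair x -` B)"
      using F pb(3) t x by (intro weak_typeD[OF wt]) auto
    finally show "measure M2 (Pair x -` E1) \<le> A * (2 / t) ^ n * measure M2 (Pair x -` B)" by simp
  qed (use \<open>0 \<le> A\<close> t in auto)
  moreover have "t/2 * measure ?N (\<Union>F) \<le> measure ?N E1"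
  proof (rule slice_le2)
    fix y assume y: "y \<in> space M2" "(\<lambda>x. (x, y)) -` E1 \<in> fmeasurable M1"
    let ?F = "(`) fst ` {I\<in>F. y \<in> snd ` I}"
    have "t/2 * measure M1 (\<Union>?F) \<le> (\<Sum>j\<in>{()}. 1 * measure M1 ((\<lambda>x. (x, y)) -` E1))"
    proof (rule nested_weak_type_sum[OF D, where W = "\<lambda>_. (\<lambda>x. (x, y)) -` E1"])
      show "finite ?F" "?F \<subseteq> D" using F pb by auto
      fix Q' assume "Q' \<in> ?F"
      then obtain I where I: "I \<in> F" "y \<in> snd ` I" "Q' = fst ` I" by auto
      have "t/2 * measure M1 Q' \<le> measure M1 (T I)" using Tbig I by simp
      also have "\<dots> \<le> measure M1 (Q' \<inter> (\<lambda>x. (x, y)) -` E1)"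
        using T[OF I(1)] I y(2) Q(1)[OF I(1)]
        by (intro measure_mono_fmeasurable) (auto simp: E1_def T_def intro!: fmeasurable_Int_fmeasurable)
      finally show "t/2 * measure M1 Q' \<le> (\<Sum>j\<in>{()}. 1 * measure M1 (Q' \<inter> (\<lambda>x. (x, y)) -` E1))"
        by simp
    qed (use y t in auto)
    moreover have "(\<lambda>x. (x, y)) -` \<Union>F = \<Union>?F"
      using F(2) by (intro product_boxes_slice_Union[OF D(1) E]) auto
    ultimately show "t/2 * measure M1 ((\<lambda>x. (x, y)) -` \<Union>F) \<le> measure M1 ((\<lambda>x. (x, y)) -` E1)"
      by simp
  qed (use UF E1 t in auto)
  ultimately have "t/2 * measure ?N (\<Union>F) \<le> (A * (2 / t) ^ n) * measure ?N B" by simp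
  then have "measure ?N (\<Union>F) \<le> (2 / t) * ((A * (2 / t) ^ n) * measure ?N B)"
    using t by (simp add: field_simps)
  also have "\<dots> = A * 2 ^ Suc n * (1 / t) ^ Suc n * measure ?N B"
    using t by (simp add: field_simps power_divide)
  finally show "measure ?N (\<Union>{I\<in>F0. t * measure ?N I \<le> measure ?N (I \<inter> B)}) \<le>
      A * 2 ^ Suc n * (1 / t) ^ Suc n * measure ?N B"
    unfolding F_def .
qed

end


section \<open>Selection by density\<close>

fun course_of_values :: "(nat \<Rightarrow> (nat \<Rightarrow> 'a) \<Rightarrow> 'a) \<Rightarrow> nat \<Rightarrow> 'a" where
  "course_of_values \<Phi> k = \<Phi> k (\<lambda>j. if j < k then course_of_values \<Phi> j else undefined)"

declare course_of_values.simps [simp del]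

lemma level_exists:
  assumes "(1/2) ^ Suc K * measure M R < measure M (R \<inter> B)" "measure M (R \<inter> B) \<le> measure M R"
  shows "\<exists>i\<le>K. level M B i R"
  using assms(1)
proof (induction K)
  case 0
  then show ?case using assms(2) by (auto simp: level_def)
next
  case (Suc K)
  show ?case
  proof (cases "(1/2) ^ Suc K * measure M R < measure M (R \<inter> B)")
    case True
    with Suc.IH show ?thesis using le_SucI by blast
  next
    case False
    with Suc.prems have "level M B (Suc K) R" unfolding level_def by simp
    then show ?thesis by blast
  qed
qed

text \<open>Strict inclusion of first sides is the relation that incomparability later produces
  between rectangles whose second sides are strictly nested. It also ensures that every dominating
  rectangle passes over each point of the first side of \<open>I\<close>.\<close>

definition dominated_part :: "('a \<times> 'b) set \<Rightarrow> ('a \<times> 'b) set set \<Rightarrow> 'b set" where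
  "dominated_part I T = snd ` I \<inter> \<Union>((`) snd ` {J\<in>T. fst ` I \<subset> fst ` J})"

text \<open>Shifting \<open>k\<close> by \<open>a * e\<close> extracts a factor
  \<open>(1/2) ^ (a * e)\<close>, which against \<open>(4 ^ e) ^ n\<close> leaves exactly
  \<open>(1/2) ^ e\<close>; summing over \<open>e\<close> then costs at most 2.\<close>

lemma shifted_sum_le:
  fixes v :: "nat \<Rightarrow> real"
  assumes "\<And>k. 0 \<le> v k" "0 \<le> A" and a: "a = 2 * n + 1"
  shows "(\<Sum>k\<le>K. (1/2) ^ k * (\<Sum>e\<in>{1..k}. if a * e \<le> k then A * (4 ^ e) ^ n * v (k - a * e) else 0))
    \<le> 2 * A * (\<Sum>k\<le>K. (1/2) ^ k * v k)"
proof -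
  have *: "(1/2) ^ k * (A * (4 ^ e) ^ n * v (k - a * e)) = A * (1/2) ^ e * ((1/2) ^ (k - a * e) * v (k - a * e))"
    if "a * e \<le> k" for k e
  proof -
    have "(1/2::real) ^ k = (1/2) ^ (k - a * e) * ((1/2) ^ a) ^ e"
      using that by (simp flip: power_mult power_add)
    moreover have "((1/2::real) ^ a) ^ e * (4 ^ e) ^ n = (1/2) ^ e"
    proof -
      have "((1/2::real) ^ a) ^ e * (4 ^ e) ^ n = ((1/2) ^ a * 4 ^ n) ^ e"
        by (simp add: power_mult_distrib power_mult[symmetric] mult.commute)
      also have "(1/2::real) ^ a * 4 ^ n = ((1/2)^2 * 4) ^ n * (1/2)"
        by (simp add: a power_mult power_mult_distrib)
      also have "\<dots> = 1/2" by (simp add: power2_eq_square)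
      finally show ?thesis .
    qed
    ultimately show ?thesis by (simp add: mult_ac)
  qed
  have "(\<Sum>k\<le>K. (1/2) ^ k * (\<Sum>e\<in>{1..k}. if a * e \<le> k then A * (4 ^ e) ^ n * v (k - a * e) else 0))
      = (\<Sum>k\<le>K. \<Sum>e\<in>{1..k}. if a * e \<le> k then A * (1/2) ^ e * ((1/2) ^ (k - a * e) * v (k - a * e)) else 0)"
    unfolding sum_distrib_left using * by (intro sum.cong refl) simp
  also have "\<dots> \<le> (\<Sum>k\<le>K. \<Sum>e\<in>{1..K}. if a * e \<le> k then A * (1/2) ^ e * ((1/2) ^ (k - a * e) * v (k - a * e)) else 0)"
    using assms by (intro sum_mono sum_mono2) auto
  also have "\<dots> = (\<Sum>e\<in>{1..K}. \<Sum>k\<le>K. if a * e \<le> k then A * (1/2) ^ e * ((1/2) ^ (k - a * e) * v (k - a * e)) else 0)"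
    by (rule sum.swap)
  also have "\<dots> \<le> (\<Sum>e\<in>{1..K}. A * (1/2) ^ e * (\<Sum>k\<le>K. (1/2) ^ k * v k))"
  proof (intro sum_mono)
    fix e
    have "(\<Sum>k\<le>K. if a * e \<le> k then A * (1/2) ^ e * ((1/2) ^ (k - a * e) * v (k - a * e)) else 0)
        = A * (1/2) ^ e * (\<Sum>k\<in>{a * e..K}. (1/2) ^ (k - a * e) * v (k - a * e))"
      unfolding sum_distrib_left by (intro sum.mono_neutral_cong_right) auto
    also have "(\<Sum>k\<in>{a * e..K}. (1/2) ^ (k - a * e) * v (k - a * e)) =
        (\<Sum>k\<in>(\<lambda>k. k - a * e) ` {a * e..K}. (1/2) ^ k * v k)"
      by (subst sum.reindex) (auto simp: inj_on_def)
    also have "\<dots> \<le> (\<Sum>k\<le>K. (1/2) ^ k * v k)"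
      using assms by (intro sum_mono2) auto
    finally show "(\<Sum>k\<le>K. if a * e \<le> k then A * (1/2) ^ e * ((1/2) ^ (k - a * e) * v (k - a * e)) else 0)
        \<le> A * (1/2) ^ e * (\<Sum>k\<le>K. (1/2) ^ k * v k)"
      using assms by (simp add: mult_left_mono)
  qed
  also have "\<dots> = (\<Sum>e\<in>{1..K}. (1/2) ^ e) * (A * (\<Sum>k\<le>K. (1/2) ^ k * v k))"
    unfolding sum_distrib_right by (intro sum.cong) auto
  also have "\<dots> \<le> 2 * (A * (\<Sum>k\<le>K. (1/2) ^ k * v k))"
    using assms by (intro mult_right_mono sum_half_powers_le mult_nonneg_nonneg sum_nonneg) auto
  finally show ?thesis by (simp add: mult_ac)
qed

text \<open>The 16 is 4 for passing to slice layers times 4 from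
  \<open>principal_level_bound\<close>. The factor \<open>1 + 2 * A\<close> pays for the selection,
  \<open>2 * n + 2 = a + 1\<close> for the number of classes relative to \<open>K + 1\<close>,
  \<open>1 + A * 2 ^ n\<close> for sparse subfamilies, and \<open>2 ^ r\<close> for replacing
  \<open>K + 2\<close> by \<open>2 * (K + 1)\<close>.\<close>

definition product_const :: "real \<Rightarrow> nat \<Rightarrow> real \<Rightarrow> nat \<Rightarrow> real" where
  "product_const A n C r = 16 * (1 + 2 * A) * real (2 * n + 2) * (1 + A * 2 ^ n) * C * 2 ^ r"

context pair_sigma_finite
begin

text \<open>The shift \<open>a = 2 * n + 1\<close> makes the gain \<open>2\<close> to the power \<open>- a * e\<close> in density beat the loss
  \<open>4\<close> to the power \<open>e * n\<close> of the weak type estimate for the discarded rectangles.\<close>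

lemma density_selection:
  assumes D: "boxes M1 D" and E: "boxes M2 E" and wt: "weak_type M2 E A n" and "0 \<le> A"
    and G: "finite G" "G \<subseteq> product_boxes D E" and lv: "\<And>k. lv k \<subseteq> G" and a: "a = 2 * n + 1"
  obtains S where "\<And>k. S k \<subseteq> lv k"
    "\<And>k e I. 1 \<le> e \<Longrightarrow> a * e \<le> k \<Longrightarrow> I \<in> S k \<Longrightarrow>
      measure M2 (dominated_part I (S (k - a * e))) \<le> (1/4) ^ e * measure M2 (snd ` I)"
    "\<And>K. (\<Sum>k\<le>K. (1/2) ^ k * measure (M1 \<Otimes>\<^sub>M M2) (\<Union>(lv k))) \<le>
      (1 + 2 * A) * (\<Sum>k\<le>K. (1/2) ^ k * measure (M1 \<Otimes>\<^sub>M M2) (\<Union>(S k)))"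
proof -
  let ?N = "M1 \<Otimes>\<^sub>M M2"
  let ?bad = "\<lambda>I e T. (1/4) ^ e * measure M2 (snd ` I) < measure M2 (dominated_part I T)"
  \<comment> \<open>Levels are treated from dense to sparse: whether a rectangle of level
    \<open>k\<close> is kept depends on the families already selected at the denser levels
    \<open>k - a * e\<close>. Testing against selected families, and not against all of
    \<open>lv\<close>, makes the discarded part chargeable to the selected one.\<close>
  define S where "S = course_of_values (\<lambda>k f. {I\<in>lv k. \<forall>e\<in>{1..k}. a * e \<le> k \<longrightarrow> \<not> ?bad I e (f (k - a * e))})"
  have S_eq: "S k = {I\<in>lv k. \<forall>e\<in>{1..k}. a * e \<le> k \<longrightarrow> \<not> ?bad I e (S (k - a * e))}" for k
  proof -
    have less: "k - a * e < k" if "e \<in> {1..k}" for e using that a by auto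
    show ?thesis
      unfolding S_def by (subst course_of_values.simps) (use less in auto)
  qed
  have Slv: "S k \<subseteq> lv k" for k using S_eq[of k] by blast
  have SG: "S k \<subseteq> G" for k using Slv lv by blast
  have SP: "S k \<subseteq> product_boxes D E" for k using SG G by blast
  have lvP: "lv k \<subseteq> product_boxes D E" for k using lv G by blast
  have bxN: "boxes ?N (product_boxes D E)" by (rule boxes_product[OF D E])
  have fmU: "\<Union>X \<in> fmeasurable ?N" if "X \<subseteq> G" for X
    using that G finite_subset by (intro fmeasurable_Union_boxes[OF bxN]) auto
  let ?Nb = "\<lambda>k e. {I\<in>lv k. a * e \<le> k \<and> ?bad I e (S (k - a * e))}"
  \<comment> \<open>Fix \<open>x\<close>. Whatever dominates a bad \<open>I\<close> over
    \<open>x\<close> also lies over \<open>x\<close>, so the dominated part of \<open>I\<close> is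
    contained in the slice of \<open>\<Union>(S (k - a * e))\<close>. The second side of
    \<open>I\<close> thus has density above \<open>(1/4) ^ e\<close> in that slice, and the weak
    type estimate in \<open>M2\<close> applies with the slice as the set \<open>B\<close>.\<close>
  have Nb: "measure ?N (\<Union>(?Nb k e)) \<le> A * (4 ^ e) ^ n * measure ?N (\<Union>(S (k - a * e)))" for k e
  proof (rule slice_le1)
    show "\<Union>(?Nb k e) \<in> fmeasurable ?N" using lv by (intro fmU) auto
    show "\<Union>(S (k - a * e)) \<in> fmeasurable ?N" by (intro fmU SG)
    show "0 \<le> A * (4 ^ e) ^ n" using \<open>0 \<le> A\<close> by simp
    fix x assume x: "Pair x -` \<Union>(S (k - a * e)) \<in> fmeasurable M2"
    let ?V = "Pair x -` \<Union>(S (k - a * e))"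
    have V: "?V = \<Union>((`) snd ` {J\<in>S (k - a * e). x \<in> fst ` J})"
      by (rule product_boxes_slice_Union'[OF D E SP])
    let ?F = "(`) snd ` {I\<in>?Nb k e. x \<in> fst ` I}"
    have FE: "?F \<subseteq> E" using product_boxesD(3)[OF D E] lvP by blast
    have finF: "finite ?F" using finite_subset[OF lv G(1), of k] by auto
    have sub: "\<Union>?F \<subseteq> \<Union>{R\<in>?F. (1/4) ^ e * measure M2 R \<le> measure M2 (R \<inter> ?V)}"
    proof -
      have "(1/4) ^ e * measure M2 R \<le> measure M2 (R \<inter> ?V)" if "R \<in> ?F" for R
      proof -
        from that obtain I where "R = snd ` I" "I \<in> {I\<in>?Nb k e. x \<in> fst ` I}" by (rule imageE)
        then have I: "I \<in> ?Nb k e" "x \<in> fst ` I" "R = snd ` I" by auto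
        have R: "R \<in> fmeasurable M2" using that FE E unfolding boxes_def by blast
        have "dominated_part I (S (k - a * e)) \<subseteq> R \<inter> ?V"
          unfolding dominated_part_def V using I by blast
        moreover have "dominated_part I (S (k - a * e)) \<in> sets M2"
        proof -
          have "snd ` J \<in> sets M2" if "J \<in> S (k - a * e)" for J
            using product_boxesD(3)[OF D E subsetD[OF SP that]] E unfolding boxes_def by auto
          moreover have "finite (S (k - a * e))" using finite_subset[OF SG G(1)] .
          ultimately show ?thesis
            unfolding dominated_part_def using R I(3) by (intro sets.Int sets.finite_Union) auto
        qed
        ultimately have "measure M2 (dominated_part I (S (k - a * e))) \<le> measure M2 (R \<inter> ?V)"
          using x R by (intro measure_mono_fmeasurable) (auto intro!: fmeasurable_Int_fmeasurable)
        then show ?thesis using I by auto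
      qed
      then show ?thesis by blast
    qed
    have "measure M2 (Pair x -` \<Union>(?Nb k e)) = measure M2 (\<Union>?F)"
      using lvP by (subst product_boxes_slice_Union'[OF D E]) auto
    also have "\<dots> \<le> measure M2 (\<Union>{R\<in>?F. (1/4) ^ e * measure M2 R \<le> measure M2 (R \<inter> ?V)})"
    proof (rule measure_mono_fmeasurable[OF sub])
      show "\<Union>?F \<in> sets M2" by (rule fmeasurableD[OF fmeasurable_Union_boxes[OF E FE finF]])
      show "\<Union>{R\<in>?F. (1/4) ^ e * measure M2 R \<le> measure M2 (R \<inter> ?V)} \<in> fmeasurable M2"
        using FE finF by (intro fmeasurable_Union_boxes[OF E]) auto
    qed
    also have "\<dots> \<le> A * (1 / (1/4) ^ e) ^ n * measure M2 ?V"
      by (rule weak_typeD[OF wt finF FE x]) (simp_all add: power_le_one)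
    finally show "measure M2 (Pair x -` \<Union>(?Nb k e)) \<le> A * (4 ^ e) ^ n * measure M2 ?V"
      by (simp add: power_one_over)
  qed
  show thesis
  proof
    show "S k \<subseteq> lv k" for k by (rule Slv)
    show "measure M2 (dominated_part I (S (k - a * e))) \<le> (1/4) ^ e * measure M2 (snd ` I)"
      if "1 \<le> e" "a * e \<le> k" "I \<in> S k" for k e I
    proof -
      have "1 * e \<le> k" by (rule order_trans[OF mult_le_mono1 that(2)]) (simp add: a)
      then have "e \<in> {1..k}" using that(1) by simp
      then show ?thesis using that(2,3) S_eq[of k] by auto
    qed
    fix K
    let ?v = "\<lambda>k. measure ?N (\<Union>(S k))"
    have step: "measure ?N (\<Union>(lv k)) \<le> ?v k + (\<Sum>e\<in>{1..k}. if a * e \<le> k then A * (4 ^ e) ^ n * ?v (k - a * e) else 0)" for k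
    proof -
      have "\<Union>(lv k) \<subseteq> \<Union>(S k) \<union> (\<Union>e\<in>{1..k}. \<Union>(?Nb k e))"
        using S_eq[of k] by blast
      moreover have fmN: "\<Union>(?Nb k e) \<in> fmeasurable ?N" for e using lv by (intro fmU) auto
      ultimately have "measure ?N (\<Union>(lv k)) \<le> measure ?N (\<Union>(S k) \<union> (\<Union>e\<in>{1..k}. \<Union>(?Nb k e)))"
        using fmU[OF lv] fmU[OF SG]
        by (intro measure_mono_fmeasurable fmeasurable.Un fmeasurable.finite_UN) auto
      also have "\<dots> \<le> ?v k + measure ?N (\<Union>e\<in>{1..k}. \<Union>(?Nb k e))"
        using fmN fmU[OF SG] by (intro measure_Un_le) (auto dest: fmeasurableD)
      also have "measure ?N (\<Union>e\<in>{1..k}. \<Union>(?Nb k e)) \<le> (\<Sum>e\<in>{1..k}. measure ?N (\<Union>(?Nb k e)))"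
        using fmN by (intro measure_UNION_le) (auto dest: fmeasurableD)
      also have "\<dots> \<le> (\<Sum>e\<in>{1..k}. if a * e \<le> k then A * (4 ^ e) ^ n * ?v (k - a * e) else 0)"
      proof (intro sum_mono)
        fix e
        show "measure ?N (\<Union>(?Nb k e)) \<le> (if a * e \<le> k then A * (4 ^ e) ^ n * ?v (k - a * e) else 0)"
        proof (cases "a * e \<le> k")
          case True
          then show ?thesis using Nb[of k e] by simp
        next
          case False
          then have "?Nb k e = {}" by blast
          then show ?thesis using False by (simp only: Union_empty measure_empty if_False)
        qed
      qed
      finally show ?thesis by simp
    qed
    have "(\<Sum>k\<le>K. (1/2) ^ k * measure ?N (\<Union>(lv k))) \<le> (\<Sum>k\<le>K. (1/2) ^ k *
        (?v k + (\<Sum>e\<in>{1..k}. if a * e \<le> k then A * (4 ^ e) ^ n * ?v (k - a * e) else 0)))"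
      by (intro sum_mono mult_left_mono step) auto
    also have "\<dots> = (\<Sum>k\<le>K. (1/2) ^ k * ?v k) + (\<Sum>k\<le>K. (1/2) ^ k *
        (\<Sum>e\<in>{1..k}. if a * e \<le> k then A * (4 ^ e) ^ n * ?v (k - a * e) else 0))"
      by (simp only: distrib_left sum.distrib)
    also have "\<dots> \<le> (\<Sum>k\<le>K. (1/2) ^ k * ?v k) + 2 * A * (\<Sum>k\<le>K. (1/2) ^ k * ?v k)"
      by (intro add_left_mono shifted_sum_le \<open>0 \<le> A\<close> a) auto
    finally show "(\<Sum>k\<le>K. (1/2) ^ k * measure ?N (\<Union>(lv k))) \<le> (1 + 2 * A) * (\<Sum>k\<le>K. (1/2) ^ k * ?v k)"
      by (simp add: distrib_right)
  qed
qed

section \<open>Slice layers and the inductive step\<close>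

definition slice_layer :: "('a \<times> 'b) set \<Rightarrow> nat \<Rightarrow> ('a \<times> 'b) set \<Rightarrow> 'a set" where
  "slice_layer B i I = {x\<in>fst ` I. level M2 (Pair x -` B) i (snd ` I)}"

lemma slice_layer_fmeasurable:
  assumes "B \<in> sets (M1 \<Otimes>\<^sub>M M2)" "fst ` I \<in> fmeasurable M1" "snd ` I \<in> fmeasurable M2"
  shows "slice_layer B i I \<in> fmeasurable M1"
proof (rule fmeasurableI2[OF assms(2)])
  note [measurable] = measurable_slice[OF assms(1) fmeasurableD[OF assms(3)]]
  have "slice_layer B i I = {x\<in>space M1. level M2 (Pair x -` B) i (snd ` I)} \<inter> fst ` I"
    unfolding slice_layer_def using sets.sets_into_space[OF fmeasurableD[OF assms(2)]] by auto
  also have "{x\<in>space M1. level M2 (Pair x -` B) i (snd ` I)} \<in> sets M1"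
    unfolding level_def by measurable
  then have "{x\<in>space M1. level M2 (Pair x -` B) i (snd ` I)} \<inter> fst ` I \<in> sets M1"
    using assms(2) by auto
  finally show "slice_layer B i I \<in> sets M1" .
qed (auto simp: slice_layer_def)

text \<open>Slices of density at most \<open>(1/2) ^ (k + 2)\<close> contribute at most half of the
  lower bound \<open>(1/2) ^ (k + 1) * measure (M1 \<Otimes>\<^sub>M M2) I\<close> that level
  \<open>k\<close> guarantees. The other half must come from the layers up to \<open>Suc k\<close>,
  and the measure of the second side cancels.\<close>

lemma slice_layers_heavy:
  assumes D: "boxes M1 D" and E: "boxes M2 E" and I: "I \<in> product_boxes D E"
    and B: "B \<in> fmeasurable (M1 \<Otimes>\<^sub>M M2)" and lev: "level (M1 \<Otimes>\<^sub>M M2) B k I"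
  shows "(1/2) ^ Suc (Suc k) * measure M1 (fst ` I) \<le> (\<Sum>i\<le>Suc k. (1/2) ^ i * measure M1 (slice_layer B i I))"
proof -
  let ?N = "M1 \<Otimes>\<^sub>M M2" and ?Q = "fst ` I" and ?R = "snd ` I"
  have IQ: "I = ?Q \<times> ?R" by (rule product_boxesD(1)[OF D E I])
  have Q: "?Q \<in> fmeasurable M1" "?R \<in> fmeasurable M2" "0 < measure M2 ?R"
    using product_boxesD(2,3)[OF D E I] D E unfolding boxes_def by auto
  note T = slice_layer_fmeasurable[OF fmeasurableD[OF B] Q(1,2)]
  have fm: "I \<in> fmeasurable ?N" "slice_layer B i I \<times> ?R \<in> fmeasurable ?N" "I \<inter> B \<in> fmeasurable ?N" for i
    using fmeasurable_Times[OF Q(1,2)] IQ fmeasurable_Times[OF T Q(2)] B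
    by (auto intro: fmeasurable_Int_fmeasurable dest: fmeasurableD)
  \<comment> \<open>The last index \<open>Suc (Suc k)\<close> stands for the whole rectangle; its
    weight accounts for the slices too sparse to belong to a layer.\<close>
  let ?Y = "\<lambda>i. if i \<le> Suc k then slice_layer B i I \<times> ?R else I"
  have "(\<Sum>j\<in>{0::nat}. 1 * measure ?N (I \<inter> B)) \<le> (\<Sum>i\<le>Suc (Suc k). (1/2) ^ i * measure ?N (?Y i))"
  proof (rule slices_le1[where X = "\<lambda>_. I \<inter> B" and c = "\<lambda>_. 1" and Y = ?Y])
    fix x
    have nonneg: "0 \<le> (1/2::real) ^ i * measure M2 (Pair x -` ?Y i)" for i by simp
    show "(\<Sum>j\<in>{0::nat}. 1 * measure M2 (Pair x -` (I \<inter> B))) \<le>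
        (\<Sum>i\<le>Suc (Suc k). (1/2) ^ i * measure M2 (Pair x -` ?Y i))"
    proof (cases "x \<in> ?Q")
      case True
      have sec: "Pair x -` (I \<inter> B) = ?R \<inter> Pair x -` B" "Pair x -` I = ?R"
        using True by (subst IQ; auto)+
      have "\<exists>i\<le>Suc (Suc k). measure M2 (?R \<inter> Pair x -` B) \<le> (1/2) ^ i * measure M2 (Pair x -` ?Y i)"
      proof (cases "(1/2) ^ Suc (Suc k) * measure M2 ?R < measure M2 (?R \<inter> Pair x -` B)")
        case True
        have "measure M2 (?R \<inter> Pair x -` B) \<le> measure M2 ?R"
          using Q(2) B by (intro measure_mono_fmeasurable) (auto intro!: sets_Pair1)
        from level_exists[OF True this] obtain i where i: "i \<le> Suc k" "level M2 (Pair x -` B) i ?R" by blast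
        then have "x \<in> slice_layer B i I" using \<open>x \<in> ?Q\<close> unfolding slice_layer_def by simp
        then have "Pair x -` (?Y i) = ?R" using i by auto
        then show ?thesis using i by (intro exI[of _ i]) (auto simp: level_def)
      next
        case False
        then show ?thesis using sec(2) by (intro exI[of _ "Suc (Suc k)"]) auto
      qed
      then obtain i where i: "i \<le> Suc (Suc k)"
        "measure M2 (?R \<inter> Pair x -` B) \<le> (1/2) ^ i * measure M2 (Pair x -` ?Y i)" by blast
      have "(1/2) ^ i * measure M2 (Pair x -` ?Y i) \<le> (\<Sum>i\<le>Suc (Suc k). (1/2) ^ i * measure M2 (Pair x -` ?Y i))"
        using i(1) nonneg by (intro member_le_sum) auto
      then show ?thesis using i(2) sec by simp
    next
      case False
      then have "Pair x -` (I \<inter> B) = {}" by (subst IQ) auto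
      moreover have "0 \<le> (\<Sum>i\<le>Suc (Suc k). (1/2) ^ i * measure M2 (Pair x -` ?Y i))"
        by (intro sum_nonneg nonneg)
      ultimately show ?thesis by (simp del: sum.atMost_Suc)
    qed
  qed (use fm in auto)
  then have "measure ?N (I \<inter> B) \<le> (\<Sum>i\<le>Suc k. (1/2) ^ i * (measure M1 (slice_layer B i I) * measure M2 ?R))
      + (1/2) ^ Suc (Suc k) * measure ?N I"
    using measure_Times[OF fmeasurableD[OF T] fmeasurableD[OF Q(2)]] by simp
  moreover have "(1/2) ^ Suc k * measure ?N I \<le> measure ?N (I \<inter> B)"
    using lev unfolding level_def by simp
  moreover have mI: "measure ?N I = measure M1 ?Q * measure M2 ?R"
    by (subst IQ) (use Q in \<open>auto intro!: measure_Times\<close>)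
  moreover have "(1/2) ^ Suc k * measure ?N I = 2 * ((1/2) ^ Suc (Suc k) * measure ?N I)" by simp
  ultimately have "(1/2) ^ Suc (Suc k) * (measure M1 ?Q * measure M2 ?R) \<le>
      (\<Sum>i\<le>Suc k. (1/2) ^ i * (measure M1 (slice_layer B i I) * measure M2 ?R))"
    by (simp only: mI)
  then have "((1/2) ^ Suc (Suc k) * measure M1 ?Q) * measure M2 ?R \<le>
      (\<Sum>i\<le>Suc k. (1/2) ^ i * measure M1 (slice_layer B i I)) * measure M2 ?R"
    by (simp only: sum_distrib_right mult.assoc)
  then show ?thesis using Q(3) by (rule mult_right_le_imp_le)
qed

text \<open>Over a fixed \<open>y\<close> the first sides belong to a nested family and each is
  heavy for the weighted combination of its layers. The one-factor estimate with several sets gives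
  the inequality for the slice, which is then integrated in \<open>y\<close>.\<close>

lemma union_le_slice_layers:
  assumes D: "boxes M1 D" "nested D" and E: "boxes M2 E" and S: "finite S" "S \<subseteq> product_boxes D E"
    and B: "B \<in> fmeasurable (M1 \<Otimes>\<^sub>M M2)" and lev: "\<And>I. I \<in> S \<Longrightarrow> level (M1 \<Otimes>\<^sub>M M2) B k I"
  shows "(1/2) ^ Suc (Suc k) * measure (M1 \<Otimes>\<^sub>M M2) (\<Union>S) \<le>
    (\<Sum>i\<le>Suc k. (1/2) ^ i * measure (M1 \<Otimes>\<^sub>M M2) (\<Union>I\<in>S. slice_layer B i I \<times> snd ` I))"
proof -
  let ?N = "M1 \<Otimes>\<^sub>M M2" and ?W = "\<lambda>i. \<Union>I\<in>S. slice_layer B i I \<times> snd ` I"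
  note pb = product_boxesD[OF D(1) E subsetD[OF S(2)]]
  have Q: "fst ` I \<in> fmeasurable M1" "snd ` I \<in> fmeasurable M2" if "I \<in> S" for I
    using pb(2,3)[OF that] D(1) E unfolding boxes_def by auto
  have T: "slice_layer B i I \<in> fmeasurable M1" if "I \<in> S" for I i
    by (rule slice_layer_fmeasurable[OF fmeasurableD[OF B] Q[OF that]])
  have W: "?W i \<in> fmeasurable ?N" for i
    using S T Q by (intro fmeasurable.finite_UN fmeasurable_Times) auto
  have "(\<Sum>j\<in>{0::nat}. (1/2) ^ Suc (Suc k) * measure ?N (\<Union>S)) \<le> (\<Sum>i\<le>Suc k. (1/2) ^ i * measure ?N (?W i))"
  proof (rule slices_le2[where X = "\<lambda>_. \<Union>S" and c = "\<lambda>_. (1/2) ^ Suc (Suc k)" and Y = ?W])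
    fix y assume y: "y \<in> space M2" "\<And>i. i \<in> {..Suc k} \<Longrightarrow> (\<lambda>x. (x, y)) -` ?W i \<in> fmeasurable M1"
    let ?F = "(`) fst ` {I\<in>S. y \<in> snd ` I}"
    have "(1/2) ^ Suc (Suc k) * measure M1 (\<Union>?F) \<le> (\<Sum>i\<le>Suc k. (1/2) ^ i * measure M1 ((\<lambda>x. (x, y)) -` ?W i))"
    proof (rule nested_weak_type_sum[OF D])
      show "finite ?F" "?F \<subseteq> D" using S pb by auto
      fix Q' assume "Q' \<in> ?F"
      then obtain I where I: "I \<in> S" "y \<in> snd ` I" "Q' = fst ` I" by auto
      have "(1/2) ^ Suc (Suc k) * measure M1 Q' \<le> (\<Sum>i\<le>Suc k. (1/2) ^ i * measure M1 (slice_layer B i I))"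
        unfolding I(3) by (rule slice_layers_heavy[OF D(1) E subsetD[OF S(2) I(1)] B lev[OF I(1)]])
      also have "\<dots> \<le> (\<Sum>i\<le>Suc k. (1/2) ^ i * measure M1 (Q' \<inter> (\<lambda>x. (x, y)) -` ?W i))"
      proof (intro sum_mono mult_left_mono measure_mono_fmeasurable)
        fix i assume i: "i \<in> {..Suc k}"
        show "slice_layer B i I \<subseteq> Q' \<inter> (\<lambda>x. (x, y)) -` ?W i"
          using I unfolding slice_layer_def by blast
        show "slice_layer B i I \<in> sets M1" using T[OF I(1)] by auto
        show "Q' \<inter> (\<lambda>x. (x, y)) -` ?W i \<in> fmeasurable M1"
          using y(2)[OF i] Q(1)[OF I(1)] I(3) by (auto intro!: fmeasurable_Int_fmeasurable)
      qed auto
      finally show "(1/2) ^ Suc (Suc k) * measure M1 Q' \<le>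
          (\<Sum>i\<le>Suc k. (1/2) ^ i * measure M1 (Q' \<inter> (\<lambda>x. (x, y)) -` ?W i))" .
    qed (use y in auto)
    moreover have "(\<lambda>x. (x, y)) -` \<Union>S = \<Union>?F"
      by (rule product_boxes_slice_Union[OF D(1) E S(2)])
    ultimately show "(\<Sum>j\<in>{0::nat}. (1/2) ^ Suc (Suc k) * measure M1 ((\<lambda>x. (x, y)) -` \<Union>S)) \<le>
        (\<Sum>i\<le>Suc k. (1/2) ^ i * measure M1 ((\<lambda>x. (x, y)) -` ?W i))"
      by simp
  qed (use W fmeasurable_Union_boxes[OF boxes_product[OF D(1) E] S(2,1)] in auto)
  then show ?thesis by simp
qed

text \<open>The pairs \<open>(k, i)\<close> are regrouped along the lines
  \<open>q = a * i + K - k\<close>, where adding \<open>K\<close> keeps \<open>q\<close> a natural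
  number. On a line \<open>i\<close> determines \<open>k\<close>, so a line is a single sequence of
  layers to which \<open>principal_level_bound\<close> applies. As \<open>i \<le> K + 1\<close>,
  there are \<open>Q + 1 = (a + 1) * (K + 1)\<close> lines.\<close>

lemma slice_sum_le:
  assumes D: "boxes M1 D" "nested D" and E: "boxes M2 E" and wt: "weak_type M2 E A n"
    and lb: "level_bound M2 E C r" and "0 \<le> A" "0 \<le> C" and a: "a = 2 * n + 1"
    and G: "finite G" "G \<subseteq> product_boxes D E" "incomparable G" and S: "\<And>k. S k \<subseteq> G"
    and rare: "\<And>k e I. 1 \<le> e \<Longrightarrow> a * e \<le> k \<Longrightarrow> I \<in> S k \<Longrightarrow>
      measure M2 (dominated_part I (S (k - a * e))) \<le> (1/4) ^ e * measure M2 (snd ` I)"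
    and Bx: "Pair x -` B \<in> fmeasurable M2"
  shows "(\<Sum>k\<le>K. \<Sum>i\<le>Suc k. (1/2) ^ i * measure M2 (Pair x -` (\<Union>I\<in>S k. slice_layer B i I \<times> snd ` I)))
    \<le> real ((a + 1) * (K + 1)) * ((1 + A * 2 ^ n) * (4 * (C * real (K + 2) ^ r * measure M2 (Pair x -` B))))"
proof -
  define H where "H k i = (`) snd ` {I\<in>S k. x \<in> slice_layer B i I}" for k i
  define H' where "H' q i = (if a * i \<le> q \<and> q \<le> a * i + K then H (a * i + K - q) i else {})" for q i
  define Q where "Q = a * (K + 1) + K"
  have SP: "S k \<subseteq> product_boxes D E" for k using S G by blast
  have finS: "finite (S k)" for k using finite_subset[OF S G(1)] .
  have finH: "finite (H k i)" for k i unfolding H_def using finS by auto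
  have HE: "H k i \<subseteq> E" for k i unfolding H_def using product_boxesD(3)[OF D(1) E] SP by blast
  have sec: "Pair x -` (\<Union>I\<in>S k. slice_layer B i I \<times> snd ` I) = \<Union>(H k i)" for k i
    unfolding H_def by auto
  let ?f = "\<lambda>k i. (1/2::real) ^ i * measure M2 (\<Union>(H k i))"
  have principal: "(\<Sum>i\<le>K + 1. (1/2) ^ i * measure M2 (\<Union>(H' q i))) \<le>
      (1 + A * 2 ^ n) * (4 * (C * real (K + 1 + 1) ^ r * measure M2 (Pair x -` B)))" for q
  proof (rule principal_level_bound[OF E wt lb \<open>0 \<le> A\<close> Bx])
    show "finite (H' q i)" "H' q i \<subseteq> E" for i unfolding H'_def using finH HE by auto
    show "level M2 (Pair x -` B) i R" if "R \<in> H' q i" for i R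
      using that unfolding H'_def H_def slice_layer_def by (auto split: if_splits)
    fix i j R assume ij: "j < i" and R: "R \<in> H' q i"
    have c: "a * i \<le> q" "q \<le> a * i + K" and RH: "R \<in> H (a * i + K - q) i"
      using R unfolding H'_def by (auto split: if_splits)
    let ?k = "a * i + K - q"
    obtain I where I: "R = snd ` I" "I \<in> S ?k" "x \<in> slice_layer B i I"
      using RH unfolding H_def by auto
    have Rfm: "R \<in> fmeasurable M2"
      using product_boxesD(3)[OF D(1) E subsetD[OF SP I(2)]] I(1) E unfolding boxes_def by auto
    show "measure M2 (\<Union>{R'\<in>H' q j. R' \<subset> R}) \<le> (1/4) ^ (i - j) * measure M2 R"
    proof (cases "a * j \<le> q \<and> q \<le> a * j + K")
      case False
      then have "{R'\<in>H' q j. R' \<subset> R} = {}" unfolding H'_def by auto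
      then show ?thesis by (simp only: Union_empty measure_empty) simp
    next
      case True
      have aij: "a * i = a * j + a * (i - j)"
        using ij by (simp flip: distrib_left)
      \<comment> \<open>Along a line, lowering \<open>i\<close> by \<open>e = i - j\<close> lowers
        \<open>k\<close> by exactly \<open>a * e\<close>; so the rectangles of layer
        \<open>j\<close> come from a family against which \<open>I\<close> was tested in the
        selection.\<close>
      have k': "a * j + K - q = ?k - a * (i - j)" "a * (i - j) \<le> ?k"
        using True c aij by auto
      let ?T = "S (?k - a * (i - j))"
      have "\<Union>{R'\<in>H' q j. R' \<subset> R} \<subseteq> dominated_part I ?T"
      proof
        fix y assume "y \<in> \<Union>{R'\<in>H' q j. R' \<subset> R}"
        then obtain R' where R': "R' \<in> H (a * j + K - q) j" "R' \<subset> R" "y \<in> R'"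
          using True unfolding H'_def by auto
        then obtain J where J: "R' = snd ` J" "J \<in> ?T" "x \<in> slice_layer B j J"
          unfolding H_def k'(1) by auto
        have IJ: "I \<in> G" "J \<in> G" using S I(2) J(2) by auto
        note pI = product_boxesD[OF D(1) E subsetD[OF G(2) IJ(1)]]
        note pJ = product_boxesD[OF D(1) E subsetD[OF G(2) IJ(2)]]
        \<comment> \<open>Both first sides contain \<open>x\<close>, so nestedness of
          \<open>D\<close> will turn this failure of inclusion into the strict inclusion the other
          way round.\<close>
        have ne: "\<not> fst ` J \<subseteq> fst ` I"
        proof
          assume "fst ` J \<subseteq> fst ` I"
          then have "fst ` J \<times> snd ` J \<subseteq> fst ` I \<times> snd ` I"
            using R'(2) unfolding I(1) J(1) by (intro Sigma_mono) auto
          then have "J \<subseteq> I" using pI(1) pJ(1) by simp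
          from incomparableD[OF G(3) IJ(2,1) this] show False
            using R'(2) I(1) J(1) by simp
        qed
        have "x \<in> fst ` I" "x \<in> fst ` J" using I(3) J(3) unfolding slice_layer_def by auto
        from nestedD[OF D(2) pI(2) pJ(2) this] ne have "fst ` I \<subset> fst ` J" by auto
        then have "J \<in> {J\<in>?T. fst ` I \<subset> fst ` J}" using J(2) by simp
        then have "y \<in> \<Union>((`) snd ` {J\<in>?T. fst ` I \<subset> fst ` J})"
          using R'(3) J(1) by blast
        moreover have "y \<in> snd ` I" using R'(2,3) I(1) by auto
        ultimately show "y \<in> dominated_part I ?T" unfolding dominated_part_def by simp
      qed
      moreover have "\<Union>{R'\<in>H' q j. R' \<subset> R} \<in> sets M2"
      proof (intro fmeasurableD[OF fmeasurable_Union_boxes[OF E]])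
        show "{R'\<in>H' q j. R' \<subset> R} \<subseteq> E" "finite {R'\<in>H' q j. R' \<subset> R}"
          using HE finH unfolding H'_def by auto
      qed
      moreover have "dominated_part I ?T \<in> fmeasurable M2"
      proof (rule fmeasurableI2[OF Rfm])
        have "snd ` J \<in> sets M2" if "J \<in> ?T" for J
          using product_boxesD(3)[OF D(1) E subsetD[OF SP that]] E unfolding boxes_def by auto
        then show "dominated_part I ?T \<in> sets M2"
          unfolding dominated_part_def using Rfm I(1) finS by (intro sets.Int sets.finite_Union) auto
      qed (auto simp: dominated_part_def I(1))
      ultimately have "measure M2 (\<Union>{R'\<in>H' q j. R' \<subset> R}) \<le> measure M2 (dominated_part I ?T)"
        by (intro measure_mono_fmeasurable)
      also have "\<dots> \<le> (1/4) ^ (i - j) * measure M2 R"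
        unfolding I(1) using ij k'(2) I(2) by (intro rare) auto
      finally show ?thesis .
    qed
  qed
  have reindex: "(\<Sum>k\<le>K. ?f k i) = (\<Sum>q\<le>Q. (1/2) ^ i * measure M2 (\<Union>(H' q i)))" if i: "i \<le> K + 1" for i
  proof -
    have aQ: "a * i + K \<le> Q" unfolding Q_def using i by (simp only: add_le_mono mult_le_mono2 order_refl)
    have "(\<Sum>q\<le>Q. (1/2) ^ i * measure M2 (\<Union>(H' q i))) = (\<Sum>q\<in>{a * i..a * i + K}. ?f (a * i + K - q) i)"
      using aQ by (intro sum.mono_neutral_cong_right) (auto simp: H'_def)
    also have "\<dots> = (\<Sum>k\<le>K. ?f k i)"
      by (rule sum.reindex_bij_witness[where i = "\<lambda>k. a * i + K - k" and j = "\<lambda>q. a * i + K - q"]) auto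
    finally show ?thesis by simp
  qed
  have "(\<Sum>k\<le>K. \<Sum>i\<le>Suc k. ?f k i) \<le> (\<Sum>k\<le>K. \<Sum>i\<le>K + 1. ?f k i)"
    by (intro sum_mono sum_mono2) auto
  also have "\<dots> = (\<Sum>i\<le>K + 1. \<Sum>k\<le>K. ?f k i)" by (rule sum.swap)
  also have "\<dots> = (\<Sum>i\<le>K + 1. \<Sum>q\<le>Q. (1/2) ^ i * measure M2 (\<Union>(H' q i)))"
    by (rule sum.cong[OF refl]) (rule reindex, simp)
  also have "\<dots> = (\<Sum>q\<le>Q. \<Sum>i\<le>K + 1. (1/2) ^ i * measure M2 (\<Union>(H' q i)))" by (rule sum.swap)
  also have "\<dots> \<le> (\<Sum>q\<le>Q. (1 + A * 2 ^ n) * (4 * (C * real (K + 1 + 1) ^ r * measure M2 (Pair x -` B))))"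
    by (intro sum_mono principal)
  also have "\<dots> = real ((a + 1) * (K + 1)) * ((1 + A * 2 ^ n) * (4 * (C * real (K + 2) ^ r * measure M2 (Pair x -` B))))"
    by (simp add: Q_def algebra_simps)
  finally show ?thesis unfolding sec .
qed

lemma level_bound_product:
  assumes D: "boxes M1 D" "nested D" and E: "boxes M2 E" and wt: "weak_type M2 E A n"
    and lb: "level_bound M2 E C r" and "0 \<le> A" "0 \<le> C"
  shows "level_bound (M1 \<Otimes>\<^sub>M M2) (product_boxes D E) (product_const A n C r) (Suc r)"
  unfolding level_bound_def
proof (intro allI impI)
  let ?N = "M1 \<Otimes>\<^sub>M M2"
  fix G B K
  assume "finite G \<and> G \<subseteq> product_boxes D E \<and> incomparable G \<and> B \<in> fmeasurable ?N"
  then have G: "finite G" "G \<subseteq> product_boxes D E" "incomparable G" and B: "B \<in> fmeasurable ?N" by auto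
  define a where "a = 2 * n + 1"
  let ?lv = "\<lambda>k. {I\<in>G. level ?N B k I}"
  obtain S where S: "\<And>k. S k \<subseteq> ?lv k"
    and rare: "\<And>k e I. 1 \<le> e \<Longrightarrow> a * e \<le> k \<Longrightarrow> I \<in> S k \<Longrightarrow>
      measure M2 (dominated_part I (S (k - a * e))) \<le> (1/4) ^ e * measure M2 (snd ` I)"
    and sel: "\<And>K. (\<Sum>k\<le>K. (1/2) ^ k * measure ?N (\<Union>(?lv k))) \<le>
      (1 + 2 * A) * (\<Sum>k\<le>K. (1/2) ^ k * measure ?N (\<Union>(S k)))"
    using density_selection[OF D(1) E wt \<open>0 \<le> A\<close> G(1,2), of ?lv a] by (auto simp: a_def)
  have SG: "S k \<subseteq> G" for k using S by blast
  have SP: "S k \<subseteq> product_boxes D E" for k using SG G by blast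
  have finS: "finite (S k)" for k using finite_subset[OF SG G(1)] .
  let ?W = "\<lambda>k i. \<Union>I\<in>S k. slice_layer B i I \<times> snd ` I"
  have W: "?W k i \<in> fmeasurable ?N" for k i
  proof (intro fmeasurable.finite_UN finS fmeasurable_Times)
    fix I assume "I \<in> S k"
    note pb = product_boxesD(2,3)[OF D(1) E subsetD[OF SP this]]
    then have Q: "fst ` I \<in> fmeasurable M1" "snd ` I \<in> fmeasurable M2" using D(1) E unfolding boxes_def by auto
    show "slice_layer B i I \<in> fmeasurable M1"
      by (rule slice_layer_fmeasurable[OF fmeasurableD[OF B] Q])
    show "snd ` I \<in> fmeasurable M2" by (rule Q(2))
  qed
  \<comment> \<open>The first factor counts the lines and is the only source of the additional power
    of \<open>K\<close>.\<close>
  let ?d = "real ((a + 1) * (K + 1)) * ((1 + A * 2 ^ n) * (4 * (C * real (K + 2) ^ r)))"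
  have d0: "0 \<le> ?d" using \<open>0 \<le> A\<close> \<open>0 \<le> C\<close> by (intro mult_nonneg_nonneg add_nonneg_nonneg) auto
  let ?P = "SIGMA k:{..K}. {..Suc k}"
  \<comment> \<open>Pairs are coded by single numbers because the slicing lemmas sum over sets of
    naturals.\<close>
  let ?P' = "(\<lambda>(k, i). prod_encode (k, i)) ` ?P"
  have layers: "(\<Sum>k\<le>K. \<Sum>i\<le>Suc k. (1/2) ^ i * measure ?N (?W k i)) \<le> ?d * measure ?N B"
  proof -
    let ?g = "\<lambda>j. fst (prod_decode j)" and ?h = "\<lambda>j. snd (prod_decode j)"
    have conv: "(\<Sum>j\<in>?P'. F (?g j) (?h j)) = (\<Sum>k\<le>K. \<Sum>i\<le>Suc k. F k i)" for F :: "nat \<Rightarrow> nat \<Rightarrow> real"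
    proof -
      have "(\<Sum>j\<in>?P'. F (?g j) (?h j)) = (\<Sum>(k, i)\<in>?P. F k i)"
        by (subst sum.reindex) (auto simp: inj_on_def intro!: sum.cong)
      also have "\<dots> = (\<Sum>k\<le>K. \<Sum>i\<le>Suc k. F k i)"
        by (rule sum.Sigma[symmetric]) auto
      finally show ?thesis .
    qed
    have "(\<Sum>j\<in>?P'. (1/2) ^ ?h j * measure ?N (?W (?g j) (?h j))) \<le> (\<Sum>j\<in>{0::nat}. ?d * measure ?N B)"
    proof (rule slices_le1[where X = "\<lambda>j. ?W (?g j) (?h j)" and Y = "\<lambda>_. B" and d = "\<lambda>_. ?d"])
      fix x assume "\<And>k. k \<in> {0::nat} \<Longrightarrow> Pair x -` B \<in> fmeasurable M2"
      then have Bx: "Pair x -` B \<in> fmeasurable M2" by simp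
      have "(\<Sum>j\<in>?P'. (1/2) ^ ?h j * measure M2 (Pair x -` ?W (?g j) (?h j))) =
          (\<Sum>k\<le>K. \<Sum>i\<le>Suc k. (1/2) ^ i * measure M2 (Pair x -` ?W k i))"
        by (rule conv)
      also have "\<dots> \<le> real ((a + 1) * (K + 1)) * ((1 + A * 2 ^ n) * (4 * (C * real (K + 2) ^ r * measure M2 (Pair x -` B))))"
        by (rule slice_sum_le[OF D E wt lb \<open>0 \<le> A\<close> \<open>0 \<le> C\<close> a_def G SG rare Bx])
      finally show "(\<Sum>j\<in>?P'. (1/2) ^ ?h j * measure M2 (Pair x -` ?W (?g j) (?h j))) \<le>
          (\<Sum>k\<in>{0::nat}. ?d * measure M2 (Pair x -` B))" by (simp add: mult_ac)
    qed (use W B d0 in auto)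
    moreover have "(\<Sum>j\<in>?P'. (1/2) ^ ?h j * measure ?N (?W (?g j) (?h j))) =
        (\<Sum>k\<le>K. \<Sum>i\<le>Suc k. (1/2) ^ i * measure ?N (?W k i))"
      by (rule conv)
    ultimately show ?thesis by simp
  qed
  have "(\<Sum>k\<le>K. (1/2) ^ k * measure ?N (\<Union>(S k))) \<le> (\<Sum>k\<le>K. 4 * (\<Sum>i\<le>Suc k. (1/2) ^ i * measure ?N (?W k i)))"
  proof (intro sum_mono)
    fix k
    have "(1/2) ^ Suc (Suc k) * measure ?N (\<Union>(S k)) \<le> (\<Sum>i\<le>Suc k. (1/2) ^ i * measure ?N (?W k i))"
      using S by (intro union_le_slice_layers[OF D E finS SP B]) auto
    then show "(1/2) ^ k * measure ?N (\<Union>(S k)) \<le> 4 * (\<Sum>i\<le>Suc k. (1/2) ^ i * measure ?N (?W k i))"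
      by (simp del: sum.atMost_Suc)
  qed
  also have "\<dots> \<le> 4 * (?d * measure ?N B)"
    using layers by (simp only: sum_distrib_left[symmetric])
  finally have "(\<Sum>k\<le>K. (1/2) ^ k * measure ?N (\<Union>(?lv k))) \<le> (1 + 2 * A) * (4 * (?d * measure ?N B))"
    using \<open>0 \<le> A\<close> by (intro order_trans[OF sel] mult_left_mono) auto
  also have "\<dots> \<le> (1 + 2 * A) * (4 * (real ((a + 1) * (K + 1)) * ((1 + A * 2 ^ n) * (4 * (C * (2 ^ r * real (K + 1) ^ r)))) * measure ?N B))"
  proof -
    have "real (K + 2) ^ r \<le> (2 * real (K + 1)) ^ r" by (intro power_mono) auto
    then have "real (K + 2) ^ r \<le> 2 ^ r * real (K + 1) ^ r" by (simp only: power_mult_distrib)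
    then show ?thesis using \<open>0 \<le> A\<close> \<open>0 \<le> C\<close> by (intro mult_left_mono mult_right_mono) auto
  qed
  also have "\<dots> = product_const A n C r * real (K + 1) ^ Suc r * measure ?N B"
    by (simp add: product_const_def a_def algebra_simps)
  finally show "(\<Sum>k\<le>K. (1/2) ^ k * measure ?N (\<Union>(?lv k))) \<le>
      product_const A n C r * real (K + 1) ^ Suc r * measure ?N B" .
qed

end

section \<open>Rectangles in finite products\<close>


text \<open>A binary product and a space of functions on an enlarged index set are different types,
  linked by \<open>T\<close>. Preservation of measure carries densities over; surjectivity makes
  preimages reflect inclusion, so that incomparable families pull back to incomparable ones.\<close>

locale box_transport =
  fixes N :: "'a measure" and P :: "'b measure" and T E E'
  assumes T: "T \<in> measurable N P"
    and preserve: "\<And>X. X \<in> sets P \<Longrightarrow> emeasure N (T -` X \<inter> space N) = emeasure P X"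
    and surj: "space P \<subseteq> T ` space N"
    and pre: "\<And>R. R \<in> E' \<Longrightarrow> T -` R \<inter> space N \<in> E"
    and boxes': "boxes P E'"
begin

abbreviation "pull X \<equiv> T -` X \<inter> space N"

lemma pull_measure: "X \<in> sets P \<Longrightarrow> measure N (pull X) = measure P X"
  by (simp add: measure_def preserve)

lemma pull_fmeasurable: "X \<in> fmeasurable P \<Longrightarrow> pull X \<in> fmeasurable N"
  using measurable_sets[OF T] by (intro fmeasurableI) (auto simp: preserve fmeasurableD fmeasurableD2 top.not_eq_extremum[symmetric])

lemma pull_box:
  assumes "R \<in> E'" "B \<in> fmeasurable P"
  shows "measure N (pull R) = measure P R" "measure N (pull R \<inter> pull B) = measure P (R \<inter> B)"
proof -
  have R: "R \<in> sets P" using assms boxes' unfolding boxes_def by auto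
  then show "measure N (pull R) = measure P R" by (rule pull_measure)
  have "pull R \<inter> pull B = pull (R \<inter> B)" by auto
  then show "measure N (pull R \<inter> pull B) = measure P (R \<inter> B)"
    using pull_measure[of "R \<inter> B"] R assms by auto
qed

lemma pull_family:
  assumes F: "finite F" "F \<subseteq> E'"
    and iff: "\<And>R. R \<in> F \<Longrightarrow> p (pull R) \<longleftrightarrow> q R"
  shows "measure N (\<Union>{R\<in>(\<lambda>R. pull R) ` F. p R}) = measure P (\<Union>{R\<in>F. q R})"
proof -
  have "\<Union>{R\<in>(\<lambda>R. pull R) ` F. p R} = pull (\<Union>{R\<in>F. q R})"
    using iff by auto
  moreover have "\<Union>{R\<in>F. q R} \<in> sets P"
    using F by (intro fmeasurableD[OF fmeasurable_Union_boxes[OF boxes']]) auto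
  ultimately show ?thesis by (simp add: pull_measure)
qed

lemma weak_type_transport:
  assumes "weak_type N E A n"
  shows "weak_type P E' A n"
  unfolding weak_type_def
proof (intro allI impI)
  fix F B and t :: real
  assume *: "finite F \<and> F \<subseteq> E' \<and> B \<in> fmeasurable P \<and> 0 < t \<and> t \<le> 1"
  have "measure N (\<Union>{R\<in>(\<lambda>R. pull R) ` F. t * measure N R \<le> measure N (R \<inter> pull B)})
      \<le> A * (1 / t) ^ n * measure N (pull B)"
    using * pre by (intro weak_typeD[OF assms]) (auto intro: pull_fmeasurable)
  moreover have "measure N (\<Union>{R\<in>(\<lambda>R. pull R) ` F. t * measure N R \<le> measure N (R \<inter> pull B)})
      = measure P (\<Union>{R\<in>F. t * measure P R \<le> measure P (R \<inter> B)})"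
    using * pull_box by (intro pull_family) auto
  ultimately show "measure P (\<Union>{R\<in>F. t * measure P R \<le> measure P (R \<inter> B)}) \<le> A * (1 / t) ^ n * measure P B"
    using * pull_measure[of B] by (simp add: fmeasurableD)
qed

lemma level_bound_transport:
  assumes "level_bound N E C r"
  shows "level_bound P E' C r"
  unfolding level_bound_def
proof (intro allI impI)
  fix F B K
  assume *: "finite F \<and> F \<subseteq> E' \<and> incomparable F \<and> B \<in> fmeasurable P"
  have sub: "R \<subseteq> R'" if "R \<in> F" "pull R \<subseteq> pull R'" for R R'
  proof
    fix y assume "y \<in> R"
    have "R \<in> sets P" using that(1) * boxes' unfolding boxes_def by auto
    with \<open>y \<in> R\<close> have "y \<in> space P" using sets.sets_into_space by blast
    then obtain x where "x \<in> space N" "y = T x" using surj by auto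
    then show "y \<in> R'" using that(2) \<open>y \<in> R\<close> by auto
  qed
  have "incomparable ((\<lambda>R. pull R) ` F)"
    unfolding incomparable_def
  proof (intro ballI impI notI)
    fix X Y assume "X \<in> (\<lambda>R. pull R) ` F" "Y \<in> (\<lambda>R. pull R) ` F" and XY: "X \<noteq> Y" "X \<subseteq> Y"
    then obtain R R' where R: "R \<in> F" "X = pull R" "R' \<in> F" "Y = pull R'" by auto
    have "R = R'"
      using * R sub[of R R'] XY(2) by (intro incomparableD[of F]) auto
    then show False using R XY by simp
  qed
  then have "(\<Sum>k\<le>K. (1/2) ^ k * measure N (\<Union>{R\<in>(\<lambda>R. pull R) ` F. level N (pull B) k R}))
      \<le> C * real (K + 1) ^ r * measure N (pull B)"
    using * pre by (intro level_boundD[OF assms]) (auto intro: pull_fmeasurable)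
  moreover have "measure N (\<Union>{R\<in>(\<lambda>R. pull R) ` F. level N (pull B) k R}) = measure P (\<Union>{R\<in>F. level P B k R})" for k
    using * pull_box by (intro pull_family) (auto simp: level_def)
  ultimately show "(\<Sum>k\<le>K. (1/2) ^ k * measure P (\<Union>{R\<in>F. level P B k R})) \<le> C * real (K + 1) ^ r * measure P B"
    using * pull_measure[of B] by (simp add: fmeasurableD)
qed

end

text \<open>The index set is arbitrary so that factors can be added one at a time.\<close>

definition rectangles :: "'i set \<Rightarrow> ('i \<Rightarrow> 'a set set) \<Rightarrow> ('i \<Rightarrow> 'a) set set" where
  "rectangles J D = {Pi\<^sub>E J I | I. \<forall>i\<in>J. I i \<in> D i}"

lemma rectanglesE:
  assumes "R \<in> rectangles J D"
  obtains I where "R = Pi\<^sub>E J I" "\<forall>i\<in>J. I i \<in> D i"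
proof -
  from assms[unfolded rectangles_def] obtain I where "R = Pi\<^sub>E J I \<and> (\<forall>i\<in>J. I i \<in> D i)"
    by (elim CollectE exE)
  with that show thesis by simp
qed

context product_sigma_finite
begin

lemma boxes_rectangles:
  assumes J: "finite J" and D: "\<And>i. i \<in> J \<Longrightarrow> boxes (M i) (D i)"
  shows "boxes (Pi\<^sub>M J M) (rectangles J D)"
proof -
  have "R \<in> fmeasurable (Pi\<^sub>M J M) \<and> 0 < measure (Pi\<^sub>M J M) R" if R: "R \<in> rectangles J D" for R
  proof -
    obtain I where I: "R = Pi\<^sub>E J I" "\<forall>i\<in>J. I i \<in> D i"
      by (rule rectanglesE[OF R])
    have fm: "I i \<in> fmeasurable (M i)" "0 < measure (M i) (I i)" if "i \<in> J" for i
      using bspec[OF I(2) that] D[OF that] unfolding boxes_def by auto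
    have "emeasure (Pi\<^sub>M J M) R = (\<Prod>i\<in>J. emeasure (M i) (I i))"
      unfolding I(1) using J fm by (intro emeasure_PiM) auto
    also have "\<dots> = (\<Prod>i\<in>J. ennreal (measure (M i) (I i)))"
      using fm by (intro prod.cong) (auto simp: emeasure_eq_measure2)
    also have "\<dots> = ennreal (\<Prod>i\<in>J. measure (M i) (I i))"
      by (intro prod_ennreal) auto
    finally have *: "emeasure (Pi\<^sub>M J M) R = ennreal (\<Prod>i\<in>J. measure (M i) (I i))" .
    moreover have "0 < (\<Prod>i\<in>J. measure (M i) (I i))" using fm by (intro prod_pos) auto
    moreover have "R \<in> sets (Pi\<^sub>M J M)"
      unfolding I(1) using J fm by (intro sets_PiM_I_finite) auto
    ultimately show ?thesis
      by (auto intro!: fmeasurableI simp: measure_def less_imp_le)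
  qed
  then show ?thesis unfolding boxes_def by auto
qed

lemma insert_box_transport:
  assumes J: "finite J" "i \<notin> J" and D: "\<And>j. j \<in> insert i J \<Longrightarrow> boxes (M j) (D j)"
  shows "box_transport (M i \<Otimes>\<^sub>M Pi\<^sub>M J M) (Pi\<^sub>M (insert i J) M) (\<lambda>(y, x). x(i := y))
    (product_boxes (D i) (rectangles J D)) (rectangles (insert i J) D)"
proof
  let ?T = "\<lambda>(y, x). x(i := y)" and ?N = "M i \<Otimes>\<^sub>M Pi\<^sub>M J M" and ?P = "Pi\<^sub>M (insert i J) M"
  interpret J: finite_product_sigma_finite M J by standard fact
  show T: "?T \<in> measurable ?N ?P"
    unfolding split_beta' by (intro measurable_fun_upd[where J = J]) auto
  show "boxes ?P (rectangles (insert i J) D)"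
    using J D by (intro boxes_rectangles) auto
  show "emeasure ?N (?T -` X \<inter> space ?N) = emeasure ?P X" if X: "X \<in> sets ?P" for X
  proof -
    note [measurable] = T X
    have "emeasure ?N (?T -` X \<inter> space ?N) = (\<integral>\<^sup>+z. indicator X (?T z) \<partial>?N)"
      by (subst nn_integral_indicator[OF measurable_sets[OF T X], symmetric])
        (intro nn_integral_cong, simp add: indicator_def)
    also have "\<dots> = (\<integral>\<^sup>+y. (\<integral>\<^sup>+x. indicator X (?T (y, x)) \<partial>Pi\<^sub>M J M) \<partial>M i)"
      by (rule J.nn_integral_fst[symmetric]) measurable
    also have "\<dots> = (\<integral>\<^sup>+z. indicator X z \<partial>?P)"
      using J X by (subst product_nn_integral_insert_rev) auto
    finally show ?thesis using X by simp
  qed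
  show "space ?P \<subseteq> ?T ` space ?N"
  proof
    fix z assume z: "z \<in> space ?P"
    have "z = ?T (z i, restrict z J)"
      using z by (auto simp: space_PiM PiE_def extensional_def fun_eq_iff)
    moreover have "(z i, restrict z J) \<in> space ?N"
      using z by (auto simp: space_PiM space_pair_measure PiE_def)
    ultimately show "z \<in> ?T ` space ?N" by blast
  qed
  show "?T -` R \<inter> space ?N \<in> product_boxes (D i) (rectangles J D)" if R: "R \<in> rectangles (insert i J) D" for R
  proof -
    obtain I where I: "R = Pi\<^sub>E (insert i J) I" "\<forall>j\<in>insert i J. I j \<in> D j"
      by (rule rectanglesE[OF R])
    have sp: "I j \<subseteq> space (M j)" if "j \<in> insert i J" for j
      using bspec[OF I(2) that] D[OF that] unfolding boxes_def by (intro sets.sets_into_space) auto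
    have "?T -` R \<inter> space ?N = I i \<times> Pi\<^sub>E J I"
    proof (intro set_eqI iffI)
      fix z assume "z \<in> ?T -` R \<inter> space ?N"
      then show "z \<in> I i \<times> Pi\<^sub>E J I"
        using J(2) unfolding I(1)
        by (cases z) (auto simp: space_pair_measure space_PiM PiE_iff extensional_def split: if_splits)
    next
      fix z assume "z \<in> I i \<times> Pi\<^sub>E J I"
      then show "z \<in> ?T -` R \<inter> space ?N"
        using J(2) sp unfolding I(1)
        by (cases z) (auto simp: space_pair_measure space_PiM PiE_iff extensional_def subset_iff)
    qed
    moreover have "Pi\<^sub>E J I \<in> rectangles J D" using I(2) unfolding rectangles_def by auto
    ultimately show ?thesis using I(2) unfolding product_boxes_def by auto
  qed
qed

end

lemma nested_rectangles_singleton: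
  assumes "nested (D i)"
  shows "nested (rectangles {i} D)"
  unfolding nested_def
proof (intro ballI impI)
  fix Q R assume "Q \<in> rectangles {i} D" "R \<in> rectangles {i} D" and ne: "Q \<inter> R \<noteq> {}"
  then obtain I I' where I: "Q = Pi\<^sub>E {i} I" "I i \<in> D i" "R = Pi\<^sub>E {i} I'" "I' i \<in> D i"
    unfolding rectangles_def by auto
  obtain x where "x \<in> Q" "x \<in> R" using ne by blast
  then have "x i \<in> I i" "x i \<in> I' i" unfolding I by auto
  then have "I i \<subseteq> I' i \<or> I' i \<subseteq> I i" by (rule nestedD[OF assms I(2,4)])
  then show "Q \<subseteq> R \<or> R \<subseteq> Q" unfolding I by (auto intro!: PiE_mono)
qed

text \<open>The constants are fixed before the spaces and the families, so they depend on the number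
  of factors only. Both estimates go through the induction together: the step for the level bound
  consumes the weak type estimate of the remaining factors. Each factor raises both exponents by
  one, starting from 1 and 0.\<close>

lemma rectangle_bounds:
  "\<exists>A C::real. 0 \<le> A \<and> 0 \<le> C \<and> (\<forall>(J::'i set) (M::'i \<Rightarrow> 'a measure) D.
     product_sigma_finite M \<and> finite J \<and> card J = Suc n \<and> (\<forall>i\<in>J. boxes (M i) (D i) \<and> nested (D i)) \<longrightarrow>
     weak_type (Pi\<^sub>M J M) (rectangles J D) A (Suc n) \<and> level_bound (Pi\<^sub>M J M) (rectangles J D) C n)"
proof (induction n)
  case 0
  show ?case
  proof (rule exI[of _ 1], rule exI[of _ 2], intro conjI allI impI)
    fix J :: "'i set" and M :: "'i \<Rightarrow> 'a measure" and D
    assume *: "product_sigma_finite M \<and> finite J \<and> card J = Suc 0 \<and> (\<forall>i\<in>J. boxes (M i) (D i) \<and> nested (D i))"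
    then obtain i where J: "J = {i}" by (auto simp: card_Suc_eq)
    interpret product_sigma_finite M using * by simp
    have bx: "boxes (Pi\<^sub>M J M) (rectangles J D)" using * by (intro boxes_rectangles) auto
    have ne: "nested (rectangles J D)" using * unfolding J by (intro nested_rectangles_singleton) auto
    show "weak_type (Pi\<^sub>M J M) (rectangles J D) 1 (Suc 0)"
      using nested_weak_type[OF bx ne] by simp
    show "level_bound (Pi\<^sub>M J M) (rectangles J D) 2 0"
      by (rule nested_level_bound[OF bx ne])
  qed auto
next
  case (Suc n)
  then obtain A C :: real where AC: "0 \<le> A" "0 \<le> C" and IH: "\<And>(J::'i set) (M::'i \<Rightarrow> 'a measure) D.
     product_sigma_finite M \<and> finite J \<and> card J = Suc n \<and> (\<forall>i\<in>J. boxes (M i) (D i) \<and> nested (D i)) \<Longrightarrow>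
     weak_type (Pi\<^sub>M J M) (rectangles J D) A (Suc n) \<and> level_bound (Pi\<^sub>M J M) (rectangles J D) C n"
    by blast
  show ?case
  proof (rule exI[of _ "A * 2 ^ Suc (Suc n)"], rule exI[of _ "product_const A (Suc n) C n"], intro conjI allI impI)
    show "0 \<le> A * 2 ^ Suc (Suc n)" "0 \<le> product_const A (Suc n) C n"
      using AC unfolding product_const_def by (auto intro!: mult_nonneg_nonneg add_nonneg_nonneg)
    fix J :: "'i set" and M :: "'i \<Rightarrow> 'a measure" and D
    assume *: "product_sigma_finite M \<and> finite J \<and> card J = Suc (Suc n) \<and> (\<forall>i\<in>J. boxes (M i) (D i) \<and> nested (D i))"
    then obtain i J' where J: "J = insert i J'" "i \<notin> J'" "card J' = Suc n" "finite J'"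
      by (metis card_Suc_eq finite_insert)
    interpret product_sigma_finite M using * by simp
    interpret J': finite_product_sigma_finite M J' by standard fact
    interpret pair_sigma_finite "M i" "Pi\<^sub>M J' M" ..
    have D: "boxes (M i) (D i)" "nested (D i)" using * J by auto
    have D': "\<And>j. j \<in> insert i J' \<Longrightarrow> boxes (M j) (D j)" using * J by auto
    have E: "boxes (Pi\<^sub>M J' M) (rectangles J' D)" using * J by (intro boxes_rectangles) auto
    have wt: "weak_type (Pi\<^sub>M J' M) (rectangles J' D) A (Suc n)" and lb: "level_bound (Pi\<^sub>M J' M) (rectangles J' D) C n"
      using IH[of M J' D] * J by auto
    interpret box_transport "M i \<Otimes>\<^sub>M Pi\<^sub>M J' M" "Pi\<^sub>M (insert i J') M" "\<lambda>(y, x). x(i := y)"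
      "product_boxes (D i) (rectangles J' D)" "rectangles (insert i J') D"
      by (rule insert_box_transport[OF J(4,2) D'])
    show "weak_type (Pi\<^sub>M J M) (rectangles J D) (A * 2 ^ Suc (Suc n)) (Suc (Suc n))"
      unfolding J(1) by (rule weak_type_transport[OF weak_type_product[OF D E wt AC(1)]])
    show "level_bound (Pi\<^sub>M J M) (rectangles J D) (product_const A (Suc n) C n) (Suc n)"
      unfolding J(1) by (rule level_bound_transport[OF level_bound_product[OF D E wt lb AC]])
  qed
qed

section \<open>From indicators to functions\<close>


lemma two_powr_minus_nat: "2 powr (- real n) = (1/2) ^ n"
  by (simp only: powr_minus powr_realpow[OF zero_less_numeral] power_inverse[symmetric]) simp

lemma summable_poly_geometric: "summable (\<lambda>q. (1/2::real) ^ q * real (q + 1) ^ r)"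
proof -
  have "(\<lambda>q. 1 + inverse (real (Suc q))) \<longlonglongrightarrow> 1"
    by (rule LIMSEQ_inverse_real_of_nat_add)
  then have "(\<lambda>q. 1/2 * (1 + inverse (real (Suc q))) ^ r) \<longlonglongrightarrow> 1/2 * 1 ^ r"
    by (intro tendsto_intros)
  then have "eventually (\<lambda>q. 1/2 * (1 + inverse (real (Suc q))) ^ r < 3/4) sequentially"
    by (rule order_tendstoD(2)) simp
  then obtain N where N: "\<And>q. N \<le> q \<Longrightarrow> 1/2 * (1 + inverse (real (Suc q))) ^ r < 3/4"
    unfolding eventually_sequentially by blast
  show ?thesis
  proof (rule summable_ratio_test[of "3/4" N])
    fix q assume "N \<le> q"
    have "real (Suc q + 1) = (1 + inverse (real (Suc q))) * real (q + 1)"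
      by (simp add: field_simps)
    then have "(1/2::real) ^ Suc q * real (Suc q + 1) ^ r =
        (1/2 * (1 + inverse (real (Suc q))) ^ r) * ((1/2) ^ q * real (q + 1) ^ r)"
      by (simp only: power_mult_distrib power_Suc mult_ac)
    also have "\<dots> \<le> 3/4 * ((1/2) ^ q * real (q + 1) ^ r)"
      using N[OF \<open>N \<le> q\<close>] by (intro mult_right_mono) auto
    finally show "norm ((1/2::real) ^ Suc q * real (Suc q + 1) ^ r) \<le> 3/4 * norm ((1/2::real) ^ q * real (q + 1) ^ r)"
      by simp
  qed simp
qed

definition poly_geometric :: "nat \<Rightarrow> real" where
  "poly_geometric r = (\<Sum>q. (1/2) ^ q * real (q + 1) ^ r)"

lemma poly_geometric_ge: "(\<Sum>q\<le>K. (1/2) ^ q * real (q + 1) ^ r) \<le> poly_geometric r"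
  unfolding poly_geometric_def by (intro sum_le_suminf summable_poly_geometric) auto

lemma poly_geometric_nonneg: "0 \<le> poly_geometric r"
  unfolding poly_geometric_def by (intro suminf_nonneg summable_poly_geometric) auto

text \<open>Blocks of length about \<open>1 / \<theta>\<close> reduce the weights to powers of 2.\<close>

lemma weighted_sum_le:
  fixes u :: "nat \<Rightarrow> real"
  assumes u: "\<And>k. 0 \<le> u k" and sum: "\<And>K. (\<Sum>k\<le>K. u k) \<le> c * real (K + 1) ^ r"
    and \<theta>: "0 < \<theta>" "\<theta> \<le> 1" and "0 \<le> c"
  shows "(\<Sum>k\<le>K. 2 powr (- \<theta> * real k) * u k) \<le> c * (poly_geometric r * (2 / \<theta>) ^ r)"
proof -
  define L where "L = nat \<lceil>1 / \<theta>\<rceil>"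
  have L: "1 / \<theta> \<le> real L" "real L \<le> 2 / \<theta>" "0 < L"
  proof -
    have "1 \<le> 1 / \<theta>" using \<theta> by simp
    then show "1 / \<theta> \<le> real L" "real L \<le> 2 / \<theta>" "0 < L" unfolding L_def by linarith+
  qed
  have pow: "2 powr (- \<theta> * real k) \<le> (1/2) ^ (k div L)" for k
  proof -
    have "1 \<le> \<theta> * real L" using L(1) \<theta> by (simp add: field_simps)
    from mult_right_mono[OF this, of "real (k div L)"]
    have "real (k div L) \<le> \<theta> * (real L * real (k div L))" by simp
    also have "\<dots> \<le> \<theta> * real k"
    proof (rule mult_left_mono)
      have "L * (k div L) \<le> k" by simp
      then show "real L * real (k div L) \<le> real k" unfolding of_nat_mult[symmetric] of_nat_le_iff .
    qed (use \<theta> in simp)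
    finally have "- \<theta> * real k \<le> - real (k div L)" by simp
    then have "2 powr (- \<theta> * real k) \<le> 2 powr (- real (k div L))" by simp
    also have "\<dots> = (1/2) ^ (k div L)" by (rule two_powr_minus_nat)
    finally show ?thesis .
  qed
  have "(\<Sum>k\<le>K. 2 powr (- \<theta> * real k) * u k) \<le> (\<Sum>k\<le>K. (1/2) ^ (k div L) * u k)"
    using pow u by (intro sum_mono mult_right_mono) auto
  \<comment> \<open>This replaces a summation by parts: a term is charged to its own block and to
    all later ones up to \<open>K\<close>, so that for each \<open>q\<close> only an initial partial
    sum occurs, and these are what the hypothesis controls.\<close>
  also have "\<dots> \<le> (\<Sum>k\<le>K. \<Sum>q\<le>K. if k < (q + 1) * L then (1/2) ^ q * u k else 0)"
  proof (intro sum_mono)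
    fix k assume k: "k \<in> {..K}"
    have "k < (k div L + 1) * L" using L(3) by (simp add: dividend_less_div_times)
    moreover have "k div L \<le> K" using k by (meson atMost_iff div_le_dividend le_trans)
    ultimately have "(1/2) ^ (k div L) * u k = (\<Sum>q\<in>{k div L}. if k < (q + 1) * L then (1/2) ^ q * u k else 0)"
      by simp
    also have "\<dots> \<le> (\<Sum>q\<le>K. if k < (q + 1) * L then (1/2) ^ q * u k else 0)"
      using u \<open>k div L \<le> K\<close> by (intro sum_mono2) auto
    finally show "(1/2) ^ (k div L) * u k \<le> (\<Sum>q\<le>K. if k < (q + 1) * L then (1/2) ^ q * u k else 0)" .
  qed
  also have "\<dots> = (\<Sum>q\<le>K. \<Sum>k\<le>K. if k < (q + 1) * L then (1/2) ^ q * u k else 0)" by (rule sum.swap)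
  also have "\<dots> \<le> (\<Sum>q\<le>K. c * real L ^ r * ((1/2) ^ q * real (q + 1) ^ r))"
  proof (intro sum_mono)
    fix q
    have "(\<Sum>k\<le>K. if k < (q + 1) * L then (1/2) ^ q * u k else 0) = (\<Sum>k\<in>{..K} \<inter> {..<(q + 1) * L}. (1/2) ^ q * u k)"
      by (simp add: sum.inter_restrict)
    also have "\<dots> \<le> (\<Sum>k\<le>(q + 1) * L - 1. (1/2) ^ q * u k)"
      using u by (intro sum_mono2) auto
    also have "\<dots> \<le> (1/2) ^ q * (c * real ((q + 1) * L - 1 + 1) ^ r)"
      unfolding sum_distrib_left[symmetric] by (intro mult_left_mono sum) auto
    also have "(q + 1) * L - 1 + 1 = (q + 1) * L" using L(3) by simp
    finally show "(\<Sum>k\<le>K. if k < (q + 1) * L then (1/2) ^ q * u k else 0) \<le> c * real L ^ r * ((1/2) ^ q * real (q + 1) ^ r)"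
      by (simp only: of_nat_mult power_mult_distrib mult_ac)
  qed
  also have "\<dots> = c * real L ^ r * (\<Sum>q\<le>K. (1/2) ^ q * real (q + 1) ^ r)" by (simp add: sum_distrib_left)
  also have "\<dots> \<le> c * (2 / \<theta>) ^ r * poly_geometric r"
    using L(2) \<open>0 \<le> c\<close> \<theta> by (intro mult_mono power_mono poly_geometric_ge mult_left_mono sum_nonneg mult_nonneg_nonneg) auto
  finally show ?thesis by (simp add: mult_ac)
qed

text \<open>A sum over levels replaces the supremum over rectangles: \<open>\<Phi>\<close> takes the
  weight \<open>2 powr (- s * k)\<close> on the union of the rectangles of level \<open>k\<close>.
  Splitting off \<open>(1/2) ^ k\<close> from the weight leaves \<theta> = s - 1 for
  \<open>weighted_sum_le\<close>.\<close>

lemma density_majorant: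
  assumes bx: "boxes M E" and lb: "level_bound M E C r" and G: "finite G" "G \<subseteq> E" "incomparable G"
    and B: "B \<in> fmeasurable M" and s: "1 < s" "s \<le> 2" and "0 \<le> C"
  obtains \<Phi> :: "'a \<Rightarrow> ennreal" where "\<Phi> \<in> borel_measurable M"
    "\<And>I x. I \<in> G \<Longrightarrow> x \<in> I \<Longrightarrow> ennreal ((measure M (I \<inter> B) / measure M I) powr s) \<le> \<Phi> x"
    "(\<integral>\<^sup>+x. \<Phi> x \<partial>M) \<le> ennreal (C * poly_geometric r * (2 / (s - 1)) ^ r * measure M B)"
proof -
  have I: "I \<in> fmeasurable M" "0 < measure M I" if "I \<in> G" for I using that G bx unfolding boxes_def by auto
  have le: "measure M (I \<inter> B) \<le> measure M I" if "I \<in> G" for I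
    using I[OF that] B by (intro measure_mono_fmeasurable) auto
  have "\<exists>k. level M B k I" if IG: "I \<in> G" "0 < measure M (I \<inter> B)" for I
  proof -
    obtain K where K: "(1/2) ^ K < measure M (I \<inter> B) / measure M I"
      using real_arch_pow_inv[of "measure M (I \<inter> B) / measure M I" "1/2"] IG I(2)[OF IG(1)] by auto
    have "(1/2) ^ Suc K * measure M I < measure M (I \<inter> B)"
    proof -
      have "(1/2) ^ Suc K * measure M I \<le> (1/2) ^ K * measure M I"
        using I(2)[OF IG(1)] by simp
      also have "\<dots> < measure M (I \<inter> B)" using K I(2)[OF IG(1)] by (simp add: field_simps)
      finally show ?thesis .
    qed
    from level_exists[OF this le[OF IG(1)]] show ?thesis by blast
  qed
  \<comment> \<open>On rectangles of density 0 the value of \<open>lev\<close> is arbitrary; for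
    these the power of the density is 0.\<close>
  then obtain lev where lev: "\<And>I. I \<in> G \<Longrightarrow> 0 < measure M (I \<inter> B) \<Longrightarrow> level M B (lev I) I" by metis
  define K where "K = Max (insert 0 (lev ` G))"
  have K: "lev I \<le> K" if "I \<in> G" for I unfolding K_def using that G(1) by (intro Max_ge) auto
  let ?U = "\<lambda>k. \<Union>{I\<in>G. level M B k I}"
  have U: "?U k \<in> fmeasurable M" for k using G by (intro fmeasurable_Union_boxes[OF bx]) auto
  let ?\<Phi> = "\<lambda>x. \<Sum>k\<le>K. ennreal (2 powr (- s * real k)) * indicator (?U k) x"
  show thesis
  proof (rule that[of ?\<Phi>])
    show "?\<Phi> \<in> borel_measurable M"
      using U by (intro borel_measurable_sum borel_measurable_times_ennreal borel_measurable_indicator) auto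
  next
    fix J x assume J: "J \<in> G" "x \<in> J"
    show "ennreal ((measure M (J \<inter> B) / measure M J) powr s) \<le> ?\<Phi> x"
    proof (cases "0 < measure M (J \<inter> B)")
      case True
      let ?k = "lev J"
      have l: "level M B ?k J" by (rule lev[OF J(1) True])
      then have "measure M (J \<inter> B) / measure M J \<le> (1/2) ^ ?k"
        using I(2)[OF J(1)] by (simp add: level_def field_simps)
      also have "\<dots> = 2 powr (- real ?k)" by (rule two_powr_minus_nat[symmetric])
      finally have "(measure M (J \<inter> B) / measure M J) powr s \<le> (2 powr (- real ?k)) powr s"
        using s by (intro powr_mono2) auto
      also have "\<dots> = 2 powr (- s * real ?k)" by (simp add: powr_powr mult.commute)
      finally have "ennreal ((measure M (J \<inter> B) / measure M J) powr s) \<le> ennreal (2 powr (- s * real ?k)) * indicator (?U ?k) x"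
        using l J by (auto simp: indicator_def intro: ennreal_leI)
      also have "\<dots> \<le> ?\<Phi> x" using K[OF J(1)] by (intro member_le_sum) auto
      finally show ?thesis .
    next
      case False
      then have "measure M (J \<inter> B) = 0" by (simp add: zero_less_measure_iff)
      then show ?thesis using s by simp
    qed
  next
    have "(\<integral>\<^sup>+x. ?\<Phi> x \<partial>M) = (\<Sum>k\<le>K. ennreal (2 powr (- s * real k)) * emeasure M (?U k))"
      using U by (subst nn_integral_sum) (auto simp: nn_integral_cmult_indicator fmeasurableD intro!: sum.cong borel_measurable_times_ennreal borel_measurable_indicator)
    also have "\<dots> = (\<Sum>k\<le>K. ennreal (2 powr (- s * real k) * measure M (?U k)))"
      using U by (intro sum.cong refl) (simp add: emeasure_eq_measure2 ennreal_mult)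
    also have "\<dots> = ennreal (\<Sum>k\<le>K. 2 powr (- s * real k) * measure M (?U k))"
      by (intro sum_ennreal) auto
    also have "(\<Sum>k\<le>K. 2 powr (- s * real k) * measure M (?U k)) =
        (\<Sum>k\<le>K. 2 powr (- (s - 1) * real k) * ((1/2) ^ k * measure M (?U k)))"
    proof (intro sum.cong refl)
      fix k
      have "2 powr (- s * real k) = 2 powr (- (s - 1) * real k) * 2 powr (- real k)"
        by (simp add: powr_add[symmetric] algebra_simps)
      also have "2 powr (- real k) = (1/2) ^ k" by (rule two_powr_minus_nat)
      finally show "2 powr (- s * real k) * measure M (?U k) = 2 powr (- (s - 1) * real k) * ((1/2) ^ k * measure M (?U k))"
        by simp
    qed
    also have "\<dots> \<le> C * measure M B * (poly_geometric r * (2 / (s - 1)) ^ r)"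
    proof (rule weighted_sum_le)
      show "(\<Sum>k\<le>K. (1/2) ^ k * measure M (?U k)) \<le> C * measure M B * real (K + 1) ^ r" for K
        using level_boundD[OF lb G B, of K] by (simp add: mult_ac)
    qed (use s \<open>0 \<le> C\<close> in auto)
    finally show "(\<integral>\<^sup>+x. ?\<Phi> x \<partial>M) \<le> ennreal (C * poly_geometric r * (2 / (s - 1)) ^ r * measure M B)"
      by (simp add: ennreal_leI mult_ac)
  qed
qed

text \<open>Only scales \<open>2\<^sup>j \<ge> F / 8\<close> matter; there Chebyshev's bound \<open>\<beta> j \<le> F / 2\<^sup>j\<close> makes the weights
  \<open>w j = sqrt (F / 2\<^sup>j)\<close> summable, and trading \<open>w j\<close> for a power of \<open>\<beta> j\<close> costs only half of the
  exponent \<open>p - 1\<close>.\<close>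

lemma average_powr_le:
  fixes \<beta> :: "int \<Rightarrow> real"
  assumes J: "finite J" and \<beta>: "\<And>j. j \<in> J \<Longrightarrow> 0 \<le> \<beta> j" "(\<Sum>j\<in>J. \<beta> j) \<le> 1"
    and F: "0 \<le> F" "F \<le> (\<Sum>j\<in>J. 2 * 2 powr j * \<beta> j)" "\<And>j. j \<in> J \<Longrightarrow> 2 powr j * \<beta> j \<le> F"
    and p: "1 < p" "p \<le> 2"
  shows "F powr p \<le> 768 * (\<Sum>j\<in>J. (2 powr j) powr p * \<beta> j powr ((1 + p) / 2))"
proof (cases "F = 0")
  case True
  then show ?thesis using p by (auto intro!: sum_nonneg mult_nonneg_nonneg)
next
  case False
  with F have F0: "0 < F" by simp
  define H where "H = {j\<in>J. F / 8 \<le> 2 powr j}"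
  have H: "finite H" "H \<subseteq> J" using J unfolding H_def by auto
  define w where "w j = sqrt (F * 2 powr (- real_of_int j))" for j :: int
  have w0: "0 < w j" for j unfolding w_def using F0 by simp
  define j0 where "j0 = \<lceil>log 2 (F / 8)\<rceil>"
  \<comment> \<open>\<open>j0\<close> is the least admissible scale, where the square of
    \<open>w\<close> is at most 8; it halves with every further scale. Enlarging 8 and 1/2 to the
    squares 9 and 9/16 keeps the geometric bound free of roots.\<close>
  have w_le: "w j \<le> 3 * (3/4) ^ nat (j - j0)" "j0 \<le> j" if "j \<in> H" for j
  proof -
    have "log 2 (F / 8) \<le> j"
      using that F0 unfolding H_def by (simp add: log_le_iff)
    then show "j0 \<le> j" unfolding j0_def by (simp add: ceiling_le_iff)
    then have e: "- real_of_int j = - real_of_int j0 + - real (nat (j - j0))" by simp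
    have "F / 8 \<le> 2 powr j0"
      using F0 unfolding j0_def by (subst log_le_iff[symmetric]) auto
    then have "F * 2 powr (- real_of_int j0) \<le> 8"
      by (simp add: powr_minus field_simps)
    then have "F * 2 powr (- real_of_int j0) * 2 powr (- real (nat (j - j0))) \<le> 8 * 2 powr (- real (nat (j - j0)))"
      by (intro mult_right_mono) auto
    moreover have "2 powr (- real_of_int j) = 2 powr (- real_of_int j0) * 2 powr (- real (nat (j - j0)))"
      unfolding e by (rule powr_add)
    then have "F * 2 powr (- real_of_int j) = F * 2 powr (- real_of_int j0) * 2 powr (- real (nat (j - j0)))"
      by (simp only: mult.assoc)
    ultimately have "F * 2 powr (- real_of_int j) \<le> 8 * (1/2) ^ nat (j - j0)"
      unfolding two_powr_minus_nat by linarith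
    also have "\<dots> \<le> 9 * (9/16) ^ nat (j - j0)"
      by (intro mult_mono power_mono) auto
    also have "\<dots> = (3 * (3/4) ^ nat (j - j0))\<^sup>2"
    proof -
      have "((3/4::real) ^ n)\<^sup>2 = (9/16) ^ n" for n
        unfolding power2_eq_square power_mult_distrib[symmetric] by simp
      then show ?thesis by (simp add: power_mult_distrib)
    qed
    finally show "w j \<le> 3 * (3/4) ^ nat (j - j0)"
      unfolding w_def by (rule real_le_lsqrt[rotated]) simp
  qed
  have W: "(\<Sum>j\<in>H. w j) \<le> 12"
  proof -
    have inj: "inj_on (\<lambda>j. nat (j - j0)) H"
    proof (rule inj_onI)
      fix i j assume "i \<in> H" "j \<in> H" "nat (i - j0) = nat (j - j0)"
      with w_le(2)[of i] w_le(2)[of j] show "i = j" by (simp add: eq_nat_nat_iff)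
    qed
    have "(\<Sum>j\<in>H. w j) \<le> (\<Sum>j\<in>H. 3 * (3/4) ^ nat (j - j0))"
      by (intro sum_mono w_le)
    also have "\<dots> = 3 * (\<Sum>e\<in>(\<lambda>j. nat (j - j0)) ` H. (3/4) ^ e)"
      by (simp add: sum.reindex[OF inj] sum_distrib_left)
    also have "(\<Sum>e\<in>(\<lambda>j. nat (j - j0)) ` H. (3/4::real) ^ e) \<le> (\<Sum>e. (3/4) ^ e)"
      using H by (intro sum_le_suminf) auto
    also have "\<dots> = 4" by (subst suminf_geometric) auto
    finally show ?thesis by simp
  qed
  define z where "z j = 2 powr j * \<beta> j / w j" for j :: int
  have wz: "w j * z j = 2 powr j * \<beta> j" for j unfolding z_def using w0[of j] by simp
  have z0: "0 \<le> z j" if "j \<in> J" for j unfolding z_def using \<beta>(1)[OF that] w0[of j] by simp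
  \<comment> \<open>The weights sum to at most 12, so the terms \<open>w j * c\<close> take up at
    most \<open>F / 8\<close>, half of the lower bound \<open>F / 4\<close> obtained from the scales
    in \<open>H\<close>.\<close>
  define c where "c = F / 96"
  have c: "0 < c" unfolding c_def using F0 by simp
  have low: "(\<Sum>j\<in>J - H. 2 powr j * \<beta> j) \<le> F / 8"
  proof -
    have "(\<Sum>j\<in>J - H. 2 powr j * \<beta> j) \<le> (\<Sum>j\<in>J - H. F / 8 * \<beta> j)"
      using \<beta> unfolding H_def by (intro sum_mono mult_right_mono) auto
    also have "\<dots> \<le> (\<Sum>j\<in>J. F / 8 * \<beta> j)"
      using J \<beta> F0 by (intro sum_mono2) auto
    also have "\<dots> = F / 8 * (\<Sum>j\<in>J. \<beta> j)" by (simp add: sum_distrib_left)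
    also have "\<dots> \<le> F / 8" using \<beta>(2) F0 by simp
    finally show ?thesis .
  qed
  have "F \<le> 2 * (\<Sum>j\<in>J. 2 powr j * \<beta> j)"
    using F(2) by (simp add: sum_distrib_left mult.assoc)
  also have "(\<Sum>j\<in>J. 2 powr j * \<beta> j) = (\<Sum>j\<in>J - H. 2 powr j * \<beta> j) + (\<Sum>j\<in>H. 2 powr j * \<beta> j)"
    using J H by (metis sum.subset_diff)
  finally have "F / 4 \<le> (\<Sum>j\<in>H. w j * z j)" using low F0 unfolding wz by simp
  also have "\<dots> \<le> (\<Sum>j\<in>H. w j * c + w j * (z j powr p * c powr (1 - p)))"
  proof (intro sum_mono)
    fix j assume j: "j \<in> H"
    have "z j \<le> c + z j powr p * c powr (1 - p)"
    proof (cases "z j \<le> c")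
      case True
      then show ?thesis by (simp add: add_increasing2)
    next
      case False
      then have "z j = z j powr p * z j powr (1 - p)"
        using c by (simp add: powr_add[symmetric])
      also have "\<dots> \<le> z j powr p * c powr (1 - p)"
        using False c p by (intro mult_left_mono powr_mono2') auto
      finally show ?thesis using c by simp
    qed
    then have "w j * z j \<le> w j * (c + z j powr p * c powr (1 - p))"
      using w0[of j] by (intro mult_left_mono) auto
    then show "w j * z j \<le> w j * c + w j * (z j powr p * c powr (1 - p))" by (simp add: distrib_left)
  qed
  also have "\<dots> = (\<Sum>j\<in>H. w j) * c + c powr (1 - p) * (\<Sum>j\<in>H. w j * z j powr p)"
    by (simp add: sum.distrib sum_distrib_left sum_distrib_right mult_ac)
  also have "(\<Sum>j\<in>H. w j) * c \<le> 12 * c" using W c by (intro mult_right_mono) auto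
  finally have "F / 8 \<le> c powr (1 - p) * (\<Sum>j\<in>H. w j * z j powr p)" unfolding c_def by simp
  then have "c powr (p - 1) * (F / 8) \<le> c powr (p - 1) * (c powr (1 - p) * (\<Sum>j\<in>H. w j * z j powr p))"
    by (intro mult_left_mono) auto
  also have "\<dots> = (c powr (p - 1) * c powr (1 - p)) * (\<Sum>j\<in>H. w j * z j powr p)" by simp
  also have "c powr (p - 1) * c powr (1 - p) = 1" using c by (simp add: powr_add[symmetric])
  finally have main: "c powr (p - 1) * (F / 8) \<le> (\<Sum>j\<in>H. w j * z j powr p)" by simp
  have "(\<Sum>j\<in>H. w j * z j powr p) \<le> (\<Sum>j\<in>H. (2 powr j) powr p * \<beta> j powr ((1 + p) / 2))"
  proof (intro sum_mono)
    fix j assume j: "j \<in> H"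
    then have jJ: "j \<in> J" using H by auto
    show "w j * z j powr p \<le> (2 powr j) powr p * \<beta> j powr ((1 + p) / 2)"
    proof (cases "\<beta> j = 0")
      case True
      then show ?thesis using p by (simp add: z_def)
    next
      case False
      then have b: "0 < \<beta> j" using \<beta>(1)[OF jJ] by simp
      have "\<beta> j \<le> F * 2 powr (- real_of_int j)"
        using F(3)[OF jJ] by (simp add: powr_minus field_simps)
      \<comment> \<open>After inserting \<open>z j\<close>, the weight occurs with the exponent 1 -
        p < 0, so a lower bound for \<open>w j\<close> is wanted. The resulting exponent of
        \<open>\<beta> j\<close> is p + (1 - p) / 2 = (1 + p) / 2, still above 1.\<close>
      then have "sqrt (\<beta> j) \<le> w j" unfolding w_def by simp
      then have "w j powr (1 - p) \<le> sqrt (\<beta> j) powr (1 - p)"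
        using b p by (intro powr_mono2') auto
      also have "\<dots> = \<beta> j powr ((1 - p) / 2)"
        using b by (simp add: powr_half_sqrt[symmetric] powr_powr)
      finally have wb: "w j powr (1 - p) \<le> \<beta> j powr ((1 - p) / 2)" .
      have "w j * z j powr p = (w j powr 1 * w j powr (- p)) * ((2 powr j) powr p * \<beta> j powr p)"
        unfolding z_def using w0[of j] b by (simp add: powr_divide powr_mult powr_minus field_simps)
      also have "w j powr 1 * w j powr (- p) = w j powr (1 - p)"
        by (simp only: powr_add[symmetric]) simp
      also have "w j powr (1 - p) * ((2 powr j) powr p * \<beta> j powr p) \<le> \<beta> j powr ((1 - p) / 2) * ((2 powr j) powr p * \<beta> j powr p)"
        using wb by (intro mult_right_mono) auto
      also have "\<dots> = (2 powr j) powr p * (\<beta> j powr ((1 - p) / 2) * \<beta> j powr p)" by simp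
      also have "\<beta> j powr ((1 - p) / 2) * \<beta> j powr p = \<beta> j powr ((1 + p) / 2)"
        by (simp add: powr_add[symmetric] field_simps)
      finally show ?thesis .
    qed
  qed
  also have "\<dots> \<le> (\<Sum>j\<in>J. (2 powr j) powr p * \<beta> j powr ((1 + p) / 2))"
    using J H by (intro sum_mono2) auto
  finally have S: "c powr (p - 1) * (F / 8) \<le> (\<Sum>j\<in>J. (2 powr j) powr p * \<beta> j powr ((1 + p) / 2))"
    using main by simp
  have "F powr p = F powr 1 * F powr (p - 1)" by (simp only: powr_add[symmetric]) simp
  also have "F powr (p - 1) = c powr (p - 1) * 96 powr (p - 1)"
    unfolding c_def using F0 by (simp add: powr_mult[symmetric])
  also have "F powr 1 * (c powr (p - 1) * 96 powr (p - 1)) = 8 * 96 powr (p - 1) * (c powr (p - 1) * (F / 8))"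
    using F0 by simp
  also have "\<dots> \<le> 8 * 96 powr 1 * (c powr (p - 1) * (F / 8))"
    using F0 p by (intro mult_right_mono mult_left_mono powr_mono) auto
  also have "\<dots> \<le> 768 * (\<Sum>j\<in>J. (2 powr j) powr p * \<beta> j powr ((1 + p) / 2))"
  proof -
    have eq: "8 * 96 powr 1 = (768::real)" by simp
    show ?thesis unfolding eq by (rule mult_left_mono[OF S]) simp
  qed
  finally show ?thesis .
qed


section \<open>Powers of extended numbers and the strong type estimate\<close>

lemma ennpowr_ennreal: "0 \<le> r \<Longrightarrow> ennpowr (ennreal r) p = ennreal (r powr p)"
  by (simp add: ennpowr_def)

lemma ennpowr_measurable [measurable]:
  assumes "f \<in> borel_measurable M"
  shows "(\<lambda>x. ennpowr (f x) p) \<in> borel_measurable M"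
  using assms unfolding ennpowr_def by measurable

text \<open>Comparison with finite thresholds determines an extended number, so monotonicity and
  compatibility with suprema follow from this without treating infinity separately.\<close>

lemma less_ennpowr_iff:
  assumes "0 < p" "0 \<le> t"
  shows "ennreal t < ennpowr a p \<longleftrightarrow> ennreal (t powr (1 / p)) < a"
proof (cases a)
  case (real r)
  have "t < r powr p \<longleftrightarrow> t powr (1 / p) < r"
  proof
    assume "t < r powr p"
    then have "t powr (1 / p) < (r powr p) powr (1 / p)"
      using assms by (intro powr_less_mono2) auto
    then show "t powr (1 / p) < r" using assms real by (simp add: powr_powr)
  next
    assume "t powr (1 / p) < r"
    then have "(t powr (1 / p)) powr p < r powr p"
      using assms by (intro powr_less_mono2) auto
    then show "t < r powr p" using assms by (simp add: powr_powr)
  qed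
  then show ?thesis using real assms by (simp add: ennpowr_ennreal ennreal_less_iff)
next
  case top
  then show ?thesis by (simp add: ennpowr_def)
qed

lemma ennpowr_SUP_le:
  assumes "0 < p" and le: "\<And>i. i \<in> S \<Longrightarrow> ennpowr (a i) p \<le> y"
  shows "ennpowr (SUP i\<in>S. a i) p \<le> y"
proof (rule dense_le)
  fix z assume z: "z < ennpowr (SUP i\<in>S. a i) p"
  then have "z \<noteq> top" using top.not_eq_extremum by fastforce
  then obtain t where t: "0 \<le> t" "z = ennreal t" by (cases z) auto
  then have "ennreal (t powr (1 / p)) < (SUP i\<in>S. a i)" using z less_ennpowr_iff[OF assms(1)] by blast
  then obtain i where "i \<in> S" "ennreal (t powr (1 / p)) < a i" by (auto simp: less_SUP_iff)
  then have "z < ennpowr (a i) p" using t less_ennpowr_iff[OF assms(1)] by blast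
  then show "z \<le> y" using le[OF \<open>i \<in> S\<close>] by simp
qed

lemma ennpowr_mono:
  assumes "0 < p" "a \<le> b"
  shows "ennpowr a p \<le> ennpowr b p"
proof (rule dense_le)
  fix z assume z: "z < ennpowr a p"
  then have "z \<noteq> top" using top.not_eq_extremum by fastforce
  then obtain t where t: "0 \<le> t" "z = ennreal t" by (cases z) auto
  then show "z \<le> ennpowr b p"
    using z less_ennpowr_iff[OF assms(1)] assms(2) by (meson less_imp_le order_less_le_trans)
qed

text \<open>For the final root of order p: a constant at least 1 does not increase under an exponent
  at most 1, so it can be kept as it is.\<close>

lemma ennpowr_times_le:
  assumes "1 \<le> a" "0 < e" "e \<le> 1"
  shows "ennpowr (ennreal a * X) e \<le> ennreal a * ennpowr X e"
proof (cases X)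
  case (real r)
  have "ennpowr (ennreal a * X) e = ennreal ((a * r) powr e)"
    using real assms by (simp add: ennreal_mult[symmetric] ennpowr_ennreal)
  also have "(a * r) powr e = a powr e * r powr e" using real assms by (simp add: powr_mult)
  also have "\<dots> \<le> a powr 1 * r powr e" using assms by (intro mult_right_mono powr_mono) auto
  finally show ?thesis
    using real assms by (simp add: ennreal_mult[symmetric] ennpowr_ennreal ennreal_leI)
next
  case top
  then show ?thesis using assms by (simp add: ennpowr_def ennreal_mult_top)
qed

lemma poly_geometric_pos: "0 < poly_geometric r"
  using poly_geometric_ge[where K = 0 and r = r] by simp

text \<open>The dyadic shells \<open>B j\<close> of \<open>f\<close> turn an average over
  \<open>I\<close> into a combination of densities of \<open>I\<close> in the shells.
  \<open>average_powr_le\<close> bounds its power by powers s = (1 + p) / 2 of these densities, and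
  each of them is majorised by a function \<open>\<Phi> j\<close> that does not depend on
  \<open>I\<close>; what remains is linear in the shells. The two-sided bound on \<open>f\<close>
  keeps the shells finite in number.\<close>

lemma strong_type_finite:
  fixes f :: "'a \<Rightarrow> real" and L :: nat
  assumes bx: "boxes M E" and lb: "level_bound M E C r" and "0 < C"
    and G: "finite G" "G \<subseteq> E" "incomparable G" and p: "1 < p" "p \<le> 2"
    and f: "f \<in> borel_measurable M" "\<And>x. f x = 0 \<or> (2 powr (- real L) \<le> f x \<and> f x < 2 powr real L)"
  shows "(\<integral>\<^sup>+x. ennpowr (maximal_function M G f x) p \<partial>M) \<le>
    ennreal (768 * C * poly_geometric r * (4 / (p - 1)) ^ r) * (\<integral>\<^sup>+x. ennpowr (ennreal \<bar>f x\<bar>) p \<partial>M)"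
    (is "_ \<le> ennreal ?K * ?I")
proof (cases "?I = \<infinity>")
  case True
  define k where "k = ?K"
  \<comment> \<open>Positivity is essential: in \<open>ennreal\<close> the product of 0 and
    \<infinity> is 0, and the right-hand side would collapse.\<close>
  have "0 < k" unfolding k_def using p \<open>0 < C\<close> poly_geometric_pos by (intro mult_pos_pos) auto
  then have "ennreal k * \<infinity> = \<infinity>" by (simp add: ennreal_mult_eq_top_iff)
  then show ?thesis unfolding True k_def[symmetric] by simp
next
  case False
  have f0: "0 \<le> f x" for x using f(2)[of x] by (metis order.refl order_trans powr_ge_zero)
  define s where "s = (1 + p) / 2"
  have s: "1 < s" "s \<le> 2" unfolding s_def using p by auto
  define J where "J = {- int L..<int L}"
  have finJ: "finite J" unfolding J_def by simp
  define B where "B j = {x\<in>space M. 2 powr real_of_int j \<le> f x \<and> f x < 2 powr (real_of_int j + 1)}" for j :: int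
  have B[measurable]: "B j \<in> sets M" for j unfolding B_def using f(1) by measurable
  have Bdisj: "i = j" if "x \<in> B i" "x \<in> B j" for x i j
  proof -
    have x: "2 powr i \<le> f x" "f x < 2 powr (real_of_int i + 1)" "2 powr j \<le> f x" "f x < 2 powr (real_of_int j + 1)"
      using that unfolding B_def by auto
    have "(2::real) powr i < 2 powr (real_of_int j + 1)" "(2::real) powr j < 2 powr (real_of_int i + 1)"
      by (rule order_le_less_trans[OF x(1,4)], rule order_le_less_trans[OF x(3,2)])
    then have "real_of_int i < real_of_int j + 1" "real_of_int j < real_of_int i + 1" by simp_all
    then show ?thesis by linarith
  qed
  have Bcover: "\<exists>j\<in>J. x \<in> B j" if "x \<in> space M" "f x \<noteq> 0" for x
  proof -
    have fx: "2 powr (- real L) \<le> f x" "f x < 2 powr real L" "0 < f x"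
      using f(2)[of x] that f0[of x] by auto
    define j where "j = \<lfloor>log 2 (f x)\<rfloor>"
    have "- real L \<le> log 2 (f x)" "log 2 (f x) < real L"
      using fx by (auto simp: le_log_iff log_less_iff)
    then have "j \<in> J" unfolding J_def j_def by (auto simp: le_floor_iff floor_less_iff)
    moreover have "2 powr j \<le> f x" "f x < 2 powr (real_of_int j + 1)"
    proof -
      have "real_of_int j \<le> log 2 (f x)" "log 2 (f x) < real_of_int j + 1"
        unfolding j_def by linarith+
      then show "2 powr j \<le> f x" "f x < 2 powr (real_of_int j + 1)"
        using fx(3) by (auto simp: le_log_iff log_less_iff)
    qed
    ultimately show ?thesis using that(1) unfolding B_def by auto
  qed
  have sumI: "(\<Sum>j\<in>J. ennreal ((2 powr j) powr p) * emeasure M (B j)) \<le> ?I"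
  proof -
    have "(\<Sum>j\<in>J. ennreal ((2 powr j) powr p) * emeasure M (B j)) =
        (\<integral>\<^sup>+x. (\<Sum>j\<in>J. ennreal ((2 powr j) powr p) * indicator (B j) x) \<partial>M)"
      by (subst nn_integral_sum) (auto simp: nn_integral_cmult_indicator)
    also have "\<dots> \<le> ?I"
    proof (rule nn_integral_mono)
      fix x
      show "(\<Sum>j\<in>J. ennreal ((2 powr j) powr p) * indicator (B j) x) \<le> ennpowr (ennreal \<bar>f x\<bar>) p"
      proof (cases "\<exists>i\<in>J. x \<in> B i")
        case True
        then obtain i where i: "i \<in> J" "x \<in> B i" by blast
        have "(\<Sum>j\<in>J. ennreal ((2 powr j) powr p) * indicator (B j) x) =
            (\<Sum>j\<in>{i}. ennreal ((2 powr j) powr p) * indicator (B j) x)"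
          using i finJ Bdisj by (intro sum.mono_neutral_right) (auto simp: indicator_def)
        also have "\<dots> = ennreal ((2 powr i) powr p)" using i by simp
        also have "\<dots> \<le> ennreal (\<bar>f x\<bar> powr p)"
          using i p unfolding B_def by (intro ennreal_leI powr_mono2) auto
        finally show ?thesis by (simp add: ennpowr_ennreal)
      next
        case False
        then have "(\<Sum>j\<in>J. ennreal ((2 powr j) powr p) * indicator (B j) x) = 0"
          by (intro sum.neutral) auto
        then show ?thesis by simp
      qed
    qed
    finally show ?thesis .
  qed
  have Bfm: "B j \<in> fmeasurable M" if "j \<in> J" for j
  proof (rule fmeasurableI[OF B])
    have "ennreal ((2 powr j) powr p) * emeasure M (B j) \<le> ?I"
      using member_le_sum[of j J "\<lambda>j. ennreal ((2 powr j) powr p) * emeasure M (B j)"] that finJ sumI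
      by (meson order_trans zero_le)
    then have "ennreal ((2 powr j) powr p) * emeasure M (B j) < \<infinity>"
      using False by (metis infinity_ennreal_def order_le_less_trans top.not_eq_extremum)
    then show "emeasure M (B j) < \<infinity>"
      by (auto simp: ennreal_mult_less_top)
  qed
  have "\<exists>\<Phi>. \<Phi> \<in> borel_measurable M \<and>
    (\<forall>I x. I \<in> G \<longrightarrow> x \<in> I \<longrightarrow> ennreal ((measure M (I \<inter> B j) / measure M I) powr s) \<le> \<Phi> x) \<and>
    (\<integral>\<^sup>+x. \<Phi> x \<partial>M) \<le> ennreal (C * poly_geometric r * (2 / (s - 1)) ^ r * measure M (B j))" if "j \<in> J" for j
    using density_majorant[OF bx lb G Bfm[OF that] s less_imp_le[OF \<open>0 < C\<close>]] by metis
  then obtain \<Phi> where \<Phi>: "\<And>j. j \<in> J \<Longrightarrow> \<Phi> j \<in> borel_measurable M"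
      "\<And>j I x. j \<in> J \<Longrightarrow> I \<in> G \<Longrightarrow> x \<in> I \<Longrightarrow> ennreal ((measure M (I \<inter> B j) / measure M I) powr s) \<le> \<Phi> j x"
      "\<And>j. j \<in> J \<Longrightarrow> (\<integral>\<^sup>+x. \<Phi> j x \<partial>M) \<le> ennreal (C * poly_geometric r * (2 / (s - 1)) ^ r * measure M (B j))"
    by metis
  have pointwise: "ennpowr ((\<integral>\<^sup>+y\<in>I. ennreal \<bar>f y\<bar> \<partial>M) / emeasure M I) p \<le>
      768 * (\<Sum>j\<in>J. ennreal ((2 powr j) powr p) * \<Phi> j x)" if I: "I \<in> G" "x \<in> I" for I x
  proof -
    let ?X = "\<integral>\<^sup>+y\<in>I. ennreal \<bar>f y\<bar> \<partial>M"
    have Ifm: "I \<in> fmeasurable M" "0 < measure M I" using I(1) G(2) bx unfolding boxes_def by auto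
    have [measurable]: "I \<in> sets M" using Ifm(1) by auto
    have IB: "I \<inter> B j \<in> fmeasurable M" for j using Ifm(1) B by (intro fmeasurable_Int_fmeasurable)
    have "?X \<le> (\<integral>\<^sup>+y. (\<Sum>j\<in>J. ennreal (2 * 2 powr j) * indicator (I \<inter> B j) y) \<partial>M)"
    proof (rule nn_integral_mono)
      fix y assume y: "y \<in> space M"
      show "ennreal \<bar>f y\<bar> * indicator I y \<le> (\<Sum>j\<in>J. ennreal (2 * 2 powr j) * indicator (I \<inter> B j) y)"
      proof (cases "y \<in> I \<and> f y \<noteq> 0")
        case True
        then obtain j where j: "j \<in> J" "y \<in> B j" using Bcover y by blast
        have "ennreal \<bar>f y\<bar> * indicator I y \<le> ennreal (2 * 2 powr j) * indicator (I \<inter> B j) y"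
          using j True f0[of y] unfolding B_def by (auto simp: powr_add intro!: ennreal_leI)
        also have "\<dots> \<le> (\<Sum>j\<in>J. ennreal (2 * 2 powr j) * indicator (I \<inter> B j) y)"
          using j finJ by (intro member_le_sum) auto
        finally show ?thesis .
      qed (auto simp: indicator_def)
    qed
    also have "\<dots> = (\<Sum>j\<in>J. ennreal (2 * 2 powr j) * emeasure M (I \<inter> B j))"
      by (subst nn_integral_sum) (auto simp: nn_integral_cmult_indicator)
    also have "\<dots> = (\<Sum>j\<in>J. ennreal (2 * 2 powr j * measure M (I \<inter> B j)))"
      using IB by (intro sum.cong refl) (simp add: emeasure_eq_measure2 ennreal_mult)
    also have "\<dots> = ennreal (\<Sum>j\<in>J. 2 * 2 powr j * measure M (I \<inter> B j))"
      by (intro sum_ennreal) auto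
    finally have X_le: "?X \<le> ennreal (\<Sum>j\<in>J. 2 * 2 powr j * measure M (I \<inter> B j))" .
    then have "?X \<noteq> top" by (metis ennreal_neq_top neq_top_trans)
    then obtain X where X: "0 \<le> X" "?X = ennreal X" by (cases ?X) auto
    have X_le': "X \<le> (\<Sum>j\<in>J. 2 * 2 powr j * measure M (I \<inter> B j))"
      using X_le unfolding X(2) by (subst (asm) ennreal_le_iff) (auto intro!: sum_nonneg)
    have X_ge: "2 powr j * measure M (I \<inter> B j) \<le> X" for j
    proof -
      have "ennreal (2 powr j * measure M (I \<inter> B j)) = ennreal (2 powr j) * emeasure M (I \<inter> B j)"
        using IB by (simp add: emeasure_eq_measure2 ennreal_mult)
      also have "\<dots> = (\<integral>\<^sup>+y. ennreal (2 powr j) * indicator (I \<inter> B j) y \<partial>M)"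
        by (simp add: nn_integral_cmult_indicator)
      also have "\<dots> \<le> ?X"
        by (rule nn_integral_mono) (auto simp: indicator_def B_def intro!: ennreal_leI)
      finally show ?thesis unfolding X(2) using X(1) by (simp add: ennreal_le_iff)
    qed
    define \<beta> where "\<beta> j = measure M (I \<inter> B j) / measure M I" for j
    have "(X / measure M I) powr p \<le> 768 * (\<Sum>j\<in>J. (2 powr j) powr p * \<beta> j powr ((1 + p) / 2))"
    proof (rule average_powr_le[OF finJ])
      show "(\<Sum>j\<in>J. \<beta> j) \<le> 1"
      proof -
        have "(\<Sum>j\<in>J. measure M (I \<inter> B j)) \<le> measure M I"
          using finJ IB Ifm Bdisj
          by (intro sum_measure_disjoint_le) (auto simp: disjoint_family_on_def)
        then show ?thesis using Ifm(2) unfolding \<beta>_def sum_divide_distrib[symmetric] by simp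
      qed
      show "X / measure M I \<le> (\<Sum>j\<in>J. 2 * 2 powr j * \<beta> j)"
        using divide_right_mono[OF X_le', of "measure M I"] unfolding \<beta>_def by (simp add: sum_divide_distrib)
      show "2 powr j * \<beta> j \<le> X / measure M I" for j
        using divide_right_mono[OF X_ge, of "measure M I"] unfolding \<beta>_def by simp
    qed (use X Ifm p in \<open>auto simp: \<beta>_def\<close>)
    then have "ennreal ((X / measure M I) powr p) \<le> ennreal (768 * (\<Sum>j\<in>J. (2 powr j) powr p * \<beta> j powr s))"
      unfolding s_def by (rule ennreal_leI)
    also have "\<dots> = 768 * (\<Sum>j\<in>J. ennreal ((2 powr j) powr p * \<beta> j powr s))"
      by (subst sum_ennreal) (auto simp: ennreal_mult sum_nonneg)
    also have "\<dots> \<le> 768 * (\<Sum>j\<in>J. ennreal ((2 powr j) powr p) * \<Phi> j x)"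
    proof (intro mult_left_mono sum_mono)
      fix j assume j: "j \<in> J"
      show "ennreal ((2 powr j) powr p * \<beta> j powr s) \<le> ennreal ((2 powr j) powr p) * \<Phi> j x"
        using mult_left_mono[OF \<Phi>(2)[OF j I], of "ennreal ((2 powr j) powr p)"]
        unfolding \<beta>_def by (simp add: ennreal_mult)
    qed auto
    finally have "ennreal ((X / measure M I) powr p) \<le> 768 * (\<Sum>j\<in>J. ennreal ((2 powr j) powr p) * \<Phi> j x)" .
    moreover have "?X / emeasure M I = ennreal (X / measure M I)"
      using X Ifm by (simp add: emeasure_eq_measure2 divide_ennreal)
    ultimately show ?thesis using X Ifm by (simp add: ennpowr_ennreal)
  qed
  have "(\<integral>\<^sup>+x. ennpowr (maximal_function M G f x) p \<partial>M) \<le> (\<integral>\<^sup>+x. 768 * (\<Sum>j\<in>J. ennreal ((2 powr j) powr p) * \<Phi> j x) \<partial>M)"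
    unfolding maximal_function_def using p pointwise by (intro nn_integral_mono ennpowr_SUP_le) auto
  also have "\<dots> = 768 * (\<Sum>j\<in>J. ennreal ((2 powr j) powr p) * (\<integral>\<^sup>+x. \<Phi> j x \<partial>M))"
    using \<Phi>(1) by (simp add: nn_integral_cmult nn_integral_sum)
  also have "\<dots> \<le> 768 * (\<Sum>j\<in>J. ennreal ((2 powr j) powr p) * ennreal (C * poly_geometric r * (2 / (s - 1)) ^ r * measure M (B j)))"
    using \<Phi>(3) by (intro mult_left_mono sum_mono) auto
  also have "\<dots> = 768 * (\<Sum>j\<in>J. ennreal (C * poly_geometric r * (2 / (s - 1)) ^ r) * (ennreal ((2 powr j) powr p) * emeasure M (B j)))"
  proof -
    define c where "c = C * poly_geometric r * (2 / (s - 1)) ^ r"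
    have "0 \<le> c"
      unfolding c_def using \<open>0 < C\<close> poly_geometric_nonneg s by (intro mult_nonneg_nonneg) auto
    then have "ennreal ((2 powr j) powr p) * ennreal (c * measure M (B j)) =
        ennreal c * (ennreal ((2 powr j) powr p) * emeasure M (B j))" if "j \<in> J" for j
      by (simp add: ennreal_mult emeasure_eq_measure2[OF Bfm[OF that]] mult_ac)
    then show ?thesis unfolding c_def[symmetric] by (simp cong: sum.cong)
  qed
  also have "\<dots> = 768 * (ennreal (C * poly_geometric r * (2 / (s - 1)) ^ r) * (\<Sum>j\<in>J. ennreal ((2 powr j) powr p) * emeasure M (B j)))"
    by (simp add: sum_distrib_left)
  also have "\<dots> \<le> 768 * (ennreal (C * poly_geometric r * (2 / (s - 1)) ^ r) * ?I)"
    using sumI by (intro mult_left_mono) auto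
  also have "\<dots> = ennreal (768 * (C * poly_geometric r * (2 / (s - 1)) ^ r)) * ?I"
    by (simp add: ennreal_mult' mult.assoc)
  \<comment> \<open>The 4 is 2 for rounding the block length up to an integer, times 2 for the
    halved exponent s - 1 = (p - 1) / 2.\<close>
  also have "768 * (C * poly_geometric r * (2 / (s - 1)) ^ r) = ?K"
  proof -
    have "2 / (s - 1) = 4 / (p - 1)" unfolding s_def using p by (simp add: field_simps)
    then show ?thesis by simp
  qed
  finally show ?thesis .
qed

section \<open>Passage to countable families and arbitrary functions\<close>

lemma maximal_function_measurable:
  assumes "countable G" "G \<subseteq> sets M"
  shows "maximal_function M G f \<in> borel_measurable M"
proof -
  have "maximal_function M G f = (\<lambda>x. SUP I\<in>G. ((\<integral>\<^sup>+y\<in>I. ennreal \<bar>f y\<bar> \<partial>M) / emeasure M I) * indicator I x)"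
    unfolding maximal_function_def
  proof (rule ext, rule antisym)
    fix x
    let ?c = "\<lambda>I. (\<integral>\<^sup>+y\<in>I. ennreal \<bar>f y\<bar> \<partial>M) / emeasure M I"
    show "(SUP I\<in>{I\<in>G. x \<in> I}. ?c I) \<le> (SUP I\<in>G. ?c I * indicator I x)"
      by (rule SUP_mono) (auto simp: indicator_def intro!: bexI)
    show "(SUP I\<in>G. ?c I * indicator I x) \<le> (SUP I\<in>{I\<in>G. x \<in> I}. ?c I)"
      by (rule SUP_least) (auto simp: indicator_def intro!: SUP_upper)
  qed
  also have "\<dots> \<in> borel_measurable M"
    using assms by (intro borel_measurable_SUP borel_measurable_times_ennreal borel_measurable_indicator) auto
  finally show ?thesis .
qed

lemma maximal_function_mono:
  assumes "G \<subseteq> G'" "\<And>x. \<bar>f x\<bar> \<le> \<bar>g x\<bar>"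
  shows "maximal_function M G f x \<le> maximal_function M G' g x"
  unfolding maximal_function_def
  using assms by (intro SUP_mono) (auto intro!: bexI divide_right_mono_ennreal nn_integral_mono mult_right_mono ennreal_leI)

text \<open>Monotone convergence in the family and in the function at once. The truncations of |f|
  to values from 2^-n up to 2^n increase and equal |f| at each point from some n on, and every
  rectangle eventually enters \<open>Gn n\<close>.\<close>

lemma strong_type:
  fixes f :: "'a \<Rightarrow> real"
  assumes bx: "boxes M E" and lb: "level_bound M E C r" and C: "0 < C"
    and G: "countable G" "G \<subseteq> E" "incomparable G" and p: "1 < p" "p \<le> 2"
    and f: "f \<in> borel_measurable M"
  shows "(\<integral>\<^sup>+x. ennpowr (maximal_function M G f x) p \<partial>M) \<le>
    ennreal (768 * C * poly_geometric r * (4 / (p - 1)) ^ r) * (\<integral>\<^sup>+x. ennpowr (ennreal \<bar>f x\<bar>) p \<partial>M)"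
    (is "_ \<le> ennreal ?K * ?I")
proof (cases "G = {}")
  case True
  then show ?thesis using p by (simp add: maximal_function_def ennpowr_def bot_ennreal)
next
  case False
  define Gn where "Gn n = from_nat_into G ` {..n}" for n :: nat
  have Gn: "finite (Gn n)" "Gn n \<subseteq> G" for n
    unfolding Gn_def using from_nat_into[OF False] by auto
  have Gn_mono: "Gn m \<subseteq> Gn n" if "m \<le> n" for m n unfolding Gn_def using that by auto
  have Gn_ex: "\<exists>n. I \<in> Gn n" if "I \<in> G" for I
    using from_nat_into_surj[OF G(1) that] unfolding Gn_def by auto
  define fn where "fn n x = (if 2 powr (- real n) \<le> \<bar>f x\<bar> \<and> \<bar>f x\<bar> < 2 powr real n then \<bar>f x\<bar> else 0)" for n x
  have fn_meas[measurable]: "fn n \<in> borel_measurable M" for n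
    unfolding fn_def using f by measurable
  have fn_le: "\<bar>fn n x\<bar> \<le> \<bar>f x\<bar>" for n x unfolding fn_def by auto
  have fn_mono: "\<bar>fn m x\<bar> \<le> \<bar>fn n x\<bar>" if "m \<le> n" for m n x
  proof -
    have n: "(2::real) powr (- real n) \<le> 2 powr (- real m)" "(2::real) powr real m \<le> 2 powr real n"
      using that by simp_all
    show ?thesis
    proof (cases "2 powr (- real m) \<le> \<bar>f x\<bar> \<and> \<bar>f x\<bar> < 2 powr real m")
      case True
      then have "2 powr (- real n) \<le> \<bar>f x\<bar>" "\<bar>f x\<bar> < 2 powr real n"
        using order_trans[OF n(1)] order_less_le_trans[OF _ n(2)] by blast+
      then show ?thesis unfolding fn_def by simp
    next
      case False
      then have "fn m x = 0" unfolding fn_def by (rule if_not_P)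
      then show ?thesis by simp
    qed
  qed
  have fn_ex: "\<exists>n. \<bar>fn n x\<bar> = \<bar>f x\<bar>" for x
  proof (cases "f x = 0")
    case True
    then show ?thesis unfolding fn_def by auto
  next
    case False
    obtain n where "\<bar>log 2 \<bar>f x\<bar>\<bar> < real n" using reals_Archimedean2 by blast
    then have "- real n \<le> log 2 \<bar>f x\<bar>" "log 2 \<bar>f x\<bar> < real n" by linarith+
    then have "2 powr (- real n) \<le> \<bar>f x\<bar>" "\<bar>f x\<bar> < 2 powr real n"
      using False by (auto simp: le_log_iff log_less_iff)
    then show ?thesis unfolding fn_def by auto
  qed
  have GE: "Gn n \<subseteq> E" "incomparable (Gn n)" for n
    using Gn(2)[of n] G(2,3) unfolding incomparable_def by blast+
  have Gsets: "G \<subseteq> sets M" using G(2) bx unfolding boxes_def by auto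
  let ?M = "\<lambda>n x. maximal_function M (Gn n) (fn n) x"
  have Mmono: "?M m x \<le> ?M n x" if "m \<le> n" for m n x
    by (intro maximal_function_mono Gn_mono fn_mono that)
  have pointwise: "ennpowr (maximal_function M G f x) p \<le> (SUP n. ennpowr (?M n x) p)" for x
    unfolding maximal_function_def[of M G]
  proof (rule ennpowr_SUP_le)
    fix I assume "I \<in> {I\<in>G. x \<in> I}"
    then have I: "I \<in> G" "x \<in> I" by auto
    then obtain m where m: "I \<in> Gn m" using Gn_ex by blast
    have [measurable]: "I \<in> sets M" using I Gsets by auto
    have "(\<integral>\<^sup>+y\<in>I. ennreal \<bar>f y\<bar> \<partial>M) \<le> (\<integral>\<^sup>+y. (SUP n. ennreal \<bar>fn n y\<bar> * indicator I y) \<partial>M)"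
    proof (rule nn_integral_mono)
      fix y
      obtain n where "\<bar>fn n y\<bar> = \<bar>f y\<bar>" using fn_ex by blast
      then have "ennreal \<bar>f y\<bar> * indicator I y = ennreal \<bar>fn n y\<bar> * indicator I y" by simp
      also have "\<dots> \<le> (SUP n. ennreal \<bar>fn n y\<bar> * indicator I y)" by (rule SUP_upper) simp
      finally show "ennreal \<bar>f y\<bar> * indicator I y \<le> (SUP n. ennreal \<bar>fn n y\<bar> * indicator I y)" .
    qed
    also have "\<dots> = (SUP n. \<integral>\<^sup>+y\<in>I. ennreal \<bar>fn n y\<bar> \<partial>M)"
      by (rule nn_integral_monotone_convergence_SUP)
        (auto simp: incseq_def le_fun_def intro!: mult_right_mono ennreal_leI fn_mono)
    finally have "(\<integral>\<^sup>+y\<in>I. ennreal \<bar>f y\<bar> \<partial>M) / emeasure M I \<le> (SUP n. \<integral>\<^sup>+y\<in>I. ennreal \<bar>fn n y\<bar> \<partial>M) / emeasure M I"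
      by (rule divide_right_mono_ennreal)
    also have "\<dots> = (SUP n. (\<integral>\<^sup>+y\<in>I. ennreal \<bar>fn n y\<bar> \<partial>M) / emeasure M I)"
      by (simp add: divide_ennreal_def SUP_mult_right_ennreal)
    finally have "ennpowr ((\<integral>\<^sup>+y\<in>I. ennreal \<bar>f y\<bar> \<partial>M) / emeasure M I) p \<le>
        ennpowr (SUP n. (\<integral>\<^sup>+y\<in>I. ennreal \<bar>fn n y\<bar> \<partial>M) / emeasure M I) p"
      using p by (intro ennpowr_mono) auto
    also have "\<dots> \<le> (SUP n. ennpowr (?M n x) p)"
    proof (rule ennpowr_SUP_le)
      fix n
      \<comment> \<open>The rectangle \<open>I\<close> is known to belong to \<open>Gn\<close> only
        from the index \<open>m\<close> on, while the function is truncated at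
        \<open>n\<close>.\<close>
      let ?k = "max m n"
      have "(\<integral>\<^sup>+y\<in>I. ennreal \<bar>fn n y\<bar> \<partial>M) / emeasure M I \<le> (\<integral>\<^sup>+y\<in>I. ennreal \<bar>fn ?k y\<bar> \<partial>M) / emeasure M I"
        by (intro divide_right_mono_ennreal nn_integral_mono mult_right_mono ennreal_leI fn_mono) auto
      also have "\<dots> \<le> ?M ?k x"
        unfolding maximal_function_def using m I Gn_mono[of m ?k] by (intro SUP_upper) auto
      finally have "ennpowr ((\<integral>\<^sup>+y\<in>I. ennreal \<bar>fn n y\<bar> \<partial>M) / emeasure M I) p \<le> ennpowr (?M ?k x) p"
        using p by (intro ennpowr_mono) auto
      also have "\<dots> \<le> (SUP n. ennpowr (?M n x) p)" by (rule SUP_upper) simp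
      finally show "ennpowr ((\<integral>\<^sup>+y\<in>I. ennreal \<bar>fn n y\<bar> \<partial>M) / emeasure M I) p \<le> (SUP n. ennpowr (?M n x) p)" .
    qed (use p in auto)
    finally show "ennpowr ((\<integral>\<^sup>+y\<in>I. ennreal \<bar>f y\<bar> \<partial>M) / emeasure M I) p \<le> (SUP n. ennpowr (?M n x) p)" .
  qed (use p in auto)
  have meas: "(\<lambda>x. ennpowr (?M n x) p) \<in> borel_measurable M" for n
    using Gn[of n] Gsets by (intro ennpowr_measurable maximal_function_measurable) (auto intro: countable_finite)
  have "(\<integral>\<^sup>+x. ennpowr (maximal_function M G f x) p \<partial>M) \<le> (\<integral>\<^sup>+x. (SUP n. ennpowr (?M n x) p) \<partial>M)"
    by (rule nn_integral_mono) (rule pointwise)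
  also have "\<dots> = (SUP n. \<integral>\<^sup>+x. ennpowr (?M n x) p \<partial>M)"
    using p meas by (intro nn_integral_monotone_convergence_SUP)
      (auto simp: incseq_def le_fun_def intro!: ennpowr_mono Mmono)
  also have "\<dots> \<le> ennreal ?K * ?I"
  proof (rule SUP_least)
    fix n
    have "(\<integral>\<^sup>+x. ennpowr (?M n x) p \<partial>M) \<le> ennreal ?K * (\<integral>\<^sup>+x. ennpowr (ennreal \<bar>fn n x\<bar>) p \<partial>M)"
      by (rule strong_type_finite[OF bx lb C Gn(1) GE p fn_meas, of n n]) (auto simp: fn_def)
    also have "\<dots> \<le> ennreal ?K * ?I"
      using p by (intro mult_left_mono nn_integral_mono ennpowr_mono ennreal_leI fn_le) auto
    finally show "(\<integral>\<^sup>+x. ennpowr (?M n x) p \<partial>M) \<le> ennreal ?K * ?I" .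
  qed
  finally show ?thesis .
qed

section \<open>Dyadic grids\<close>


lemma cube_fmeasurable:
  assumes "cube n k Q"
  shows "Q \<in> fmeasurable (borel_space n)" "0 < measure (borel_space n) Q"
proof -
  interpret finite_product_sigma_finite "\<lambda>_. lborel :: real measure" "{..<n}"
    by standard auto
  obtain a where a: "Q = (\<Pi>\<^sub>E j\<in>{..<n}. {a j ..< a j + 2 powi k})"
    using assms unfolding cube_def by blast
  have l: "0 < (2::real) powi k" by simp
  have "emeasure (borel_space n) Q = (\<Prod>j<n. emeasure lborel {a j ..< a j + 2 powi k})"
    unfolding a borel_space_def by (intro emeasure_PiM) auto
  also have "\<dots> = (\<Prod>j<n. ennreal (2 powi k))"
    using l by (intro prod.cong) (auto simp: less_imp_le)
  also have "\<dots> = ennreal ((2 powi k) ^ n)"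
    using l by (simp add: ennreal_power)
  finally have e: "emeasure (borel_space n) Q = ennreal ((2 powi k) ^ n)" .
  moreover have "Q \<in> sets (borel_space n)"
    unfolding a borel_space_def by (intro sets_PiM_I_finite) auto
  ultimately show "Q \<in> fmeasurable (borel_space n)" by (auto intro!: fmeasurableI)
  show "0 < measure (borel_space n) Q"
    unfolding measure_def e using l by simp
qed

text \<open>For countability: cubes of one side length are disjoint, and each contains a point with
  rational coordinates. Countability is what permits the exhaustion by finite families.\<close>

lemma dyadic_grid_boxes:
  assumes "dyadic_grid n D"
  shows "boxes (borel_space n) D" "nested D" "countable D"
proof -
  show "boxes (borel_space n) D"
    using assms cube_fmeasurable unfolding dyadic_grid_def boxes_def by (metis subsetI)
  show "nested D"
    using assms unfolding dyadic_grid_def nested_def by blast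
  let ?R = "{..<n} \<rightarrow>\<^sub>E \<rat> :: (nat \<Rightarrow> real) set"
  have "countable {Q\<in>D. cube n k Q}" for k
  proof -
    let ?D = "{Q\<in>D. cube n k Q}"
    have disj: "disjoint ?D"
      using assms unfolding dyadic_grid_def by (blast dest: partition_onD2)
    have "\<exists>q\<in>?R. q \<in> Q" if QD: "Q \<in> ?D" for Q
    proof -
      obtain a where a: "Q = (\<Pi>\<^sub>E j\<in>{..<n}. {a j ..< a j + 2 powi k})"
        using QD[THEN CollectD, THEN conjunct2] unfolding cube_def by (rule exE)
      have "\<exists>q\<in>\<rat>. a j < q \<and> q < a j + 2 powi k" for j
        by (intro Rats_dense_in_real) simp
      then obtain q where q: "\<And>j. q j \<in> \<rat>" "\<And>j. a j < q j" "\<And>j. q j < a j + 2 powi k" by metis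
      have "restrict q {..<n} \<in> ?R" "restrict q {..<n} \<in> Q"
        unfolding a using q by (auto simp: less_imp_le)
      then show ?thesis by blast
    qed
    then obtain q where q: "\<And>Q. Q \<in> ?D \<Longrightarrow> q Q \<in> ?R \<and> q Q \<in> Q" by metis
    have "inj_on q ?D"
    proof (rule inj_onI)
      fix Q R assume QR: "Q \<in> ?D" "R \<in> ?D" "q Q = q R"
      then have "q Q \<in> Q \<inter> R" using q[of Q] q[of R] by simp
      then show "Q = R" using disj QR(1,2) unfolding disjoint_def by blast
    qed
    moreover have "q ` ?D \<subseteq> ?R" using q by blast
    moreover have "countable ?R" by (intro countable_PiE) (auto simp: countable_rat)
    ultimately show ?thesis by (meson countable_image_inj_on countable_subset)
  qed
  then have "countable (\<Union>k. {Q\<in>D. cube n k Q})" by (intro countable_UN) auto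
  moreover have "D \<subseteq> (\<Union>k. {Q\<in>D. cube n k Q})"
    using assms unfolding dyadic_grid_def by fast
  ultimately show "countable D" by (rule countable_subset[rotated])
qed

lemma countable_rectangles:
  assumes "finite J" "\<And>i. i \<in> J \<Longrightarrow> countable (D i)"
  shows "countable (rectangles J D)"
proof -
  have "rectangles J D \<subseteq> Pi\<^sub>E J ` (Pi\<^sub>E J D)"
  proof
    fix R assume "R \<in> rectangles J D"
    then obtain I where I: "R = Pi\<^sub>E J I" "\<forall>i\<in>J. I i \<in> D i" by (rule rectanglesE)
    then have "restrict I J \<in> Pi\<^sub>E J D" "R = Pi\<^sub>E J (restrict I J)" by (auto cong: PiE_cong)
    then show "R \<in> Pi\<^sub>E J ` (Pi\<^sub>E J D)" by blast
  qed
  moreover have "countable (Pi\<^sub>E J ` (Pi\<^sub>E J D))"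
    using assms by (intro countable_image countable_PiE) auto
  ultimately show ?thesis by (rule countable_subset)
qed

lemma grid_rectangles_eq: "grid_rectangles m D = rectangles {..<m} D"
  unfolding grid_rectangles_def rectangles_def by (simp only: Ball_def lessThan_iff)

section \<open>From the product measure to Lebesgue measure\<close>

lemma level_bound_mono:
  assumes "level_bound M E C r" "C \<le> C'"
  shows "level_bound M E C' r"
  unfolding level_bound_def
proof (intro allI impI)
  fix F B K assume "finite F \<and> F \<subseteq> E \<and> incomparable F \<and> B \<in> fmeasurable M"
  then have "(\<Sum>k\<le>K. (1/2) ^ k * measure M (\<Union>{R\<in>F. level M B k R})) \<le> C * real (K + 1) ^ r * measure M B"
    by (intro level_boundD[OF assms(1)]) auto
  also have "\<dots> \<le> C' * real (K + 1) ^ r * measure M B"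
    using assms(2) by (intro mult_right_mono) auto
  finally show "(\<Sum>k\<le>K. (1/2) ^ k * measure M (\<Union>{R\<in>F. level M B k R})) \<le> C' * real (K + 1) ^ r * measure M B" .
qed

text \<open>Averages do not see null sets, so the two maximal functions agree at every point. A
  Lebesgue measurable \<open>f\<close> can thus be exchanged for a Borel measurable representative,
  and the completed measure for the product measure in which the induction took place.\<close>

lemma maximal_function_completion:
  assumes "G \<subseteq> sets M" "AE x in M. f x = g x"
  shows "maximal_function (completion M) G f = maximal_function M G g"
  unfolding maximal_function_def
proof (intro ext SUP_cong refl)
  fix x I assume "I \<in> {I\<in>G. x \<in> I}"
  then have "emeasure (completion M) I = emeasure M I" using assms(1) by (auto intro!: emeasure_completion)
  moreover have "(\<integral>\<^sup>+y\<in>I. ennreal \<bar>f y\<bar> \<partial>completion M) = (\<integral>\<^sup>+y\<in>I. ennreal \<bar>g y\<bar> \<partial>M)"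
    unfolding nn_integral_completion
    using assms(2) by (intro nn_integral_cong_AE) auto
  ultimately show "(\<integral>\<^sup>+y\<in>I. ennreal \<bar>f y\<bar> \<partial>completion M) / emeasure (completion M) I =
      (\<integral>\<^sup>+y\<in>I. ennreal \<bar>g y\<bar> \<partial>M) / emeasure M I" by simp
qed

theorem theorem3p1:
  fixes m d :: nat
  assumes "m \<ge> 2"
  shows "\<exists>C::real. \<forall>\<delta> :: nat \<Rightarrow> nat. (\<forall>i<m. \<delta> i \<ge> 1) \<and> (\<Sum>i<m. \<delta> i) = d \<longrightarrow>
    (\<forall>D G. (\<forall>i<m. dyadic_grid (\<delta> i) (D i)) \<and> G \<subseteq> grid_rectangles m D \<and> incomparable G \<longrightarrow>
      (\<forall>p f. 1 < p \<and> p \<le> 2 \<and> f \<in> Lp_space (lebesgue_blocks m \<delta>) p \<longrightarrow>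
        Lp_norm (lebesgue_blocks m \<delta>) p (maximal_function (lebesgue_blocks m \<delta>) G f)
          \<le> ennreal (C * (p / (p - 1)) ^ (m - 1))
            * Lp_norm (lebesgue_blocks m \<delta>) p (\<lambda>x. ennreal \<bar>f x\<bar>)))"
proof -
  define r where "r = m - 1"
  obtain C0 :: real where C0: "0 \<le> C0" "\<And>(J::nat set) (M::nat \<Rightarrow> (nat \<Rightarrow> real) measure) D.
     product_sigma_finite M \<and> finite J \<and> card J = Suc r \<and> (\<forall>i\<in>J. boxes (M i) (D i) \<and> nested (D i)) \<Longrightarrow>
     level_bound (Pi\<^sub>M J M) (rectangles J D) C0 r"
    using rectangle_bounds[of r, where 'a = "nat \<Rightarrow> real" and 'i = nat] by metis
  \<comment> \<open>The summand 1 provides the positive constant that \<open>strong_type\<close>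
    requires; the maximum with 1 in \<open>C\<close> lets the constant survive the root of order
    p.\<close>
  define C1 where "C1 = C0 + 1"
  define C where "C = max 1 (768 * C1 * poly_geometric r * 4 ^ r)"
  show ?thesis
  proof (intro exI[of _ C] allI impI)
    fix \<delta> :: "nat \<Rightarrow> nat" and D G and p :: real and f
    assume "(\<forall>i<m. \<delta> i \<ge> 1) \<and> (\<Sum>i<m. \<delta> i) = d"
    assume grids: "(\<forall>i<m. dyadic_grid (\<delta> i) (D i)) \<and> G \<subseteq> grid_rectangles m D \<and> incomparable G"
      and pf: "1 < p \<and> p \<le> 2 \<and> f \<in> Lp_space (lebesgue_blocks m \<delta>) p"
    define M where "M = Pi\<^sub>M {..<m} (\<lambda>i. borel_space (\<delta> i))"
    have L: "lebesgue_blocks m \<delta> = completion M" unfolding lebesgue_blocks_def M_def ..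
    have p: "1 < p" "p \<le> 2" using pf by auto
    have sf: "product_sigma_finite (\<lambda>i. borel_space (\<delta> i))"
    proof (rule product_sigma_finite.intro)
      fix i
      interpret finite_product_sigma_finite "\<lambda>_. lborel :: real measure" "{..<\<delta> i}" by standard auto
      show "sigma_finite_measure (borel_space (\<delta> i))"
        unfolding borel_space_def by (rule sigma_finite_measure_axioms)
    qed
    interpret product_sigma_finite "\<lambda>i. borel_space (\<delta> i)" by (rule sf)
    let ?E = "rectangles {..<m} D"
    have bx: "boxes M ?E"
      unfolding M_def using grids dyadic_grid_boxes(1) by (intro boxes_rectangles) auto
    have lb: "level_bound M ?E C1 r"
    proof (rule level_bound_mono)
      show "level_bound M ?E C0 r"
        unfolding M_def using grids dyadic_grid_boxes(1,2) sf assms by (intro C0(2)) (auto simp: r_def)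
    qed (simp add: C1_def)
    have G: "countable G" "G \<subseteq> ?E" "incomparable G"
    proof -
      show "G \<subseteq> ?E" "incomparable G" using grids grid_rectangles_eq by auto
      moreover have "countable ?E" using grids dyadic_grid_boxes(3) by (intro countable_rectangles) auto
      ultimately show "countable G" using countable_subset by blast
    qed
    have Gsets: "G \<subseteq> sets M" using G(2) bx unfolding boxes_def by auto
    have "f \<in> borel_measurable (completion M)" using pf unfolding L Lp_space_def by simp
    then obtain g where g: "g \<in> borel_measurable M" "AE x in M. f x = g x"
      using completion_ex_borel_measurable_real by blast
    let ?A = "\<integral>\<^sup>+x. ennpowr (maximal_function M G g x) p \<partial>M" and ?B = "\<integral>\<^sup>+x. ennpowr (ennreal \<bar>g x\<bar>) p \<partial>M"
    let ?K = "C * (p / (p - 1)) ^ (m - 1)"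
    have A: "Lp_norm (lebesgue_blocks m \<delta>) p (maximal_function (lebesgue_blocks m \<delta>) G f) = ennpowr ?A (1 / p)"
      unfolding Lp_norm_def L nn_integral_completion maximal_function_completion[OF Gsets g(2)] ..
    have "(\<integral>\<^sup>+x. ennpowr (ennreal \<bar>f x\<bar>) p \<partial>M) = ?B"
      using g(2) by (intro nn_integral_cong_AE) auto
    then have B: "Lp_norm (lebesgue_blocks m \<delta>) p (\<lambda>x. ennreal \<bar>f x\<bar>) = ennpowr ?B (1 / p)"
      unfolding Lp_norm_def L nn_integral_completion by simp
    have K: "1 \<le> ?K"
    proof -
      have "1 \<le> C" unfolding C_def by simp
      moreover have "1 \<le> (p / (p - 1)) ^ (m - 1)" using p by (intro one_le_power) simp
      ultimately show ?thesis using mult_mono[of 1 C 1 "(p / (p - 1)) ^ (m - 1)"] by simp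
    qed
    have "?A \<le> ennreal (768 * C1 * poly_geometric r * (4 / (p - 1)) ^ r) * ?B"
      using C0(1) by (intro strong_type[OF bx lb _ G p g(1)]) (simp add: C1_def)
    also have "\<dots> \<le> ennreal ?K * ?B"
    proof (intro mult_right_mono ennreal_leI)
      have "768 * C1 * poly_geometric r * (4 / (p - 1)) ^ r \<le> 768 * C1 * poly_geometric r * (4 * (p / (p - 1))) ^ r"
        using C0(1) poly_geometric_nonneg p divide_right_mono[of 4 "4 * p" "p - 1"]
        by (intro mult_left_mono power_mono mult_nonneg_nonneg) (auto simp: C1_def)
      also have "\<dots> = 768 * C1 * poly_geometric r * 4 ^ r * (p / (p - 1)) ^ r"
        by (simp only: power_mult_distrib mult_ac)
      also have "\<dots> \<le> ?K"
        unfolding r_def[symmetric] C_def using p by (intro mult_right_mono) auto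
      finally show "768 * C1 * poly_geometric r * (4 / (p - 1)) ^ r \<le> ?K" .
    qed auto
    finally have "ennpowr ?A (1 / p) \<le> ennpowr (ennreal ?K * ?B) (1 / p)"
      using p by (intro ennpowr_mono) auto
    also have "\<dots> \<le> ennreal ?K * ennpowr ?B (1 / p)"
      using K p by (intro ennpowr_times_le) auto
    finally show "Lp_norm (lebesgue_blocks m \<delta>) p (maximal_function (lebesgue_blocks m \<delta>) G f)
          \<le> ennreal ?K * Lp_norm (lebesgue_blocks m \<delta>) p (\<lambda>x. ennreal \<bar>f x\<bar>)"
      unfolding A B .
  qed
qed

end
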